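(* Let $\Gamma$ be a finite index subgroup of $\mathrm{SL}_2(\mathbf Z)$. Assume that the cusps of $X_\Gamma$ are fixed by the complex conjugation (if $\Gamma=\Gamma_1(N)$, this is the case if and only if $N$ divides $2p$ for some prime $p$). Then the pairing $\langle\cdot,\cdot\rangle$ on $\tilde{\mathcal M}_\Gamma^*$ is perfect after inverting $2$ and the least common multiple of the widths of the cusps of $X_\Gamma$.
   Context: Let $T=\begin{pmatrix}1&1\\0&1\end{pmatrix}$, $S=\begin{pmatrix}0&-1\\1&0\end{pmatrix}$. $X_\Gamma$ is the compact modular curve attached to $\Gamma$, with set of cusps $\mathcal C_\Gamma=\Gamma\backslash\mathbf P^1(\mathbf Q)$; the width of a cusp $c$ is the ramification index at $c$ of $X_\Gamma\to X_{\mathrm{SL}_2(\mathbf Z)}$. That the cusps are fixed by the complex conjugation means that $\Gamma\cdot(-x)=\Gamma\cdot x$ for all $x\in\mathbf P^1(\mathbf Q)$. Mixed modular symbols: $\tilde{\mathcal M}$ is the torsion-free abelian group generated by symbols $\{g,g'\}$, $(g,g')\in\mathrm{SL}_2(\mathbf Z)^2$, subject to: (1) $\{g,g'\}+\{g',g''\}+\{g'',g\}=0$; (2) $\{g,g'\}=\{\epsilon_1 g,\epsilon_2 g'\}$ for $\epsilon_1,\epsilon_2\in\{1,-1\}$; (3) $\{g,gT^m\}=m\cdot\{g,gT\}$ for $m\in\mathbf Z$. (That is, the quotient of the free abelian group by these relations, modulo torsion.) $\mathrm{SL}_2(\mathbf Z)$ acts on the left by $g\cdot\{g',g''\}=\{gg',gg''\}$,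 and $\tilde{\mathcal M}_\Gamma$ is the largest torsion-free quotient of $\tilde{\mathcal M}$ on which $\Gamma$ acts trivially. It is free of finite rank. Put $\tilde{\mathcal M}_\Gamma^*=\mathrm{Hom}_{\mathbf Z}(\tilde{\mathcal M}_\Gamma,\mathbf Z)$. The anti-symmetric bilinear pairing $\langle\cdot,\cdot\rangle:\tilde{\mathcal M}_\Gamma^*\times\tilde{\mathcal M}_\Gamma^*\to\frac16\mathbf Z$ is $$\langle\varphi_1,\varphi_2\rangle=\frac16\sum_{g\in\Gamma\backslash\mathrm{SL}_2(\mathbf Z)}\Big(\varphi_1(\{gS,g\})\varphi_2(\{gTS,gT\})-\varphi_1(\{gTS,gT\})\varphi_2(\{gS,g\})-4\varphi_1(\{g,gT\})\varphi_2(\{g,gS\})+4\varphi_1(\{g,gS\})\varphi_2(\{g,gT\})\Big).$$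
   Formalization: The parenthetical criterion for Γ_1(N) is stated for N ≠ 8 only, since it fails at N = 8: all cusps of X_{Γ_1(8)} are fixed by complex conjugation although 8 divides no 2p with p prime; the perfectness claim is not restricted. *)

theory Defs
  imports "HOL-Analysis.Analysis" "HOL-Algebra.Group_Action" "HOL-Algebra.Free_Abelian_Groups"
    "HOL-Computational_Algebra.Primes" "HOL-Number_Theory.Cong"
begin

subsection \<open>The modular group\<close>

type_synonym imat = "int^2^2"

definition SL2Z :: "imat monoid" where
  "SL2Z = \<lparr>carrier = {A. det A = 1}, monoid.mult = (**), one = mat 1\<rparr>"

definition matS :: imat where
  "matS = vector [vector [0, - 1], vector [1, 0]]"

definition matT :: imat where
  "matT = vector [vector [1, 1], vector [0, 1]]"

definition Gamma1 :: "nat \<Rightarrow> imat set" where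
  "Gamma1 N = {g \<in> carrier SL2Z.
     [g $ 1 $ 1 = 1] (mod int N) \<and> [g $ 2 $ 2 = 1] (mod int N) \<and> [g $ 2 $ 1 = 0] (mod int N)}"

definition finite_index_subgroup :: "imat set \<Rightarrow> bool" where
  "finite_index_subgroup \<Gamma> \<longleftrightarrow> subgroup \<Gamma> SL2Z \<and> finite (rcosets\<^bsub>SL2Z\<^esub> \<Gamma>)"


subsection \<open>The compact modular curve\<close>

text \<open>The projective line over the rationals, \<open>Fin q\<close> being the point \<open>[q : 1]\<close>.\<close>

datatype p1q = Fin rat | Infty

definition p1_act :: "imat \<Rightarrow> p1q \<Rightarrow> p1q" where
  "p1_act g x =
    (let a = of_int (g $ 1 $ 1); b = of_int (g $ 1 $ 2);
         c = of_int (g $ 2 $ 1); d = of_int (g $ 2 $ 2)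
     in case x of
          Infty \<Rightarrow> if c = 0 then Infty else Fin (a / c)
        | Fin q \<Rightarrow> if c * q + d = 0 then Infty else Fin (moebius a b c d q))"

definition p1_neg :: "p1q \<Rightarrow> p1q" where
  "p1_neg x = (case x of Infty \<Rightarrow> Infty | Fin q \<Rightarrow> Fin (- q))"

definition upper_half_plane :: "complex set" where
  "upper_half_plane = {z. Im z > 0}"

definition uhp_act :: "imat \<Rightarrow> complex \<Rightarrow> complex" where
  "uhp_act g = moebius (of_int (g $ 1 $ 1)) (of_int (g $ 1 $ 2))
                       (of_int (g $ 2 $ 1)) (of_int (g $ 2 $ 2))"

datatype hpoint = Inner complex | Cusp p1q

definition extended_uhp :: "hpoint set" where
  "extended_uhp = Inner ` upper_half_plane \<union> range Cusp"

definition h_act :: "imat \<Rightarrow> hpoint \<Rightarrow> hpoint" where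
  "h_act g p = (case p of Inner z \<Rightarrow> Inner (uhp_act g z) | Cusp x \<Rightarrow> Cusp (p1_act g x))"

text \<open>
  The usual topology on the extended upper half-plane: a fundamental system of neighbourhoods
  of the cusp \<open>g\<infinity>\<close> is given by \<open>g ({z. Im z > M} \<union> {\<infinity>})\<close>, \<open>M > 0\<close>.
\<close>

definition open_extended :: "hpoint set \<Rightarrow> bool" where
  "open_extended U \<longleftrightarrow> U \<subseteq> extended_uhp \<and> open {z. Inner z \<in> U} \<and>
     (\<forall>g \<in> carrier SL2Z. h_act g (Cusp Infty) \<in> U \<longrightarrow>
        (\<exists>M>0. \<forall>z. Im z > M \<longrightarrow> h_act g (Inner z) \<in> U))"

definition extended_topology :: "hpoint topology" where
  "extended_topology = topology open_extended"

definition h_orbit :: "imat set \<Rightarrow> hpoint \<Rightarrow> hpoint set" where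
  "h_orbit \<Gamma> = orbit (SL2Z\<lparr>carrier := \<Gamma>\<rparr>) h_act"

definition modular_curve_set :: "imat set \<Rightarrow> hpoint set set" where
  "modular_curve_set \<Gamma> = h_orbit \<Gamma> ` extended_uhp"

text \<open>The quotient topology.\<close>

definition open_modular_curve :: "imat set \<Rightarrow> hpoint set set \<Rightarrow> bool" where
  "open_modular_curve \<Gamma> W \<longleftrightarrow> W \<subseteq> modular_curve_set \<Gamma> \<and>
     openin extended_topology {p \<in> extended_uhp. h_orbit \<Gamma> p \<in> W}"

definition modular_curve :: "imat set \<Rightarrow> hpoint set topology" where
  "modular_curve \<Gamma> = topology (open_modular_curve \<Gamma>)"

definition cusps :: "imat set \<Rightarrow> hpoint set set" where
  "cusps \<Gamma> = h_orbit \<Gamma> ` range Cusp"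

text \<open>The covering from \<open>X\<^sub>\<Gamma>\<close> to the modular curve of the full modular group.\<close>

definition modular_covering :: "hpoint set \<Rightarrow> hpoint set" where
  "modular_covering C = (\<Union>p \<in> C. h_orbit (carrier SL2Z) p)"

text \<open>
  The ramification index of a non-constant holomorphic map \<open>f\<close> of Riemann surfaces at \<open>p\<close>, as
  the multiplicity with which \<open>f\<close> takes the value \<open>f p\<close> at \<open>p\<close>: arbitrarily close to \<open>p\<close>,
  every value near (but different from) \<open>f p\<close> is taken exactly \<open>e\<close> times.
\<close>

definition has_ramification_index ::
    "'a topology \<Rightarrow> 'b topology \<Rightarrow> ('a \<Rightarrow> 'b) \<Rightarrow> 'a \<Rightarrow> nat \<Rightarrow> bool" where
  "has_ramification_index TX TY f p e \<longleftrightarrow>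
     (\<forall>U\<^sub>0. openin TX U\<^sub>0 \<and> p \<in> U\<^sub>0 \<longrightarrow>
        (\<exists>U V. openin TX U \<and> p \<in> U \<and> U \<subseteq> U\<^sub>0 \<and> openin TY V \<and> f p \<in> V \<and>
           (\<forall>y \<in> V - {f p}. finite {x \<in> U. f x = y} \<and> card {x \<in> U. f x = y} = e)))"

definition cusp_width :: "imat set \<Rightarrow> hpoint set \<Rightarrow> nat" where
  "cusp_width \<Gamma> c =
     (THE e. has_ramification_index (modular_curve \<Gamma>) (modular_curve (carrier SL2Z))
               modular_covering c e)"

definition cusps_fixed_by_conjugation :: "imat set \<Rightarrow> bool" where
  "cusps_fixed_by_conjugation \<Gamma> \<longleftrightarrow>
     (\<forall>x. orbit (SL2Z\<lparr>carrier := \<Gamma>\<rparr>) p1_act (p1_neg x) = orbit (SL2Z\<lparr>carrier := \<Gamma>\<rparr>) p1_act x)"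

lemma istopology_open_extended: "istopology open_extended"
  unfolding istopology_def
proof (intro conjI allI impI)
  fix S T assume S: "open_extended S" and T: "open_extended T"
  have "open ({z. Inner z \<in> S} \<inter> {z. Inner z \<in> T})"
    using S T by (intro open_Int) (auto simp: open_extended_def)
  then have op: "open {z. Inner z \<in> S \<inter> T}"
    by (simp add: Int_def)
  have "\<exists>M>0. \<forall>z. Im z > M \<longrightarrow> h_act g (Inner z) \<in> S \<inter> T"
    if g: "g \<in> carrier SL2Z" and h: "h_act g (Cusp Infty) \<in> S \<inter> T" for g
  proof -
    obtain M where "M > 0" "\<forall>z. Im z > M \<longrightarrow> h_act g (Inner z) \<in> S"
      using S g h unfolding open_extended_def by blast
    moreover obtain M' where "M' > 0" "\<forall>z. Im z > M' \<longrightarrow> h_act g (Inner z) \<in> T"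
      using T g h unfolding open_extended_def by blast
    ultimately show ?thesis
      by (intro exI[of _ "max M M'"]) auto
  qed
  with op show "open_extended (S \<inter> T)"
    using S by (auto simp: open_extended_def)
next
  fix K assume K: "\<forall>S\<in>K. open_extended S"
  have "{z. Inner z \<in> \<Union>K} = (\<Union>S\<in>K. {z. Inner z \<in> S})"
    by auto
  then have "open {z. Inner z \<in> \<Union>K}"
    using K by (auto simp: open_extended_def intro!: open_UN)
  moreover have "\<exists>M>0. \<forall>z. Im z > M \<longrightarrow> h_act g (Inner z) \<in> \<Union>K"
    if "g \<in> carrier SL2Z" "h_act g (Cusp Infty) \<in> \<Union>K" for g
    using that K unfolding open_extended_def by (meson UnionE UnionI)
  ultimately show "open_extended (\<Union>K)"
    using K unfolding open_extended_def by blast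
qed

lemma openin_extended_topology: "openin extended_topology = open_extended"
  by (simp add: extended_topology_def istopology_open_extended topology_inverse')

lemma istopology_open_modular_curve: "istopology (open_modular_curve \<Gamma>)"
  unfolding istopology_def
proof (intro conjI allI impI)
  fix S T assume "open_modular_curve \<Gamma> S" "open_modular_curve \<Gamma> T"
  moreover have "{p \<in> extended_uhp. h_orbit \<Gamma> p \<in> S \<inter> T} =
      {p \<in> extended_uhp. h_orbit \<Gamma> p \<in> S} \<inter> {p \<in> extended_uhp. h_orbit \<Gamma> p \<in> T}"
    by auto
  ultimately show "open_modular_curve \<Gamma> (S \<inter> T)"
    by (auto simp: open_modular_curve_def)
next
  fix K assume "\<forall>S\<in>K. open_modular_curve \<Gamma> S"
  moreover have "{p \<in> extended_uhp. h_orbit \<Gamma> p \<in> \<Union>K} =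
      (\<Union>S\<in>K. {p \<in> extended_uhp. h_orbit \<Gamma> p \<in> S})"
    by auto
  ultimately show "open_modular_curve \<Gamma> (\<Union>K)"
    by (auto simp: open_modular_curve_def)
qed

lemma openin_modular_curve: "openin (modular_curve \<Gamma>) = open_modular_curve \<Gamma>"
  by (simp add: modular_curve_def istopology_open_modular_curve topology_inverse')


subsection \<open>Torsion-free quotients\<close>

definition torsion_elements :: "('a, 'b) monoid_scheme \<Rightarrow> 'a set" where
  "torsion_elements G = {x \<in> carrier G. \<exists>n::nat. n > 0 \<and> x [^]\<^bsub>G\<^esub> n = \<one>\<^bsub>G\<^esub>}"

text \<open>
  For an abelian group \<open>G\<close> and a set \<open>R\<close> of elements of \<open>G\<close>: the quotient of \<open>G\<close> by the subgroup
  generated by \<open>R\<close>, modulo torsion, that is, the largest torsion-free quotient of \<open>G\<close> in which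
  \<open>R\<close> becomes trivial; and the canonical projection to it.
\<close>

definition torsion_free_quotient :: "('a, 'b) monoid_scheme \<Rightarrow> 'a set \<Rightarrow> 'a set set monoid" where
  "torsion_free_quotient G R =
     (G Mod generate G R) Mod torsion_elements (G Mod generate G R)"

definition tf_class :: "('a, 'b) monoid_scheme \<Rightarrow> 'a set \<Rightarrow> 'a \<Rightarrow> 'a set set" where
  "tf_class G R x =
     torsion_elements (G Mod generate G R) #>\<^bsub>G Mod generate G R\<^esub> (generate G R #>\<^bsub>G\<^esub> x)"


subsection \<open>Mixed modular symbols\<close>

type_synonym symbol_sum = "(imat \<times> imat) \<Rightarrow>\<^sub>0 int"

definition symbol_group :: "symbol_sum monoid" where
  "symbol_group = free_Abelian_group (carrier SL2Z \<times> carrier SL2Z)"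

definition symbol_relators :: "symbol_sum set" where
  "symbol_relators =
     {frag_of (g, g') + frag_of (g', g'') + frag_of (g'', g) | g g' g''.
        g \<in> carrier SL2Z \<and> g' \<in> carrier SL2Z \<and> g'' \<in> carrier SL2Z} \<union>
     {frag_of (g, g') - frag_of (mat \<epsilon>\<^sub>1 ** g, mat \<epsilon>\<^sub>2 ** g') | g g' \<epsilon>\<^sub>1 \<epsilon>\<^sub>2.
        g \<in> carrier SL2Z \<and> g' \<in> carrier SL2Z \<and> \<epsilon>\<^sub>1 \<in> {1, - 1} \<and> \<epsilon>\<^sub>2 \<in> {1, - 1}} \<union>
     {frag_of (g, g ** (matT [^]\<^bsub>SL2Z\<^esub> m)) - frag_cmul m (frag_of (g, g ** matT)) | g m::int.
        g \<in> carrier SL2Z}"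

definition mixed_symbols :: "symbol_sum set set monoid" where
  "mixed_symbols = torsion_free_quotient symbol_group symbol_relators"

definition mixed_symbol :: "imat \<Rightarrow> imat \<Rightarrow> symbol_sum set set" where
  "mixed_symbol g g' = tf_class symbol_group symbol_relators (frag_of (g, g'))"

text \<open>
  Elements of \<open>mixed_symbols\<close> are cosets of cosets; since \<open>g\<close> acts on \<open>symbol_group\<close> by an
  automorphism that permutes the relators, the induced action is by taking (iterated) images.
\<close>

definition symbol_act :: "imat \<Rightarrow> symbol_sum \<Rightarrow> symbol_sum" where
  "symbol_act g = frag_extend (\<lambda>(g', g''). frag_of (g ** g', g ** g''))"

definition mixed_act :: "imat \<Rightarrow> symbol_sum set set \<Rightarrow> symbol_sum set set" where
  "mixed_act g m = (\<lambda>C. symbol_act g ` C) ` m"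

definition coinvariant_relators :: "imat set \<Rightarrow> symbol_sum set set set" where
  "coinvariant_relators \<Gamma> =
     {mixed_act \<gamma> m \<otimes>\<^bsub>mixed_symbols\<^esub> inv\<^bsub>mixed_symbols\<^esub> m | \<gamma> m.
        \<gamma> \<in> \<Gamma> \<and> m \<in> carrier mixed_symbols}"

definition mixed_symbols_mod :: "imat set \<Rightarrow> symbol_sum set set set set monoid" where
  "mixed_symbols_mod \<Gamma> = torsion_free_quotient mixed_symbols (coinvariant_relators \<Gamma>)"

definition mixed_symbol_mod :: "imat set \<Rightarrow> imat \<Rightarrow> imat \<Rightarrow> symbol_sum set set set set" where
  "mixed_symbol_mod \<Gamma> g g' =
     tf_class mixed_symbols (coinvariant_relators \<Gamma>) (mixed_symbol g g')"


subsection \<open>Duals, localisation and perfect pairings\<close>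

text \<open>
  \<open>Hom(M, \<int>)\<close>. Homomorphisms are extended by \<open>0\<close> outside the carrier, so that they are
  determined by their values on \<open>M\<close> and addition is pointwise addition of functions.
\<close>

definition int_dual :: "('a, 'b) monoid_scheme \<Rightarrow> ('a \<Rightarrow> int) set" where
  "int_dual M = {\<phi> \<in> hom M integer_group. \<forall>x. x \<notin> carrier M \<longrightarrow> \<phi> x = 0}"

text \<open>The ring \<open>\<int>[1/N]\<close>.\<close>

definition Z_inverting :: "nat \<Rightarrow> rat set" where
  "Z_inverting N = {x. \<exists>k. of_nat N ^ k * x \<in> \<int>}"

text \<open>
  \<open>Hom(M, \<int>) \<otimes> \<int>[1/N]\<close>. As \<open>Hom(M, \<int>)\<close> is torsion-free, for \<open>N > 0\<close> this localisation is
  the module of fractions \<open>\<phi> / N ^ k\<close> inside the rational-valued functions.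
\<close>

definition localized_dual :: "nat \<Rightarrow> ('a, 'b) monoid_scheme \<Rightarrow> ('a \<Rightarrow> rat) set" where
  "localized_dual N M = {(\<lambda>x. of_int (\<phi> x) / of_nat N ^ k) | \<phi> k. \<phi> \<in> int_dual M}"

definition linear_forms :: "rat set \<Rightarrow> ('a \<Rightarrow> rat) set \<Rightarrow> (('a \<Rightarrow> rat) \<Rightarrow> rat) set" where
  "linear_forms R L = {l \<in> L \<rightarrow>\<^sub>E R.
     (\<forall>\<phi>\<in>L. \<forall>\<psi>\<in>L. l (\<lambda>x. \<phi> x + \<psi> x) = l \<phi> + l \<psi>) \<and>
     (\<forall>r\<in>R. \<forall>\<phi>\<in>L. l (\<lambda>x. r * \<phi> x) = r * l \<phi>)}"

text \<open>
  Perfectness of a pairing on an \<open>R\<close>-module \<open>L\<close>: it takes values in \<open>R\<close> and both maps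
  from \<open>L\<close> to \<open>Hom\<^sub>R(L, R)\<close> that it induces are isomorphisms. (Bijectivity on to \<open>linear_forms\<close>
  includes that the pairing is \<open>R\<close>-valued and linear in either argument.)
\<close>

definition perfect_pairing ::
    "rat set \<Rightarrow> ('a \<Rightarrow> rat) set \<Rightarrow> (('a \<Rightarrow> rat) \<Rightarrow> ('a \<Rightarrow> rat) \<Rightarrow> rat) \<Rightarrow> bool" where
  "perfect_pairing R L B \<longleftrightarrow>
     bij_betw (\<lambda>\<phi>. \<lambda>\<psi>\<in>L. B \<phi> \<psi>) L (linear_forms R L) \<and>
     bij_betw (\<lambda>\<psi>. \<lambda>\<phi>\<in>L. B \<phi> \<psi>) L (linear_forms R L)"


subsection \<open>The pairing\<close>

text \<open>
  The formula is stated for rational-valued homomorphisms, so that it gives both the pairing on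
  \<open>Hom(M, \<int>)\<close> and its bilinear extension to the localisations. The summand does not depend on
  the representative \<open>g\<close> of the coset.
\<close>

definition mixed_pairing ::
    "imat set \<Rightarrow> (symbol_sum set set set set \<Rightarrow> rat) \<Rightarrow> (symbol_sum set set set set \<Rightarrow> rat) \<Rightarrow> rat"
  where
  "mixed_pairing \<Gamma> \<phi>\<^sub>1 \<phi>\<^sub>2 = 1 / 6 *
     (\<Sum>C \<in> rcosets\<^bsub>SL2Z\<^esub> \<Gamma>.
        let g = (SOME g. g \<in> C); sym = mixed_symbol_mod \<Gamma> in
            \<phi>\<^sub>1 (sym (g ** matS) g) * \<phi>\<^sub>2 (sym (g ** matT ** matS) (g ** matT))
          - \<phi>\<^sub>1 (sym (g ** matT ** matS) (g ** matT)) * \<phi>\<^sub>2 (sym (g ** matS) g)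
          - 4 * \<phi>\<^sub>1 (sym g (g ** matT)) * \<phi>\<^sub>2 (sym g (g ** matS))
          + 4 * \<phi>\<^sub>1 (sym g (g ** matS)) * \<phi>\<^sub>2 (sym g (g ** matT)))"

definition perfect_after_inverting :: "nat \<Rightarrow> imat set \<Rightarrow> bool" where
  "perfect_after_inverting N \<Gamma> \<longleftrightarrow>
     perfect_pairing (Z_inverting N) (localized_dual N (mixed_symbols_mod \<Gamma>)) (mixed_pairing \<Gamma>)"

end

theory Submission
  imports Defs
begin

text \<open>
  A homomorphism from \<open>mixed_symbols_mod \<Gamma>\<close> to the integers is a \<open>\<plusminus>\<Gamma>\<close>-invariant cocycle on the
  modular group. It is determined by its values \<open>a g\<close>, \<open>b g\<close> on \<open>{g, gS}\<close> and \<open>{g, gT}\<close>. As the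
  modular group acts on a tree, these values may be prescribed arbitrarily, subject to
  antisymmetry under \<open>S\<close>, invariance of \<open>b\<close> under \<open>T\<close> and one relation for every orbit of
  \<open>U = ST\<close>, that is, for every triangle of the Farey tessellation.

  On the finite set of cosets one writes down, over the ring where 2 and the widths are inverted,
  explicit solutions \<open>\<phi>\<close> with \<open>\<langle>\<phi>, \<psi>\<rangle> = a\<^sub>\<psi> x\<close> and with \<open>\<langle>\<phi>, \<psi>\<rangle> = b\<^sub>\<psi> x\<close> for all \<open>\<psi>\<close>: coboundaries of
  indicator functions of cusps for the latter, and sawtooth functions along the two cusps joined by
  an edge for the former. Hence the pairing is nondegenerate, and a linear form \<open>l\<close> is represented
  by the cochain whose values are those of \<open>- l\<close> on these elements.

  The factor 1/6 leaves integrality at 3. The explicit elements realise all possible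
  functions \<open>b\<close>, so one may assume \<open>b = 0\<close> for the first argument; up to a
  term with total zero, the contribution of every triangle is then divisible by 3. The index of ramification at a cusp is computed with horoballs.
\<close>

subsection \<open>Cochains on a finite set with an action of the modular group\<close>

text \<open>No basis and no determinant is used. Once the evaluations at edges and cusps are
  pairings with explicit cochains, a form \<open>l\<close> leaves no choice for the cochain that
  represents it, and the relations required of that cochain are relations between explicit cochains,
  which nondegeneracy carries over to \<open>l\<close>. The obstacle is that the sawtooth of one
  cusp violates the triangle relation, in exactly one triangle. Two sawtooth functions whose jumps
  belong to the same triangle cancel there; this fixes the jumps \<open>t_inv x\<close> and
  \<open>s x\<close> for the edge \<open>x\<close>. Their difference pairs to \<open>4 * a x\<close>
  directly, and the triangle relation turns the other two edges of the triangle into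
  \<open>2 * a x\<close> more, which matches the factor 1/6 up to terms in \<open>b\<close>. The
  prime 2 enters three times: in the coefficients that remove those terms in \<open>b\<close>, as a
  possible number of cosets of \<Gamma> in a coset of \<plusminus>\<Gamma>, and because the sum over
  triangles is shown to be divisible by 3 where 6 is wanted. The widths enter as slopes of the
  sawteeth and as normalisations of cusp indicators.\<close>

text \<open>
  The maps \<open>s\<close>, \<open>u\<close>, \<open>t\<close> stand for right multiplication by \<open>S\<close>, \<open>ST\<close>, \<open>T\<close> on the cosets of \<open>\<plusminus>\<Gamma>\<close>,
  and a cochain \<open>(a, b)\<close> for the values of a cocycle on the symbols \<open>{g, gS}\<close> and \<open>{g, gT}\<close>.
  The value of \<open>s\<close> and \<open>u\<close> outside of \<open>X\<close> is irrelevant; assuming the identities everywhere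
  makes them unconditional rewrite rules.
\<close>

locale triangle_set =
  fixes X :: "'x set" and s u :: "'x \<Rightarrow> 'x"
  assumes finite_X: "finite X"
    and s_in_iff [simp]: "s x \<in> X \<longleftrightarrow> x \<in> X" and u_in_iff [simp]: "u x \<in> X \<longleftrightarrow> x \<in> X"
    and s_s [simp]: "s (s x) = x" and u_u_u [simp]: "u (u (u x)) = x"
begin

lemma s_eq_iff: "s x = y \<longleftrightarrow> x = s y" and u_eq_iff: "u x = y \<longleftrightarrow> x = u (u y)" by auto

definition t :: "'x \<Rightarrow> 'x" where "t x = u (s x)"

definition t_inv :: "'x \<Rightarrow> 'x" where "t_inv x = s (u (u x))"

lemma t_in_iff [simp]: "t x \<in> X \<longleftrightarrow> x \<in> X" and t_inv_in_iff [simp]: "t_inv x \<in> X \<longleftrightarrow> x \<in> X"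
  by (simp_all add: t_def t_inv_def)

lemma t_t_inv [simp]: "t (t_inv x) = x" and t_inv_t [simp]: "t_inv (t x) = x"
  by (simp_all add: t_def t_inv_def)

lemma sum_s: "(\<Sum>x\<in>X. f (s x)) = (\<Sum>x\<in>X. f x)"
  by (rule sum.reindex_bij_witness[of _ s s]) auto

lemma sum_u: "(\<Sum>x\<in>X. f (u x)) = (\<Sum>x\<in>X. f x)"
  by (rule sum.reindex_bij_witness[of _ "\<lambda>x. u (u x)" u]) auto

lemma sum_t: "(\<Sum>x\<in>X. f (t x)) = (\<Sum>x\<in>X. f x)"
  by (rule sum.reindex_bij_witness[of _ t_inv t]) auto

section \<open>Cochains and their pairing\<close>

definition cochain :: "rat set \<Rightarrow> ('x \<Rightarrow> rat) \<Rightarrow> ('x \<Rightarrow> rat) \<Rightarrow> bool" where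
  "cochain S a b \<longleftrightarrow>
     (\<forall>x. a x \<in> S \<and> b x \<in> S) \<and> (\<forall>x. x \<notin> X \<longrightarrow> a x = 0 \<and> b x = 0) \<and>
     (\<forall>x. a (s x) = - a x) \<and> (\<forall>x. b (t x) = b x) \<and>
     (\<forall>x. a x + a (u x) + a (u (u x)) + b (s x) + b (s (u x)) + b (s (u (u x))) = 0)"

text \<open>The sum in the pairing, without the factor 1/6 and taken over cosets of
  \<plusminus>\<Gamma>. The reversed symbols \<open>{gS, g}\<close> occur in pairs, so their signs
  cancel and \<open>a\<close> can stand for \<open>{g, gS}\<close> throughout.\<close>

definition pair_form ::
    "('x \<Rightarrow> rat) \<Rightarrow> ('x \<Rightarrow> rat) \<Rightarrow> ('x \<Rightarrow> rat) \<Rightarrow> ('x \<Rightarrow> rat) \<Rightarrow> rat" where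
  "pair_form a\<^sub>1 b\<^sub>1 a\<^sub>2 b\<^sub>2 =
     (\<Sum>x\<in>X. a\<^sub>1 x * a\<^sub>2 (t x) - a\<^sub>1 (t x) * a\<^sub>2 x - 4 * b\<^sub>1 x * a\<^sub>2 x + 4 * a\<^sub>1 x * b\<^sub>2 x)"

lemma pair_form_anti: "pair_form a\<^sub>2 b\<^sub>2 a\<^sub>1 b\<^sub>1 = - pair_form a\<^sub>1 b\<^sub>1 a\<^sub>2 b\<^sub>2"
  unfolding pair_form_def sum_negf[symmetric] by (intro sum.cong) (auto simp: algebra_simps)

lemma pair_form_diff_left:
  "pair_form (\<lambda>x. a x - a' x) (\<lambda>x. b x - b' x) c d = pair_form a b c d - pair_form a' b' c d"
  unfolding pair_form_def sum_subtractf[symmetric] by (intro sum.cong) (auto simp: algebra_simps)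

lemma pair_form_add_left:
  "pair_form (\<lambda>x. a x + a' x) (\<lambda>x. b x + b' x) c d = pair_form a b c d + pair_form a' b' c d"
  unfolding pair_form_def sum.distrib[symmetric] by (intro sum.cong) (auto simp: algebra_simps)

lemma pair_form_scale_left:
  "pair_form (\<lambda>x. r * a x) (\<lambda>x. r * b x) c d = r * pair_form a b c d"
  unfolding pair_form_def sum_distrib_left by (intro sum.cong) (auto simp: algebra_simps)

lemma pair_form_sum_left:
  assumes "finite I"
  shows "pair_form (\<lambda>x. \<Sum>i\<in>I. a i x) (\<lambda>x. \<Sum>i\<in>I. b i x) c d = (\<Sum>i\<in>I. pair_form (a i) (b i) c d)"
  using assms
proof (induction I)
  case empty
  then show ?case by (simp add: pair_form_def)
next
  case (insert i I)
  have "pair_form (\<lambda>x. a i x - (- (\<Sum>i\<in>I. a i x))) (\<lambda>x. b i x - (- (\<Sum>i\<in>I. b i x))) c d =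
     pair_form (a i) (b i) c d - (-1) * (\<Sum>i\<in>I. pair_form (a i) (b i) c d)"
    unfolding pair_form_diff_left insert.IH[symmetric] pair_form_scale_left[symmetric] by simp
  with insert show ?case by simp
qed

lemma cochain_t_inv: 
  assumes "cochain S a b" shows "b (t_inv x) = b x"
  using assms t_t_inv unfolding cochain_def by metis

text \<open>Summation by parts. \<open>D\<close> measures how far \<open>f\<close> is from being
  constant on cusps; the triangle relation gathers everything else into \<open>f x * b x\<close>.
  The function \<open>b\<^sub>1\<close> stays free because the first pair need not be a cochain: the
  sawtooth functions are inserted here one at a time.\<close>

lemma pair_form_gradient:
  fixes f :: "'x \<Rightarrow> rat"
  assumes c: "cochain S a b"
  defines "D \<equiv> \<lambda>x. f (t x) - f x"
  shows "pair_form (\<lambda>x. f x - f (s x)) b\<^sub>1 a b =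
    6 * (\<Sum>x\<in>X. f x * b x) - 4 * (\<Sum>x\<in>X. b\<^sub>1 x * a x) +
    (\<Sum>x\<in>X. D x * (- 2 * a x - 2 * a (t x) + b x + b (s x) - b (s (t x))))"
proof -
  have as: "a (s x) = - a x" and bt: "b (t x) = b x" for x
    using c by (auto simp: cochain_def)
  have rel: "a x + a (u x) + a (u (u x)) + b (s x) + b (s (u x)) + b (s (u (u x))) = 0" for x
    using c unfolding cochain_def by blast
  \<comment> \<open>The triangle through \<open>s x\<close>, solved for the one edge value that the
    reindexed sums produce.\<close>
  have tri: "a (t_inv (s x)) = - a x + a (t x) + b x + b (s (t x)) + b (s x)" for x
  proof -
    have "b (s (u (u (s x)))) = b (s x)"
      using cochain_t_inv[OF c, of "s x"] by (simp add: t_inv_def)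
    then show ?thesis using rel[of "s x"] by (simp add: t_inv_def t_def as)
  qed
  have e2: "(\<Sum>x\<in>X. f (t x) * a (t x)) = (\<Sum>x\<in>X. f x * a x)" by (rule sum_t)
  have e3: "(\<Sum>x\<in>X. f (s x) * b x) = (\<Sum>x\<in>X. f x * b (s x))"
    using sum_s[of "\<lambda>x. f x * b (s x)"] by simp
  have e4: "(\<Sum>x\<in>X. f (s x) * a (t x)) = - (\<Sum>x\<in>X. a (t_inv (s x)) * f (t x))"
  proof -
    have "(\<Sum>x\<in>X. f (s x) * a (t x)) = (\<Sum>x\<in>X. f x * a (t (s x)))"
      using sum_s[of "\<lambda>x. f x * a (t (s x))"] by simp
    also have "\<dots> = (\<Sum>x\<in>X. f (t x) * a (t (s (t x))))"
      using sum_t[of "\<lambda>x. f x * a (t (s x))"] by simp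
    also have "\<dots> = (\<Sum>x\<in>X. - (a (t_inv (s x)) * f (t x)))"
    proof (rule sum.cong)
      fix x
      \<comment> \<open>This is the relation \<open>(ST)^3 = 1\<close> up to sign, as seen on
        cosets.\<close>
      have "t_inv (s x) = s (t (s (t x)))" by (simp add: t_def t_inv_def)
      then show "f (t x) * a (t (s (t x))) = - (a (t_inv (s x)) * f (t x))"
        by (simp add: as)
    qed simp
    finally show ?thesis by (simp add: sum_negf)
  qed
  have e5: "(\<Sum>x\<in>X. f (s (t x)) * a x) = (\<Sum>x\<in>X. a (t_inv (s x)) * f x)"
    by (rule sum.reindex_bij_witness[of _ "\<lambda>x. t_inv (s x)" "\<lambda>x. s (t x)"]) auto
  have e6: "(\<Sum>x\<in>X. f x * b (s (t x))) = (\<Sum>x\<in>X. f x * b (s x)) - (\<Sum>x\<in>X. D x * b (s (t x)))"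
    using sum_t[of "\<lambda>x. f x * b (s x)"] by (simp add: D_def algebra_simps sum_subtractf)
  have "pair_form (\<lambda>x. f x - f (s x)) b\<^sub>1 a b =
      (\<Sum>x\<in>X. f x * a (t x)) - (\<Sum>x\<in>X. f (s x) * a (t x)) - (\<Sum>x\<in>X. f (t x) * a x)
      + (\<Sum>x\<in>X. f (s (t x)) * a x) - 4 * (\<Sum>x\<in>X. b\<^sub>1 x * a x) + 4 * (\<Sum>x\<in>X. f x * b x)
      - 4 * (\<Sum>x\<in>X. f (s x) * b x)"
    unfolding pair_form_def sum_distrib_left sum_subtractf[symmetric] sum.distrib[symmetric]
    by (intro sum.cong) (auto simp: algebra_simps)
  also have "\<dots> = (\<Sum>x\<in>X. f x * a (t x)) + (\<Sum>x\<in>X. a (t_inv (s x)) * (2 * f x + D x))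
     - (\<Sum>x\<in>X. f (t x) * a x) - 4 * (\<Sum>x\<in>X. b\<^sub>1 x * a x) + 4 * (\<Sum>x\<in>X. f x * b x)
      - 4 * (\<Sum>x\<in>X. f x * b (s x))"
    unfolding e3 e4 e5 by (simp add: D_def algebra_simps sum.distrib sum_subtractf sum_distrib_left)
  also have "\<dots> = 6 * (\<Sum>x\<in>X. f x * b x) - 4 * (\<Sum>x\<in>X. b\<^sub>1 x * a x) +
    (\<Sum>x\<in>X. D x * (- 2 * a x - 2 * a (t x) + b x + b (s x) - b (s (t x))))"
  proof -
    have "(\<Sum>x\<in>X. a (t_inv (s x)) * (2 * f x + D x)) =
        2 * (\<Sum>x\<in>X. f x * a (t x)) - 2 * (\<Sum>x\<in>X. f x * a x) + 2 * (\<Sum>x\<in>X. f x * b x)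
        + 2 * (\<Sum>x\<in>X. f x * b (s (t x))) + 2 * (\<Sum>x\<in>X. f x * b (s x))
        + (\<Sum>x\<in>X. D x * (- a x + a (t x) + b x + b (s (t x)) + b (s x)))"
      unfolding sum_distrib_left sum.distrib[symmetric] sum_subtractf[symmetric] tri
      by (intro sum.cong) (simp_all add: algebra_simps)
    moreover have "(\<Sum>x\<in>X. D x * (- 2 * a x - 2 * a (t x) + b x + b (s x) - b (s (t x)))) =
        (\<Sum>x\<in>X. D x * (- a x + a (t x) + b x + b (s (t x)) + b (s x)))
        - (\<Sum>x\<in>X. D x * a x) - 3 * (\<Sum>x\<in>X. D x * a (t x)) - 2 * (\<Sum>x\<in>X. D x * b (s (t x)))"
      unfolding sum_distrib_left sum.distrib[symmetric] sum_subtractf[symmetric]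
      by (intro sum.cong) (simp_all add: algebra_simps)
    moreover have "(\<Sum>x\<in>X. D x * a x) = (\<Sum>x\<in>X. f (t x) * a x) - (\<Sum>x\<in>X. f x * a x)"
        "(\<Sum>x\<in>X. D x * a (t x)) = (\<Sum>x\<in>X. f (t x) * a (t x)) - (\<Sum>x\<in>X. f x * a (t x))"
      unfolding sum_subtractf[symmetric] D_def by (simp_all add: algebra_simps)
    ultimately show ?thesis using e2 e6 by linarith
  qed
  finally show ?thesis .
qed


section \<open>Cycles of \<open>t\<close>: the cusps and their widths\<close>

definition cyc :: "'x \<Rightarrow> 'x set" where "cyc x = {(t ^^ k) x | k. True}"

definition width :: "'x \<Rightarrow> nat" where "width x = (LEAST k. k > 0 \<and> (t ^^ k) x = x)"

lemma inj_t: "inj t" by (metis injI t_inv_t)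

lemma t_pow_in_iff [simp]: "(t ^^ k) x \<in> X \<longleftrightarrow> x \<in> X" by (induction k) auto

lemma width:
  assumes "x \<in> X"
  shows "width x > 0" "(t ^^ width x) x = x"
proof -
  have "\<not> inj_on (\<lambda>k. (t ^^ k) x) UNIV"
  proof
    assume "inj_on (\<lambda>k. (t ^^ k) x) UNIV"
    moreover have "(\<lambda>k. (t ^^ k) x) ` UNIV \<subseteq> X" using assms by auto
    ultimately show False
      using finite_X by (meson finite_imageD finite_subset infinite_UNIV_nat)
  qed
  then obtain i j where "i \<noteq> j" and ij: "(t ^^ i) x = (t ^^ j) x"
    unfolding inj_on_def by blast
  have "\<exists>k>0. (t ^^ k) x = x" if "(t ^^ i) x = (t ^^ j) x" "i < j" for i j
  proof -
    have "(t ^^ i) ((t ^^ (j - i)) x) = (t ^^ i) x"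
      using that by (simp add: funpow_add[symmetric, THEN fun_cong, simplified o_def])
    then have "(t ^^ (j - i)) x = x" using inj_fn[OF inj_t, of i] by (auto dest: injD)
    with that show ?thesis by (intro exI[of _ "j - i"]) auto
  qed
  with ij \<open>i \<noteq> j\<close> have "\<exists>k>0. (t ^^ k) x = x" by (metis linorder_neqE_nat)
  then have "width x > 0 \<and> (t ^^ width x) x = x" unfolding width_def by (rule LeastI_ex)
  then show "width x > 0" "(t ^^ width x) x = x" by auto
qed

lemma width_le: "k > 0 \<Longrightarrow> (t ^^ k) x = x \<Longrightarrow> width x \<le> k"
  unfolding width_def by (rule Least_le) simp

lemma cyc_refl [simp]: "x \<in> cyc x"
  unfolding cyc_def by (rule CollectI, rule exI[of _ 0]) simp

lemma cyc_t_iff [simp]: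
  assumes "x \<in> X"
  shows "t y \<in> cyc x \<longleftrightarrow> y \<in> cyc x"
proof
  assume "t y \<in> cyc x"
  then obtain k where k: "t y = (t ^^ k) x" by (auto simp: cyc_def)
  \<comment> \<open>One full turn is added so that the exponent also makes sense for
    \<open>k = 0\<close>.\<close>
  have "(t ^^ (width x + k - 1)) x = y"
  proof (rule injD[OF inj_t])
    have "t ((t ^^ (width x + k - 1)) x) = (t ^^ (k + width x)) x"
      using width(1)[OF assms] by (cases "width x") (auto simp: add.commute)
    also have "\<dots> = (t ^^ k) x" using width(2)[OF assms] by (simp add: funpow_add)
    finally show "t ((t ^^ (width x + k - 1)) x) = t y" using k by simp
  qed
  then show "y \<in> cyc x" by (auto simp: cyc_def)
next
  assume "y \<in> cyc x"
  then obtain k where "y = (t ^^ k) x" by (auto simp: cyc_def)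
  then have "t y = (t ^^ Suc k) x" by simp
  then show "t y \<in> cyc x" unfolding cyc_def by blast
qed

lemma cyc_subset: "x \<in> X \<Longrightarrow> cyc x \<subseteq> X" by (auto simp: cyc_def)

lemma cyc_t:
  assumes "x \<in> X" shows "cyc (t x) = cyc x"
proof
  have "(t ^^ k) (t x) \<in> cyc x" for k using assms by (induction k) auto
  then show "cyc (t x) \<subseteq> cyc x" by (auto simp: cyc_def)
  have "t x \<in> cyc (t x)" by simp
  then have "x \<in> cyc (t x)" using cyc_t_iff[of "t x" x] assms by simp
  then have "(t ^^ k) x \<in> cyc (t x)" for k using assms by (induction k) auto
  then show "cyc x \<subseteq> cyc (t x)" by (auto simp: cyc_def)
qed

lemma cyc_eq:
  assumes "x \<in> X" "y \<in> cyc x" shows "cyc y = cyc x"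
proof -
  obtain k where "y = (t ^^ k) x" using assms(2) by (auto simp: cyc_def)
  moreover have "cyc ((t ^^ k) x) = cyc x"
    using assms(1) by (induction k) (auto simp: cyc_t)
  ultimately show ?thesis by simp
qed

lemma cyc_eq_image:
  assumes "x \<in> X" shows "cyc x = (\<lambda>k. (t ^^ k) x) ` {..<width x}"
proof -
  have "(t ^^ k) x = (t ^^ (k mod width x)) x" for k
    using funpow_mod_eq[OF width(2)[OF assms]] by simp
  moreover have "k mod width x < width x" for k using width(1)[OF assms] by simp
  ultimately show ?thesis unfolding cyc_def by blast
qed

lemma inj_on_width:
  assumes "x \<in> X" shows "inj_on (\<lambda>k. (t ^^ k) x) {..<width x}"
proof (rule linorder_inj_onI)
  fix i j assume "i < j" and ij: "i \<in> {..<width x}" "j \<in> {..<width x}"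
  show "(t ^^ i) x \<noteq> (t ^^ j) x"
  proof
    assume "(t ^^ i) x = (t ^^ j) x"
    then have "(t ^^ i) ((t ^^ (j - i)) x) = (t ^^ i) x"
      using \<open>i < j\<close> by (simp add: funpow_add[symmetric, THEN fun_cong, simplified o_def])
    then have "(t ^^ (j - i)) x = x" using inj_fn[OF inj_t, of i] by (auto dest: injD)
    then have "width x \<le> j - i" using \<open>i < j\<close> by (intro width_le) auto
    with ij show False by simp
  qed
qed auto

lemma card_cyc: "x \<in> X \<Longrightarrow> card (cyc x) = width x"
  by (simp add: cyc_eq_image card_image inj_on_width)

lemma width_t_pow: "x \<in> X \<Longrightarrow> width ((t ^^ k) x) = width x"
proof -
  assume x: "x \<in> X"
  have "(t ^^ k) x \<in> cyc x" by (auto simp: cyc_def)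
  with x show ?thesis
    using card_cyc[of "(t ^^ k) x"] card_cyc[of x] cyc_eq[of x "(t ^^ k) x"] by simp
qed

text \<open>A function that rises by the same amount at every step of a cycle has to fall back
  somewhere. Placing the fall at \<open>x\<close> turns the difference of \<open>f\<close> into a
  constant minus a point mass at \<open>x\<close>, and the point mass is what singles out one
  edge.\<close>

lemma sawtooth:
  assumes x: "x \<in> X"
  obtains f :: "'x \<Rightarrow> rat" where
    "\<And>y. f (t y) - f y = (if y \<in> cyc x then 1 / of_nat (width x) else 0) - (if y = x then 1 else 0)"
    "\<And>y. y \<notin> cyc x \<Longrightarrow> f y = 0"
    "\<And>y. \<exists>n. f y = of_nat n / of_nat (width x)"
proof -
  let ?w = "width x"
  \<comment> \<open>Positions are counted from \<open>t x\<close>, so that \<open>x\<close> comes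
    last and the fall from \<open>(w - 1) / w\<close> to 0 takes place between \<open>x\<close> and
    \<open>t x\<close>.\<close>
  define k where "k = (\<lambda>y. inv_into {..<?w} (\<lambda>k. (t ^^ k) (t x)) y)"
  have w: "width (t x) = ?w" "cyc (t x) = cyc x" "t x \<in> X"
    using width_t_pow[OF x, of 1] x by (auto simp: cyc_t)
  have k: "k ((t ^^ i) (t x)) = i" if "i < ?w" for i
    unfolding k_def using inj_on_width[OF w(3)] that unfolding w
    by (intro inv_into_f_f) auto
  have im: "cyc x = (\<lambda>k. (t ^^ k) (t x)) ` {..<?w}"
    using cyc_eq_image[OF w(3)] by (simp add: w)
  define f :: "'x \<Rightarrow> rat" where "f y = (if y \<in> cyc x then of_nat (k y) / of_nat ?w else 0)" for y
  have wpos: "?w > 0" using width x by blast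
  have "f (t y) - f y = (if y \<in> cyc x then 1 / of_nat ?w else 0) - (if y = x then 1 else 0)" for y
  proof (cases "y \<in> cyc x")
    case True
    then obtain i where i: "i < ?w" "y = (t ^^ i) (t x)" using im by auto
    then have f: "f y = of_nat i / of_nat ?w" using True by (simp add: f_def k)
    have x': "(t ^^ (?w - 1)) (t x) = x"
    proof -
      have "(t ^^ (?w - 1)) (t x) = (t ^^ Suc (?w - 1)) x" by (simp only: funpow_Suc_right o_def)
      then show ?thesis using wpos width(2)[OF x] by simp
    qed
    have iff: "y = x \<longleftrightarrow> i = ?w - 1"
    proof
      assume "y = x"
      then have "k y = k ((t ^^ (?w - 1)) (t x))" using x' by simp
      then show "i = ?w - 1" using i k wpos by auto
    next
      assume "i = ?w - 1" then show "y = x" using x' i by simp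
    qed
    have ty: "t y \<in> cyc x" using True x by simp
    show ?thesis
    proof (cases "y = x")
      case yx: True
      then have "f (t y) = 0" using ty k[of 0] wpos by (simp add: f_def)
      moreover have "(of_nat (?w - 1) :: rat) = of_nat ?w - 1" using wpos by (simp add: of_nat_diff)
      ultimately show ?thesis using f True iff yx wpos by (simp add: field_simps)
    next
      case False
      then have "Suc i < ?w" using iff i by auto
      then have "k (t y) = Suc i" using k[of "Suc i"] i by simp
      then have "f (t y) = of_nat (Suc i) / of_nat ?w" using ty by (simp add: f_def)
      then show ?thesis using True False by (simp add: f add_divide_distrib)
    qed
  next
    case False
    then show ?thesis using x by (auto simp: f_def)
  qed
  then show ?thesis by (rule that) (auto simp: f_def intro: exI[of _ 0] exI[of _ "k _"])
qed

lemma sum_cyc_indicator: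
  "x \<in> X \<Longrightarrow> (\<Sum>y\<in>X. (if y \<in> cyc x then g y else 0)) = (\<Sum>y\<in>cyc x. g y)"
  using cyc_subset finite_X by (simp add: sum.If_cases Int_absorb1)

lemma cochain_cyc:
  assumes "cochain S a b" "y \<in> cyc x" shows "b y = b x"
proof -
  have "b ((t ^^ k) x) = b x" for k using assms(1) by (induction k) (auto simp: cochain_def)
  then show ?thesis using assms(2) by (auto simp: cyc_def)
qed

lemma sum_cyc_t:
  assumes "x \<in> X"
  shows "(\<Sum>y\<in>cyc x. g (t y)) = (\<Sum>y\<in>cyc x. (g y :: rat))"
  using assms cyc_t_iff[OF assms, of "t_inv _"]
  by (intro sum.reindex_bij_witness[of _ t_inv t]) auto

text \<open>For \<open>f\<close> constant on cusps the correction term of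
  \<open>pair_form_gradient\<close> vanishes, and \<open>b\<close> is constant on the cycle, whose
  length the factor \<open>1 / of_nat (width x)\<close> compensates.\<close>

lemma pair_form_cusp:
  assumes x: "x \<in> X" and c: "cochain S a b"
  defines "f \<equiv> \<lambda>y. if y \<in> cyc x then 1 / of_nat (width x) else 0"
  shows "pair_form (\<lambda>y. f y - f (s y)) (\<lambda>_. 0) a b = 6 * b x"
proof -
  have "(\<Sum>y\<in>X. f y * b y) = (\<Sum>y\<in>X. if y \<in> cyc x then b x / of_nat (width x) else 0)"
    using cochain_cyc[OF c] by (intro sum.cong) (auto simp: f_def)
  also have "\<dots> = b x" using x width[of x] by (simp add: sum_cyc_indicator card_cyc)
  finally have "(\<Sum>y\<in>X. f y * b y) = b x" .
  moreover have "f (t y) - f y = 0" for y using x by (simp add: f_def)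
  ultimately show ?thesis using pair_form_gradient[OF c, of f "\<lambda>_. 0"] by simp
qed

text \<open>The constant slope of the sawtooth contributes an average of \<open>a\<close> over the
  whole cusp. The cusp part \<open>- g\<close> is chosen to cancel this average, so that only the
  values of \<open>a\<close> next to the jump survive.\<close>

lemma pair_form_sawtooth:
  assumes x: "x \<in> X" and c: "cochain S a b"
    and f: "\<And>y. f (t y) - f y =
      (if y \<in> cyc x then 1 / of_nat (width x) else 0) - (if y = x then 1 else 0)"
    "\<And>y. y \<notin> cyc x \<Longrightarrow> f y = 0"
  defines "g \<equiv> \<lambda>y. if y \<in> cyc x then 1 / of_nat (width x) else 0"
  shows "pair_form (\<lambda>y. f y - f (s y)) (\<lambda>y. - g y) a b =
    2 * a x + 2 * a (t x) + b (s (t x)) - b (s x) + 6 * (\<Sum>y\<in>X. f y) * b x"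
proof -
  let ?w = "of_nat (width x) :: rat"
  have w: "?w \<noteq> 0" using width x by simp
  have ga: "(\<Sum>y\<in>X. g y * h y) = (\<Sum>y\<in>cyc x. h y) / ?w" for h
  proof -
    have "(\<Sum>y\<in>X. g y * h y) = (\<Sum>y\<in>X. if y \<in> cyc x then h y / ?w else 0)"
      by (intro sum.cong) (auto simp: g_def)
    then show ?thesis using x by (simp add: sum_cyc_indicator sum_divide_distrib)
  qed
  have bt: "b (t y) = b y" for y using c by (simp add: cochain_def)
  let ?h = "\<lambda>y. - 2 * a y - 2 * a (t y) + b y + b (s y) - b (s (t y))"
  have "(\<Sum>y\<in>X. f y * b y) = (\<Sum>y\<in>X. f y) * b x" unfolding sum_distrib_right
  proof (intro sum.cong refl)
    fix y show "f y * b y = f y * b x"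
      using f(2)[of y] cochain_cyc[OF c, of y x] by (cases "y \<in> cyc x") auto
  qed
  moreover have "(\<Sum>y\<in>X. (f (t y) - f y) * ?h y) = (\<Sum>y\<in>X. g y * ?h y) - ?h x"
  proof -
    have "(\<Sum>y\<in>X. (f (t y) - f y) * ?h y) = (\<Sum>y\<in>X. g y * ?h y - (if y = x then ?h y else 0))"
      by (intro sum.cong) (auto simp: f g_def algebra_simps)
    also have "\<dots> = (\<Sum>y\<in>X. g y * ?h y) - ?h x"
      unfolding sum_subtractf using x finite_X by (subst sum.delta) auto
    finally show ?thesis .
  qed
  \<comment> \<open>Around the full cycle \<open>b (s y)\<close> and \<open>b (s (t y))\<close>
    cancel, whereas the two terms in \<open>a\<close> add up.\<close>
  moreover have "(\<Sum>y\<in>cyc x. ?h y) = - 4 * (\<Sum>y\<in>cyc x. a y) + ?w * b x"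
  proof -
    have "(\<Sum>y\<in>cyc x. b y) = (\<Sum>y\<in>cyc x. b x)"
      using cochain_cyc[OF c] by (intro sum.cong) auto
    then have "(\<Sum>y\<in>cyc x. b y) = ?w * b x" using x by (simp add: card_cyc)
    moreover have "(\<Sum>y\<in>cyc x. a (t y)) = (\<Sum>y\<in>cyc x. a y)"
        "(\<Sum>y\<in>cyc x. b (s (t y))) = (\<Sum>y\<in>cyc x. b (s y))"
      using sum_cyc_t[OF x] sum_cyc_t[OF x, of "\<lambda>y. b (s y)"] by auto
    ultimately show ?thesis
      by (simp add: sum.distrib sum_subtractf sum_distrib_left[symmetric] sum_negf)
  qed
  ultimately have "6 * (\<Sum>y\<in>X. f y * b y) - 4 * (\<Sum>y\<in>X. - g y * a y) + (\<Sum>y\<in>X. (f (t y) - f y) * ?h y)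
     = 6 * ((\<Sum>y\<in>X. f y) * b x) + 4 * ((\<Sum>y\<in>cyc x. a y) / ?w)
       + ((- 4 * (\<Sum>y\<in>cyc x. a y) + ?w * b x) / ?w - ?h x)"
    by (simp only: ga mult_minus_left sum_negf)
  also have "\<dots> = 2 * a x + 2 * a (t x) + b (s (t x)) - b (s x) + 6 * (\<Sum>y\<in>X. f y) * b x"
    using w by (simp add: add_divide_distrib diff_divide_distrib)
  finally show ?thesis unfolding pair_form_gradient[OF c] .
qed


lemma cyc_width_eq: "x \<in> X \<Longrightarrow> y \<in> cyc x \<Longrightarrow> width y = width x"
  using card_cyc[of x] card_cyc[of y] cyc_eq[of x y] cyc_subset[of x] by auto

lemma cyc_sym: "x \<in> X \<Longrightarrow> y \<in> cyc x \<Longrightarrow> x \<in> cyc y" using cyc_eq[of x y] cyc_refl[of x] by blast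

lemma cyc_sym_iff: "x \<in> X \<Longrightarrow> y \<in> X \<Longrightarrow> x \<in> cyc y \<longleftrightarrow> y \<in> cyc x" using cyc_sym by blast

text \<open>Adding all triangle relations gives three times the sum of \<open>b\<close>, since
  \<open>a\<close> is odd under \<open>s\<close>. Like the residue theorem, this is the constraint
  on cusp parts; it is why differences of cusp functions suffice to build them.\<close>

lemma cochain_sum_zero:
  assumes "cochain S a b" shows "(\<Sum>x\<in>X. b x) = 0"
proof -
  have "(\<Sum>x\<in>X. a x) = - (\<Sum>x\<in>X. a x)"
    using sum_s[of a] assms by (simp add: cochain_def sum_negf)
  moreover have "(\<Sum>x\<in>X. a x + a (u x) + a (u (u x)) + b (s x) + b (s (u x)) + b (s (u (u x)))) = 0"
    using assms unfolding cochain_def by (intro sum.neutral) blast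
  ultimately show ?thesis
    by (simp add: sum.distrib sum_u sum_u[of "\<lambda>x. _ (u x)"] sum_s sum_u[of "\<lambda>x. b (s x)"]
        sum_u[of "\<lambda>x. b (s (u x))"])
qed

text \<open>Orbits of \<open>u\<close> have three elements or one. At an elliptic point the sum over
  the orbit has one summand rather than three, so the hypothesis on triangles says nothing about it
  and \<open>h1\<close> is asked separately.\<close>

lemma sum_orbits_dvd_3:
  assumes S: "\<And>p q. p \<in> S \<Longrightarrow> q \<in> S \<Longrightarrow> p + q \<in> S" "0 \<in> S"
    and h3: "\<And>x. \<exists>k\<in>S. h x + h (u x) + h (u (u x)) = 3 * k"
    and h1: "\<And>x. u x = x \<Longrightarrow> \<exists>k\<in>S. h x = 3 * k"
    and Y: "finite Y" "\<And>x. x \<in> Y \<Longrightarrow> u x \<in> Y"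
  shows "\<exists>k\<in>S. (\<Sum>x\<in>Y. h x) = 3 * (k :: rat)" using Y
proof (induction Y rule: finite_psubset_induct)
  case (psubset Y)
  show ?case
  proof (cases "Y = {}")
    case True
    then show ?thesis using S by (intro bexI[of _ 0]) auto
  next
    case False
    then obtain x where x: "x \<in> Y" by auto
    let ?O = "{x, u x, u (u x)}"
    have O: "?O \<subseteq> Y" using x psubset by auto
    have "u y \<in> Y - ?O" if y: "y \<in> Y - ?O" for y
    proof -
      have "u y \<notin> ?O"
      proof
        assume "u y \<in> ?O"
        then have "y \<in> {u (u x), u (u (u x)), u (u (u (u x)))}"
          by (simp only: u_eq_iff insert_iff empty_iff)
        then show False using y by simp
      qed
      then show ?thesis using y psubset by auto
    qed
    then obtain k where k: "k \<in> S" "(\<Sum>x\<in>Y - ?O. h x) = 3 * k"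
      using psubset.IH[of "Y - ?O"] x by blast
    have "\<exists>k\<in>S. (\<Sum>x\<in>?O. h x) = 3 * k"
    proof (cases "u x = x")
      case True
      then show ?thesis using h1[OF True] by simp
    next
      case False
      have "u (u x) \<noteq> x" "u (u x) \<noteq> u x" using False u_u_u[of x] by metis+
      then show ?thesis using False h3[of x] by (auto simp: add.assoc)
    qed
    then obtain k' where k': "k' \<in> S" "(\<Sum>x\<in>?O. h x) = 3 * k'" by blast
    have "(\<Sum>x\<in>Y. h x) = (\<Sum>x\<in>Y - ?O. h x) + (\<Sum>x\<in>?O. h x)"
      using O psubset.hyps by (intro sum.subset_diff) auto
    then show ?thesis using k k' S by (intro bexI[of _ "k + k'"]) auto
  qed
qed

lemma pair_form_parabolic:
  assumes S: "\<And>p q. p \<in> S \<Longrightarrow> q \<in> S \<Longrightarrow> p + q \<in> S" "\<And>p q. p \<in> S \<Longrightarrow> q \<in> S \<Longrightarrow> p * q \<in> S"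
      "1 \<in> S" "- 1 \<in> S"
    and c1: "cochain S a\<^sub>1 (\<lambda>_. 0)" and c2: "cochain S a\<^sub>2 b\<^sub>2"
  shows "\<exists>k\<in>S. pair_form a\<^sub>1 (\<lambda>_. 0) a\<^sub>2 b\<^sub>2 = 3 * k"
proof -
  have neg: "- p \<in> S" if "p \<in> S" for p using S(2)[OF S(4) that] by simp
  have diff: "p - q \<in> S" if "p \<in> S" "q \<in> S" for p q using S(1)[OF that(1) neg[OF that(2)]] by simp
  have zero: "0 \<in> S" using S(1)[OF S(3,4)] by simp
  have two: "2 \<in> S" using S(1)[OF S(3,3)] by simp
  have a1: "a\<^sub>1 x \<in> S" "a\<^sub>1 (s x) = - a\<^sub>1 x" and a2: "a\<^sub>2 x \<in> S" "b\<^sub>2 x \<in> S" "a\<^sub>2 (s x) = - a\<^sub>2 x"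
    and b2: "b\<^sub>2 (t x) = b\<^sub>2 x" for x using c1 c2 by (auto simp: cochain_def)
  have r1: "a\<^sub>1 x + a\<^sub>1 (u x) + a\<^sub>1 (u (u x)) = 0" for x using c1 by (simp add: cochain_def)
  have r2: "a\<^sub>2 x + a\<^sub>2 (u x) + a\<^sub>2 (u (u x)) + b\<^sub>2 (s x) + b\<^sub>2 (s (u x)) + b\<^sub>2 (s (u (u x)))
    = 0" for x
    using c2 unfolding cochain_def by blast
  \<comment> \<open>The last summand has total zero over \<open>X\<close>, but within one triangle
    it removes the residue modulo 3 left by the values of \<open>b\<^sub>2\<close>.\<close>
  define h where "h v = a\<^sub>1 (u v) * a\<^sub>2 v - a\<^sub>1 v * a\<^sub>2 (u v) - 4 * (a\<^sub>1 v * b\<^sub>2 (s v))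
    + a\<^sub>1 v * b\<^sub>2 (s (u v))" for v
  have form: "pair_form a\<^sub>1 (\<lambda>_. 0) a\<^sub>2 b\<^sub>2 =
      (\<Sum>v\<in>X. a\<^sub>1 (u v) * a\<^sub>2 v - a\<^sub>1 v * a\<^sub>2 (u v) - 4 * (a\<^sub>1 v * b\<^sub>2 (s v)))"
    unfolding pair_form_def
    by (rule sum.reindex_bij_witness[of _ s s]) (auto simp: t_def a1 a2 algebra_simps)
  \<comment> \<open>\<open>?\<beta>\<close> is constant on triangles, where \<open>a\<^sub>1\<close>
    sums to zero. Of its three parts, \<open>b\<^sub>2 (s v)\<close> and
    \<open>b\<^sub>2 (s (u (u v))) = b\<^sub>2 v\<close> cancel against each other because
    \<open>a\<^sub>1\<close> is odd under \<open>s\<close>, so the middle part has total zero as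
    well.\<close>
  have "(\<Sum>v\<in>X. a\<^sub>1 v * b\<^sub>2 (s (u v))) = 0"
  proof -
    let ?\<beta> = "\<lambda>v. b\<^sub>2 (s v) + b\<^sub>2 (s (u v)) + b\<^sub>2 (s (u (u v)))"
    have "(\<Sum>v\<in>X. a\<^sub>1 (u v) * ?\<beta> v) = (\<Sum>v\<in>X. a\<^sub>1 v * ?\<beta> v)"
      using sum_u[of "\<lambda>v. a\<^sub>1 v * ?\<beta> v"] by (simp add: add_ac)
    moreover have "(\<Sum>v\<in>X. a\<^sub>1 (u (u v)) * ?\<beta> v) = (\<Sum>v\<in>X. a\<^sub>1 (u v) * ?\<beta> v)"
      using sum_u[of "\<lambda>v. a\<^sub>1 (u v) * ?\<beta> v"] by (simp add: add_ac)
    moreover have "(\<Sum>v\<in>X. a\<^sub>1 v * ?\<beta> v) + (\<Sum>v\<in>X. a\<^sub>1 (u v) * ?\<beta> v) + (\<Sum>v\<in>X. a\<^sub>1 (u (u v)) * ?\<beta> v) = 0"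
    proof -
      have "a\<^sub>1 v * ?\<beta> v + a\<^sub>1 (u v) * ?\<beta> v + a\<^sub>1 (u (u v)) * ?\<beta> v = 0" for v
        using r1[of v] by (simp add: distrib_right[symmetric] del: distrib_right_numeral)
      then show ?thesis unfolding sum.distrib[symmetric] by (intro sum.neutral) blast
    qed
    ultimately have "(\<Sum>v\<in>X. a\<^sub>1 v * ?\<beta> v) = 0" by linarith
    moreover have "b\<^sub>2 (s (u (u v))) = b\<^sub>2 v" for v
      using cochain_t_inv[OF c2, of v] by (simp add: t_inv_def)
    moreover have "(\<Sum>v\<in>X. a\<^sub>1 v * b\<^sub>2 (s v)) = - (\<Sum>v\<in>X. a\<^sub>1 v * b\<^sub>2 v)"
      using sum_s[of "\<lambda>v. a\<^sub>1 v * b\<^sub>2 (s v)"] by (simp add: a1 sum_negf)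
    ultimately show ?thesis by (simp add: distrib_left sum.distrib)
  qed
  then have eq: "pair_form a\<^sub>1 (\<lambda>_. 0) a\<^sub>2 b\<^sub>2 = (\<Sum>v\<in>X. h v)"
    by (simp add: form h_def sum.distrib)
  have "\<exists>k\<in>S. h x + h (u x) + h (u (u x)) = 3 * k" for x
  proof -
    have x2: "a\<^sub>1 (u (u x)) = - a\<^sub>1 x - a\<^sub>1 (u x)"
      and y2: "a\<^sub>2 (u (u x)) = - a\<^sub>2 x - a\<^sub>2 (u x) - b\<^sub>2 (s x) - b\<^sub>2 (s (u x)) - b\<^sub>2 (s (u (u x)))"
      using r1[of x] r2[of x] by linarith+
    let ?k = "a\<^sub>1 (u x) * a\<^sub>2 x - a\<^sub>1 x * a\<^sub>2 (u x) + a\<^sub>1 x * (b\<^sub>2 (s (u (u x))) - 2 * b\<^sub>2 (s x))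
        + a\<^sub>1 (u x) * (2 * b\<^sub>2 (s (u (u x))) - b\<^sub>2 (s (u x)))"
    have "h x + h (u x) + h (u (u x)) = 3 * ?k"
      unfolding h_def by (simp add: x2 y2 algebra_simps)
    moreover have "?k \<in> S" by (intro S(1) S(2) diff a1 a2 two)
    ultimately show ?thesis by blast
  qed
  moreover have "\<exists>k\<in>S. h x = 3 * k" if "u x = x" for x
  proof -
    \<comment> \<open>At a fixed point of \<open>u\<close> the triangle relation reads
      \<open>3 * a\<^sub>1 x = 0\<close>.\<close>
    have "a\<^sub>1 x = 0" using r1[of x] that by simp
    then show ?thesis using zero that by (intro bexI[of _ 0]) (auto simp: h_def)
  qed
  ultimately show ?thesis
    unfolding eq using S zero finite_X by (intro sum_orbits_dvd_3) auto
qed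

end

section \<open>Coefficients in a ring containing 1/2 and the inverses of the widths\<close>

locale triangle_set_over = triangle_set X s u for X :: "'x set" and s u +
  fixes R :: "rat set"
  assumes R_add: "p \<in> R \<Longrightarrow> q \<in> R \<Longrightarrow> p + q \<in> R"
    and R_mult: "p \<in> R \<Longrightarrow> q \<in> R \<Longrightarrow> p * q \<in> R"
    and R_one: "1 \<in> R" and R_minus_one: "- 1 \<in> R" and R_half: "1 / 2 \<in> R"
    and R_width: "x \<in> X \<Longrightarrow> 1 / of_nat (width x) \<in> R"
    and connected: "\<lbrakk>x \<in> X; y \<in> X; P x; \<And>z. z \<in> X \<Longrightarrow> P z \<Longrightarrow> P (s z);
                     \<And>z. z \<in> X \<Longrightarrow> P z \<Longrightarrow> P (u z)\<rbrakk> \<Longrightarrow> P y"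
begin

lemma R_neg: "p \<in> R \<Longrightarrow> - p \<in> R" using R_mult[OF R_minus_one] by simp

lemma R_diff: "p \<in> R \<Longrightarrow> q \<in> R \<Longrightarrow> p - q \<in> R" using R_add[OF _ R_neg] by fastforce

lemma R_zero: "0 \<in> R" using R_add[OF R_one R_minus_one] by simp

lemma R_nat: "of_nat n \<in> R" by (induction n) (auto intro: R_zero R_one R_add)

lemma R_sum: "(\<And>i. i \<in> I \<Longrightarrow> f i \<in> R) \<Longrightarrow> (\<Sum>i\<in>I. f i) \<in> R"
  by (induction I rule: infinite_finite_induct) (auto intro: R_zero R_add)

lemma R_numeral: "numeral n \<in> R" using R_nat[of "numeral n"] by simp

lemma cochain_triangle:
  "cochain S a b \<Longrightarrow> a x + a (u x) + a (u (u x)) + b (s x) + b (s (u x)) + b (s (u (u x))) = 0"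
  by (simp add: cochain_def)

lemma cochain_zero: "cochain R (\<lambda>_. 0) (\<lambda>_. 0)" by (auto simp: cochain_def R_zero)

lemma cochain_add:
  assumes "cochain R a b" "cochain R a' b'"
  shows "cochain R (\<lambda>x. a x + a' x) (\<lambda>x. b x + b' x)" unfolding cochain_def
proof (intro conjI allI)
  fix x
  show "a x + a' x + (a (u x) + a' (u x)) + (a (u (u x)) + a' (u (u x))) +
      (b (s x) + b' (s x)) + (b (s (u x)) + b' (s (u x))) + (b (s (u (u x))) + b' (s (u (u x)))) = 0"
    using cochain_triangle[OF assms(1), of x] cochain_triangle[OF assms(2), of x] by linarith
qed (use assms in \<open>simp_all add: cochain_def R_add\<close>)

lemma cochain_scale:
  assumes "cochain R a b" "r \<in> R"
  shows "cochain R (\<lambda>x. r * a x) (\<lambda>x. r * b x)" unfolding cochain_def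
proof (intro conjI allI)
  fix x
  show "r * a x + r * a (u x) + r * a (u (u x)) + r * b (s x) + r * b (s (u x))
    + r * b (s (u (u x))) = 0"
    using cochain_triangle[OF assms(1), of x] by (simp only: distrib_left[symmetric])
qed (use assms in \<open>simp_all add: cochain_def R_mult\<close>)

lemma cochain_diff:
  assumes "cochain R a b" "cochain R a' b'"
  shows "cochain R (\<lambda>x. a x - a' x) (\<lambda>x. b x - b' x)"
  using cochain_add[OF assms(1) cochain_scale[OF assms(2) R_minus_one]] by simp

lemma cochain_sum:
  assumes "\<And>i. i \<in> I \<Longrightarrow> cochain R (a i) (b i)"
  shows "cochain R (\<lambda>x. \<Sum>i\<in>I. a i x) (\<lambda>x. \<Sum>i\<in>I. b i x)" using assms
  by (induction I rule: infinite_finite_induct) (auto simp: cochain_zero cochain_add)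

text \<open>Normalised to have total 1. This makes it symmetric on \<open>X\<close>, a reproducing
  kernel for functions that are constant on cusps, and the potential whose coboundary pairs to
  \<open>6 * b x\<close>.\<close>

definition cusp_fun :: "'x \<Rightarrow> 'x \<Rightarrow> rat" where
  "cusp_fun x y = (if y \<in> cyc x then 1 / of_nat (width x) else 0)"

lemma cusp_fun_t: "x \<in> X \<Longrightarrow> cusp_fun x (t y) = cusp_fun x y" by (simp add: cusp_fun_def)

lemma cusp_fun_cong: "x \<in> X \<Longrightarrow> y \<in> cyc x \<Longrightarrow> cusp_fun y = cusp_fun x"
  unfolding cusp_fun_def fun_eq_iff using cyc_eq[of x y] cyc_width_eq[of x y] by simp

lemma cusp_fun_in_R: "x \<in> X \<Longrightarrow> cusp_fun x y \<in> R" by (simp add: cusp_fun_def R_width R_zero)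

lemma cusp_fun_outside: "x \<in> X \<Longrightarrow> y \<notin> X \<Longrightarrow> cusp_fun x y = 0"
  using cyc_subset by (auto simp: cusp_fun_def)

lemma cusp_fun_sym: "x \<in> X \<Longrightarrow> y \<in> X \<Longrightarrow> cusp_fun x y = cusp_fun y x"
  unfolding cusp_fun_def using cyc_sym_iff[of x y] cyc_width_eq[of x y] by auto

text \<open>Invariance under \<open>t\<close> says
  \<open>cusp_fun x (u v) = cusp_fun x (s v)\<close>, so the coboundary telescopes around each
  triangle and needs no cusp part.\<close>

lemma cusp_generator:
  assumes x: "x \<in> X"
  shows "cochain R (\<lambda>y. cusp_fun x y - cusp_fun x (s y)) (\<lambda>_. 0)"
    and "cochain S a b \<Longrightarrow> pair_form (\<lambda>y. cusp_fun x y - cusp_fun x (s y)) (\<lambda>_. 0) a b = 6 * b x"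
proof -
  have "cusp_fun x (u v) = cusp_fun x (s v)" for v
    using cusp_fun_t[OF x, of "s v"] by (simp add: t_def)
  from this this[of "u (u _)"] show "cochain R (\<lambda>y. cusp_fun x y - cusp_fun x (s y)) (\<lambda>_. 0)"
    using x by (auto simp: cochain_def cusp_fun_in_R R_diff R_zero cusp_fun_outside)
  show "pair_form (\<lambda>y. cusp_fun x y - cusp_fun x (s y)) (\<lambda>_. 0) a b = 6 * b x" if "cochain S a b"
    using pair_form_cusp[OF x that] by (simp add: cusp_fun_def)
qed

text \<open>The cusp part is the boundary of the edge, one end minus the other; by this the
  generators can later move a cusp part along a path.\<close>

lemma edge_generator:
  assumes x: "x \<in> X"
  obtains A where "cochain R A (\<lambda>y. cusp_fun (s x) y - cusp_fun x y)"
    "\<And>S a b. cochain S a b \<Longrightarrow> pair_form A (\<lambda>y. cusp_fun (s x) y - cusp_fun x y) a b = 6 * a x"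
proof -
  \<comment> \<open>The jumps sit at \<open>t_inv x = s (u (u x))\<close> and at \<open>s x\<close>.
    Applying \<open>s\<close> brings both into the triangle of \<open>x\<close>, where the two
    defects of the triangle relation cancel.\<close>
  define z where "z = t_inv x"
  have z: "z \<in> X" "t z = x" using x by (auto simp: z_def)
  have y: "s x \<in> X" using x by simp
  obtain f :: "'x \<Rightarrow> rat" where "\<And>y. f (t y) - f y
    = (if y \<in> cyc z then 1 / of_nat (width z) else 0) - (if y = z then 1 else 0)"
      "\<And>y. y \<notin> cyc z \<Longrightarrow> f y = 0" "\<And>y. \<exists>n. f y = of_nat n / of_nat (width z)"
    using sawtooth[OF z(1)] by blast
  note f = this[folded cusp_fun_def]
  obtain g :: "'x \<Rightarrow> rat" where "\<And>y. g (t y) - g y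
    = (if y \<in> cyc (s x) then 1 / of_nat (width (s x)) else 0) - (if y = s x then 1 else 0)"
      "\<And>y. y \<notin> cyc (s x) \<Longrightarrow> g y = 0" "\<And>y. \<exists>n. g y = of_nat n / of_nat (width (s x))"
    using sawtooth[OF y] by blast
  note g = this[folded cusp_fun_def]
  have "of_nat n / of_nat (width v) \<in> R" if "v \<in> X" for n v
    using R_mult[OF R_nat R_width[OF that]] by simp
  then have fR: "f v \<in> R" and gR: "g v \<in> R" for v using f(3)[of v] g(3)[of v] z y by auto
  have f_outside: "f v = 0" "g v = 0" if "v \<notin> X" for v
    using that f(2) g(2) cyc_subset[OF z(1)] cyc_subset[OF y] by auto
  define F G where "F = (\<Sum>v\<in>X. f v)" and "G = (\<Sum>v\<in>X. g v)"
  have FG: "F \<in> R" "G \<in> R" by (auto simp: F_def G_def fR gR intro: R_sum)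
  let ?b = "\<lambda>y. cusp_fun (s x) y - cusp_fun x y"
  have xz: "cusp_fun x = cusp_fun z"
    using cusp_fun_cong[OF z(1), of x] z cyc_t_iff[of z z] by auto
  define A0 where "A0 v = (f v - f (s v)) - (g v - g (s v))" for v
  have A0: "cochain R A0 ?b" unfolding cochain_def
  proof (intro conjI allI impI)
    fix v
    have fu: "f (u w) = f (s w) + cusp_fun x (s w) - (if s w = z then 1 else 0)" for w
      using f(1)[of "s w"] by (simp add: t_def xz)
    have gu: "g (u w) = g (s w) + cusp_fun (s x) (s w) - (if w = x then 1 else 0)" for w
      using g(1)[of "s w"] s_eq_iff[of w "s x"] by (simp add: t_def)
    have sw: "s w = z \<longleftrightarrow> w = u (u x)" for w by (simp add: z_def t_inv_def s_eq_iff[of w])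
    \<comment> \<open>Going around a triangle meets \<open>u (u x)\<close>, the defect of
      \<open>f\<close>, as often as \<open>x\<close>, the defect of \<open>g\<close>, also if
      \<open>u x = x\<close>.\<close>
    have "v = u (u x) \<longleftrightarrow> u v = x" "u v = u (u x) \<longleftrightarrow> u (u v) = x" "u (u v) = u (u x) \<longleftrightarrow> v = x"
      using u_eq_iff[of v x] u_eq_iff[of "u v" x] u_eq_iff[of "u v" "u (u x)"] u_eq_iff[of v x]
      by (simp_all add: u_eq_iff[of v "u x"])
    then show "A0 v + A0 (u v) + A0 (u (u v)) + ?b (s v) + ?b (s (u v)) + ?b (s (u (u v))) = 0"
      using fu[of v] fu[of "u v"] fu[of "u (u v)"] gu[of v] gu[of "u v"] gu[of "u (u v)"]
      by (simp add: A0_def sw)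
  qed (use x y fR gR f_outside in \<open>auto simp: A0_def cusp_fun_in_R R_diff cusp_fun_outside cusp_fun_t\<close>)
  let ?C = "\<lambda>w v. cusp_fun w v - cusp_fun w (s v)"
  \<comment> \<open>The coefficients are those of the surplus found in \<open>A0_form\<close>,
    divided by 6 because a cusp generator pairs to \<open>6 * b\<close>; this division produces the
    1/2.\<close>
  let ?A = "\<lambda>v. A0 v - ((1 / 2 + F) * ?C x v + (1 / 2 - G) * ?C (s x) v)"
  show thesis
  proof (rule that[of ?A])
    have "cochain R (\<lambda>v. A0 v - ((1 / 2 + F) * ?C x v + (1 / 2 - G) * ?C (s x) v))
        (\<lambda>v. ?b v - ((1 / 2 + F) * 0 + (1 / 2 - G) * 0))"
      by (intro cochain_diff cochain_add cochain_scale A0 cusp_generator x y R_add R_diff R_half FG)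
    then show "cochain R ?A ?b" by simp
  next
    fix S a b assume c: "cochain S a b"
    have as: "a (s v) = - a v" and bt: "b (t v) = b v" for v using c by (auto simp: cochain_def)
    have "pair_form (\<lambda>v. f v - f (s v)) (\<lambda>v. - cusp_fun x v) a b =
        2 * a z + 2 * a x + b (s x) - b (s z) + 6 * F * b x"
      using pair_form_sawtooth[OF z(1) c, of f] f bt[of z] by (simp add: xz F_def z cusp_fun_def)
    moreover have "pair_form (\<lambda>v. g v - g (s v)) (\<lambda>v. - cusp_fun (s x) v) a b =
        2 * a (s x) + 2 * a (t (s x)) + b (s (t (s x))) - b x + 6 * G * b (s x)"
      using pair_form_sawtooth[OF y c, of g] g by (simp add: G_def cusp_fun_def)
    ultimately have "pair_form (\<lambda>v. (f v - f (s v)) - (g v - g (s v)))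
        (\<lambda>v. - cusp_fun x v - (- cusp_fun (s x) v)) a b =
        2 * a z + 2 * a x + b (s x) - b (s z) + 6 * F * b x
        - (2 * a (s x) + 2 * a (t (s x)) + b (s (t (s x))) - b x + 6 * G * b (s x))"
      by (simp only: pair_form_diff_left)
    moreover have "(\<lambda>v. - cusp_fun x v - (- cusp_fun (s x) v)) = ?b" by auto
    moreover have "(\<lambda>v. (f v - f (s v)) - (g v - g (s v))) = A0" by (auto simp: A0_def)
    ultimately have "pair_form A0 ?b a b =
        2 * a z + 2 * a x + b (s x) - b (s z) + 6 * F * b x
        - (2 * a (s x) + 2 * a (t (s x)) + b (s (t (s x))) - b x + 6 * G * b (s x))" by simp
    \<comment> \<open>So far the edge values amount to
      \<open>4 * a x - 2 * (a (u x) + a (u (u x)))\<close>; the triangle relation converts the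
      bracket into \<open>- a x\<close> and values of \<open>b\<close>.\<close>
    moreover have "a x + a (u x) + a (u (u x)) + b (s x) + b (s (u x)) + b (s (u (u x))) = 0"
      by (rule cochain_triangle[OF c])
    moreover have "a z = - a (u (u x))" "b (s (u (u x))) = b x" "t (s x) = u x" "s z = u (u x)"
        "b (u (u x)) = b (s (u x))"
      using as[of "u (u x)"] bt[of z] bt[of "s (u x)"] by (simp_all add: z_def t_inv_def t_def)
    ultimately have A0_form: "pair_form A0 ?b a b = 6 * a x + (3 + 6 * F) * b x + (3
      - 6 * G) * b (s x)"
      using as[of x] by (simp add: algebra_simps)
    have "pair_form (\<lambda>v. A0 v - ((1 / 2 + F) * ?C x v - (- (1 / 2 - G)) * ?C (s x) v))
        (\<lambda>v. ?b v - ((1 / 2 + F) * 0 - (- (1 / 2 - G)) * 0)) a b =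
        6 * a x + (3 + 6 * F) * b x + (3 - 6 * G) * b (s x)
        - ((1 / 2 + F) * (6 * b x) - (- (1 / 2 - G)) * (6 * b (s x)))"
      unfolding pair_form_diff_left pair_form_scale_left cusp_generator(2)[OF x c]
        cusp_generator(2)[OF y c] A0_form by simp
    then show "pair_form ?A ?b a b = 6 * a x" by (simp add: algebra_simps)
  qed
qed


lemma pair_form_sum_scaled:
  assumes "finite I"
  shows "pair_form (\<lambda>x. \<Sum>i\<in>I. r i * a i x) (\<lambda>x. \<Sum>i\<in>I. r i * b i x) c d
    = (\<Sum>i\<in>I. r i * pair_form (a i) (b i) c d)"
  using pair_form_sum_left[OF assms, of "\<lambda>i x. r i * a i x" "\<lambda>i x. r i * b i x"]
  by (simp add: pair_form_scale_left)

lemma pair_form_nondegenerate: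
  assumes c: "cochain S a b" and z: "\<And>c d. cochain R c d \<Longrightarrow> pair_form c d a b = 0"
  shows "a = (\<lambda>_. 0)" "b = (\<lambda>_. 0)"
proof -
  have "a x = 0" if x: "x \<in> X" for x
  proof -
    obtain A where "cochain R A (\<lambda>y. cusp_fun (s x) y - cusp_fun x y)"
      "\<And>S a b. cochain S a b \<Longrightarrow> pair_form A (\<lambda>y. cusp_fun (s x) y - cusp_fun x y) a b = 6 * a x"
      using edge_generator[OF x] by blast
    from z[OF this(1)] this(2)[OF c] show ?thesis by simp
  qed
  then show "a = (\<lambda>_. 0)" using c unfolding cochain_def by blast
  have "b x = 0" if "x \<in> X" for x
    using z[OF cusp_generator(1)[OF that]] cusp_generator(2)[OF that c] by simp
  then show "b = (\<lambda>_. 0)" using c unfolding cochain_def by blast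
qed

section \<open>Integrality of the pairing after division by 6\<close>

definition integral_cochain :: "('x \<Rightarrow> rat) \<Rightarrow> ('x \<Rightarrow> rat) \<Rightarrow> bool" where
  "integral_cochain a b \<longleftrightarrow> cochain R a b \<and> (\<forall>c d. cochain R c d \<longrightarrow> pair_form a b c d / 6 \<in> R)"

text \<open>Adding the edge generator of \<open>v\<close> moves the cusp part from \<open>v\<close>
  to \<open>s v\<close> and changes the pairing with \<open>(c, d)\<close> by
  \<open>6 * c v\<close>, so integrality after division by 6 persists.\<close>

lemma integral_cochain_step:
  assumes v: "v \<in> X" and "\<exists>A. integral_cochain A (\<lambda>z. cusp_fun v z - cusp_fun x z)"
  shows "\<exists>A. integral_cochain A (\<lambda>z. cusp_fun (s v) z - cusp_fun x z)"
proof -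
  obtain A where A: "integral_cochain A (\<lambda>z. cusp_fun v z - cusp_fun x z)"
    using assms by blast
  obtain B where B: "cochain R B (\<lambda>y. cusp_fun (s v) y - cusp_fun v y)"
    "\<And>S a b. cochain S a b \<Longrightarrow> pair_form B (\<lambda>y. cusp_fun (s v) y - cusp_fun v y) a b = 6 * a v"
    using edge_generator[OF v] by blast
  have eq: "(\<lambda>z. cusp_fun v z - cusp_fun x z - - (cusp_fun (s v) z - cusp_fun v z))
      = (\<lambda>z. cusp_fun (s v) z - cusp_fun x z)" by auto
  have "cochain R (\<lambda>z. A z - - B z) (\<lambda>z. cusp_fun v z - cusp_fun x z - - (cusp_fun (s v) z
    - cusp_fun v z))"
    using A cochain_scale[OF B(1) R_minus_one]
    by (intro cochain_diff) (simp_all add: integral_cochain_def)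
  moreover have "pair_form (\<lambda>z. A z - - B z)
      (\<lambda>z. cusp_fun v z - cusp_fun x z - - (cusp_fun (s v) z - cusp_fun v z)) c d / 6 \<in> R"
    if c: "cochain R c d" for c d
  proof -
    have "pair_form (\<lambda>z. - B z) (\<lambda>z. - (cusp_fun (s v) z - cusp_fun v z)) c d = - (6 * c v)"
      using pair_form_scale_left[of "-1" B "\<lambda>z. cusp_fun (s v) z
        - cusp_fun v z" c d] B(2)[OF c] by simp
    then have "pair_form (\<lambda>z. A z - - B z)
      (\<lambda>z. cusp_fun v z - cusp_fun x z - - (cusp_fun (s v) z - cusp_fun v z)) c d / 6
      = pair_form A (\<lambda>z. cusp_fun v z - cusp_fun x z) c d / 6 + c v"
      unfolding pair_form_diff_left by simp
    moreover have "pair_form A (\<lambda>z. cusp_fun v z - cusp_fun x z) c d / 6 \<in> R"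
      using A c unfolding integral_cochain_def by blast
    moreover have "c v \<in> R" using c by (simp add: cochain_def)
    ultimately show ?thesis by (simp only: R_add)
  qed
  ultimately show "\<exists>A. integral_cochain A (\<lambda>z. cusp_fun (s v) z - cusp_fun x z)"
    unfolding eq by (auto simp: integral_cochain_def)
qed

text \<open>Transitivity of \<open>s\<close> and \<open>u\<close> provides a path of edges between
  the cusps. Only \<open>s\<close> requires a generator: \<open>u v = t (s v)\<close> lies on the
  same cusp as \<open>s v\<close>, so a step by \<open>u\<close> has the same effect as one by
  \<open>s\<close>.\<close>

lemma integral_cochain_cusp_diff:
  assumes "x \<in> X" "y \<in> X"
  shows "\<exists>A. integral_cochain A (\<lambda>z. cusp_fun y z - cusp_fun x z)"
proof (rule connected[OF assms])
  show "\<exists>A. integral_cochain A (\<lambda>z. cusp_fun x z - cusp_fun x z)"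
    by (rule exI[of _ "\<lambda>_. 0"]) (auto simp: integral_cochain_def cochain_zero pair_form_def R_zero)
next
  fix v assume v: "v \<in> X" and ex: "\<exists>A. integral_cochain A (\<lambda>z. cusp_fun v z - cusp_fun x z)"
  show *: "\<exists>A. integral_cochain A (\<lambda>z. cusp_fun (s v) z - cusp_fun x z)"
    by (rule integral_cochain_step[OF v ex])
  have "cusp_fun (u v) = cusp_fun (s v)"
    using cusp_fun_cong[of "s v" "u v"] v cyc_t_iff[of "s v" "s v"] by (simp add: t_def)
  with * show "\<exists>A. integral_cochain A (\<lambda>z. cusp_fun (u v) z - cusp_fun x z)" by simp
qed

text \<open>
  The cochains obtained above realise every admissible cusp part, and they pair integrally with
  everything. What remains has zero cusp part, where a sum over triangles shows divisibility by 3.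
\<close>

lemma pair_form_integral:
  assumes c1: "cochain R a\<^sub>1 b\<^sub>1" and c2: "cochain R a\<^sub>2 b\<^sub>2"
  shows "pair_form a\<^sub>1 b\<^sub>1 a\<^sub>2 b\<^sub>2 / 6 \<in> R"
proof (cases "X = {}")
  case True
  then show ?thesis unfolding pair_form_def using R_zero by simp
next
  case False
  then obtain x0 where x0: "x0 \<in> X" by auto
  have "\<forall>x. \<exists>A. x \<in> X \<longrightarrow> integral_cochain A (\<lambda>z. cusp_fun x z - cusp_fun x0 z)"
    using integral_cochain_cusp_diff[OF x0] by blast
  then obtain A where A: "\<And>x. x \<in> X \<Longrightarrow> integral_cochain (A x) (\<lambda>z. cusp_fun x z - cusp_fun x0 z)"
    by metis
  have b1: "b\<^sub>1 x \<in> R" for x using c1 by (simp add: cochain_def)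
  let ?A = "\<lambda>z. \<Sum>x\<in>X. b\<^sub>1 x * A x z"
  let ?B = "\<lambda>z. \<Sum>x\<in>X. b\<^sub>1 x * (cusp_fun x z - cusp_fun x0 z)"
  have cA: "cochain R ?A ?B"
    using A b1 by (intro cochain_sum cochain_scale) (auto simp: integral_cochain_def)
  have B: "?B = b\<^sub>1"
  proof
    fix z
    have "(\<Sum>x\<in>X. b\<^sub>1 x * cusp_fun x z) = b\<^sub>1 z"
    proof (cases "z \<in> X")
      case True
      have "(\<Sum>x\<in>X. b\<^sub>1 x * cusp_fun x z) = (\<Sum>x\<in>X. if x \<in> cyc z then b\<^sub>1 z / of_nat (width z) else 0)"
      proof (rule sum.cong)
        fix x assume "x \<in> X"
        then show "b\<^sub>1 x * cusp_fun x z = (if x \<in> cyc z then b\<^sub>1 z / of_nat (width z) else 0)"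
          using True cusp_fun_sym[of x z] cochain_cyc[OF c1, of x z] by (simp add: cusp_fun_def)
      qed simp
      also have "\<dots> = b\<^sub>1 z" using True width[of z] by (simp add: sum_cyc_indicator card_cyc)
      finally show ?thesis .
    next
      case False
      then have "(\<Sum>x\<in>X. b\<^sub>1 x * cusp_fun x z) = 0"
        by (intro sum.neutral) (simp add: cusp_fun_outside)
      then show ?thesis using c1 False by (simp add: cochain_def)
    qed
    \<comment> \<open>The base cusp drops out because the cusp part of a cochain has total
      zero.\<close>
    moreover have "(\<Sum>x\<in>X. b\<^sub>1 x * cusp_fun x0 z) = 0"
      by (simp add: sum_distrib_right[symmetric] cochain_sum_zero[OF c1])
    ultimately show "?B z = b\<^sub>1 z" by (simp add: right_diff_distrib sum_subtractf)
  qed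
  have "pair_form ?A ?B a\<^sub>2 b\<^sub>2 / 6 = (\<Sum>x\<in>X. b\<^sub>1 x * (pair_form (A x) (\<lambda>z. cusp_fun x z
    - cusp_fun x0 z) a\<^sub>2 b\<^sub>2 / 6))"
    by (simp add: pair_form_sum_scaled finite_X sum_divide_distrib)
  also have "\<dots> \<in> R" using A c2 b1 by (intro R_sum R_mult) (auto simp: integral_cochain_def)
  finally have 1: "pair_form ?A b\<^sub>1 a\<^sub>2 b\<^sub>2 / 6 \<in> R" by (simp only: B)
  have "cochain R ?A b\<^sub>1" using cA unfolding B .
  then have "cochain R (\<lambda>z. a\<^sub>1 z - ?A z) (\<lambda>z. b\<^sub>1 z - b\<^sub>1 z)" by (rule cochain_diff[OF c1])
  then have "cochain R (\<lambda>z. a\<^sub>1 z - ?A z) (\<lambda>z. 0)" by simp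
  from pair_form_parabolic[OF R_add R_mult R_one R_minus_one this c2] obtain k where k: "k \<in> R"
    "pair_form (\<lambda>z. a\<^sub>1 z - ?A z) (\<lambda>z. 0) a\<^sub>2 b\<^sub>2 = 3 * k"
    by blast
  have "pair_form a\<^sub>1 b\<^sub>1 a\<^sub>2 b\<^sub>2 - pair_form ?A b\<^sub>1 a\<^sub>2 b\<^sub>2 = 3 * k"
    using k(2) pair_form_diff_left[of a\<^sub>1 ?A b\<^sub>1 b\<^sub>1 a\<^sub>2 b\<^sub>2] by simp
  \<comment> \<open>Divisibility by 3 leaves \<open>3 * k / 6\<close>, which lies in
    \<open>R\<close> because 2 is invertible.\<close>
  then have "pair_form a\<^sub>1 b\<^sub>1 a\<^sub>2 b\<^sub>2 / 6 = pair_form ?A b\<^sub>1 a\<^sub>2 b\<^sub>2 / 6 + 1 / 2 * k"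
    by (simp add: field_simps)
  then show ?thesis using 1 k(1) by (simp only:) (intro R_add R_mult R_half)
qed

section \<open>Representing linear forms\<close>

definition cochain_functional :: "(('x \<Rightarrow> rat) \<Rightarrow> ('x \<Rightarrow> rat) \<Rightarrow> rat) \<Rightarrow> bool" where
  "cochain_functional l \<longleftrightarrow>
     (\<forall>a b. cochain R a b \<longrightarrow> l a b \<in> R) \<and>
     (\<forall>a b a' b'. cochain R a b \<longrightarrow> cochain R a' b' \<longrightarrow>
        l (\<lambda>x. a x + a' x) (\<lambda>x. b x + b' x) = l a b + l a' b') \<and>
     (\<forall>r a b. r \<in> R \<longrightarrow> cochain R a b \<longrightarrow> l (\<lambda>x. r * a x) (\<lambda>x. r * b x) = r * l a b)"

lemma cochain_functional_sum:
  assumes l: "cochain_functional l" and I: "finite I"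
    and c: "\<And>i. i \<in> I \<Longrightarrow> cochain R (a i) (b i)" and r: "\<And>i. i \<in> I \<Longrightarrow> r i \<in> R"
  shows "l (\<lambda>x. \<Sum>i\<in>I. r i * a i x) (\<lambda>x. \<Sum>i\<in>I. r i * b i x) = (\<Sum>i\<in>I. r i * l (a i) (b i))"
  using I c r
proof (induction I)
  case empty
  have "l (\<lambda>x. 0 * 0) (\<lambda>x. 0 * 0) = 0 * l (\<lambda>_. 0) (\<lambda>_. 0)"
    using l cochain_zero R_zero unfolding cochain_functional_def by blast
  then show ?case by simp
next
  case (insert i I)
  have *: "cochain R (a i) (b i)" "r i \<in> R" using insert.prems by auto
  have "cochain R (\<lambda>x. \<Sum>i\<in>I. r i * a i x) (\<lambda>x. \<Sum>i\<in>I. r i * b i x)"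
    using insert.prems by (intro cochain_sum cochain_scale) auto
  then have "l (\<lambda>x. r i * a i x + (\<Sum>i\<in>I. r i * a i x)) (\<lambda>x. r i * b i x + (\<Sum>i\<in>I. r i * b i x)) =
    l (\<lambda>x. r i * a i x) (\<lambda>x. r i * b i x) + l (\<lambda>x. \<Sum>i\<in>I. r i * a i x) (\<lambda>x. \<Sum>i\<in>I. r i * b i x)"
    using l cochain_scale[OF *] unfolding cochain_functional_def by blast
  also have "l (\<lambda>x. r i * a i x) (\<lambda>x. r i * b i x) = r i * l (a i) (b i)"
    using l * unfolding cochain_functional_def by blast
  finally show ?case using insert by simp
qed

text \<open>A combination that pairs to zero with every cochain is the zero cochain by
  nondegeneracy, so \<open>l\<close> vanishes on it. Every identity between evaluations thereby
  becomes an identity between values of \<open>l\<close>.\<close>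

lemma cochain_functional_relation:
  assumes l: "cochain_functional l" and I: "finite I"
    and c: "\<And>i. i \<in> I \<Longrightarrow> cochain R (a i) (b i)" and r: "\<And>i. i \<in> I \<Longrightarrow> r i \<in> R"
    and z: "\<And>c d. cochain R c d \<Longrightarrow> (\<Sum>i\<in>I. r i * pair_form (a i) (b i) c d) = 0"
  shows "(\<Sum>i\<in>I. r i * l (a i) (b i)) = 0"
proof -
  let ?a = "\<lambda>x. \<Sum>i\<in>I. r i * a i x" and ?b = "\<lambda>x. \<Sum>i\<in>I. r i * b i x"
  have co: "cochain R ?a ?b" using c r by (intro cochain_sum cochain_scale) auto
  have "pair_form c d ?a ?b = 0" if "cochain R c d" for c d
    using z[OF that] pair_form_anti[of c d ?a ?b] pair_form_sum_scaled[OF I, of r a b c d] by simp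
  then have "?a = (\<lambda>_. 0)" "?b = (\<lambda>_. 0)" using pair_form_nondegenerate[OF co] by blast+
  then have "(\<Sum>i\<in>I. r i * l (a i) (b i)) = l (\<lambda>_. 0) (\<lambda>_. 0)"
    using cochain_functional_sum[of l I a b r] l I c r by simp
  also have "\<dots> = 0" using cochain_functional_sum[OF l, of "{} :: 'x set"] by simp
  finally show ?thesis .
qed

lemma cochain_functional_represented:
  assumes l: "cochain_functional l"
  obtains a b where "cochain R a b" "\<And>c d. cochain R c d \<Longrightarrow> pair_form a b c d / 6 = l c d"
proof -
  have "\<exists>A B. cochain R A B \<and> (\<forall>a b. cochain R a b \<longrightarrow> pair_form A B a b = 6 * a x)" for x
  proof (cases "x \<in> X")
    case True
    obtain A where "cochain R A (\<lambda>y. cusp_fun (s x) y - cusp_fun x y)"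
      "\<And>S a b. cochain S a b \<Longrightarrow> pair_form A (\<lambda>y. cusp_fun (s x) y - cusp_fun x y) a b = 6 * a x"
      using edge_generator[OF True] by blast
    then show ?thesis by blast
  next
    case False
    then show ?thesis
      by (intro exI[of _ "\<lambda>_. 0"]) (auto simp: R_zero pair_form_def cochain_def)
  qed
  then obtain A B where AB: "\<And>x. cochain R (A x) (B x)"
      "\<And>x a b. cochain R a b \<Longrightarrow> pair_form (A x) (B x) a b = 6 * a x" by metis
  have "\<exists>A B. cochain R A B \<and> (\<forall>a b. cochain R a b \<longrightarrow> pair_form A B a b = 6 * b x)" for x
  proof (cases "x \<in> X")
    case True then show ?thesis using cusp_generator[OF True] by blast
  next
    case False
    then show ?thesis
      by (intro exI[of _ "\<lambda>_. 0"]) (auto simp: R_zero pair_form_def cochain_def)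
  qed
  then obtain C D where CD: "\<And>x. cochain R (C x) (D x)"
      "\<And>x a b. cochain R a b \<Longrightarrow> pair_form (C x) (D x) a b = 6 * b x" by metis
  \<comment> \<open>Forced: if \<open>(a, b)\<close> represents \<open>l\<close>, then
    \<open>6 * a x\<close> is the pairing of \<open>(A x, B x)\<close> with \<open>(a, b)\<close>,
    which by antisymmetry is \<open>- 6 * l (A x) (B x)\<close>; likewise for
    \<open>b\<close>.\<close>
  define a b where "a x = - l (A x) (B x)" and "b x = - l (C x) (D x)" for x
  have lR: "l c d \<in> R" if "cochain R c d" for c d
    using l that unfolding cochain_functional_def by blast
  have zero: "l c d = 0" if "cochain R c d" "\<And>c' d'. cochain R c' d' \<Longrightarrow> pair_form c d c' d' = 0"
    for c d
    using cochain_functional_relation[OF l, of "{()}" "\<lambda>_. c" "\<lambda>_. d" "\<lambda>_. 1"] that R_one by simp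
  have rel2: "l a\<^sub>1 b\<^sub>1 + r * l a\<^sub>2 b\<^sub>2 = 0"
    if "cochain R a\<^sub>1 b\<^sub>1" "cochain R a\<^sub>2 b\<^sub>2" "r \<in> R"
      "\<And>c d. cochain R c d \<Longrightarrow> pair_form a\<^sub>1 b\<^sub>1 c d + r * pair_form a\<^sub>2 b\<^sub>2 c d = 0"
    for a\<^sub>1 b\<^sub>1 a\<^sub>2 b\<^sub>2 r
    using cochain_functional_relation[OF l, of "{True, False}" "\<lambda>i. if i then a\<^sub>1 else a\<^sub>2"
        "\<lambda>i. if i then b\<^sub>1 else b\<^sub>2" "\<lambda>i. if i then 1 else r"] that R_one by simp
  have co: "cochain R a b" unfolding cochain_def
  proof (intro conjI allI impI)
    fix x
    show "a x \<in> R" "b x \<in> R" using lR AB CD by (auto simp: a_def b_def R_neg)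
    show "a x = 0" "b x = 0" if "x \<notin> X"
      using zero[OF AB(1)[of x]] zero[OF CD(1)[of x]] that AB(2)[of _ _ x] CD(2)[of _ _ x]
      by (auto simp: a_def b_def cochain_def)
    show "a (s x) = - a x" using rel2[OF AB(1)[of "s x"] AB(1)[of x] R_one] AB(2)
      by (simp add: a_def cochain_def)
    show "b (t x) = b x" using rel2[OF CD(1)[of "t x"] CD(1)[of x] R_minus_one] CD(2)
      by (simp add: b_def cochain_def)
    \<comment> \<open>The six generators whose pairings are the six terms of the triangle relation
      at \<open>x\<close>.\<close>
    let ?A = "\<lambda>i :: nat. [A x, A (u x), A (u (u x)), C (s x), C (s (u x)), C (s (u (u x)))] ! i"
    let ?B = "\<lambda>i :: nat. [B x, B (u x), B (u (u x)), D (s x), D (s (u x)), D (s (u (u x)))] ! i"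
    have cases: "i \<in> {0,1,2,3,4,5}" if "i < 6" for i :: nat using that by auto
    have "(\<Sum>i<6. 1 * l (?A i) (?B i)) = 0"
    proof (rule cochain_functional_relation[OF l])
      fix i :: nat assume "i \<in> {..<6}"
      then have "i = 0 \<or> i = 1 \<or> i = 2 \<or> i = 3 \<or> i = 4 \<or> i = 5" by auto
      then show "cochain R (?A i) (?B i)" using AB(1) CD(1) by (elim disjE) simp_all
    next
      fix c d assume cd: "cochain R c d"
      show "(\<Sum>i<6. 1 * pair_form (?A i) (?B i) c d) = 0" using cochain_triangle[OF cd, of x]
        by (simp add: AB(2)[OF cd] CD(2)[OF cd] numeral_eq_Suc)
    qed (auto simp: R_one)
    then show "a x + a (u x) + a (u (u x)) + b (s x) + b (s (u x)) + b (s (u (u x))) = 0"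
      by (simp add: a_def b_def numeral_eq_Suc)
  qed
  show thesis
  proof (rule that[OF co])
    fix c d assume cd: "cochain R c d"
    have cR: "c x \<in> R" "d x \<in> R" for x using cd by (auto simp: cochain_def)
    have qR: "- (c (t x) + 4 * d x) \<in> R" "4 * c x \<in> R" "- 6 \<in> R" for x
      by (intro R_neg R_add R_mult R_numeral cR)+
    \<comment> \<open>\<open>None\<close> stands for \<open>(c, d)\<close> itself, and
      \<open>(j, x)\<close> for the generators that read off \<open>c' x\<close>,
      \<open>c' (t x)\<close> and \<open>d' x\<close>. The weights \<open>?q\<close> are the
      coefficients of these values in \<open>pair_form c d c' d'\<close>, so that the combination
      with weight \<open>- 6\<close> at \<open>None\<close> pairs to zero.\<close>
    let ?A = "\<lambda>i. case i of None \<Rightarrow> c | Some (j, x) \<Rightarrow> [A x, A (t x), C x] ! (j :: nat)"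
    let ?B = "\<lambda>i. case i of None \<Rightarrow> d | Some (j, x) \<Rightarrow> [B x, B (t x), D x] ! (j :: nat)"
    let ?q = "\<lambda>i. case i of None \<Rightarrow> - 6 | Some (j, x) \<Rightarrow> [- (c (t x)
      + 4 * d x), c x, 4 * c x] ! (j :: nat)"
    let ?I = "insert None (Some ` ({..<3 :: nat} \<times> X))"
    have three: "j = 0 \<or> j = 1 \<or> j = 2" if "j < 3" for j :: nat using that by auto
    have sum_I: "(\<Sum>i\<in>?I. F i) = F None + (\<Sum>x\<in>X. F (Some (0, x)) + F (Some (1, x)) + F (Some (2, x)))"
      for F :: "(nat \<times> 'x) option \<Rightarrow> rat"
    proof -
      have "(\<Sum>i\<in>?I. F i) = F None + (\<Sum>i\<in>{..<3 :: nat} \<times> X. F (Some i))"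
        using finite_X by (subst sum.insert) (auto simp: sum.reindex)
      also have "(\<Sum>i\<in>{..<3 :: nat} \<times> X. F (Some i)) = (\<Sum>j<3. \<Sum>x\<in>X. F (Some (j, x)))"
        by (simp add: sum.cartesian_product)
      finally show ?thesis by (simp add: numeral_eq_Suc sum.distrib)
    qed
    have "(\<Sum>i\<in>?I. ?q i * l (?A i) (?B i)) = 0"
    proof (rule cochain_functional_relation[OF l])
      show "finite ?I" using finite_X by auto
      fix i assume "i \<in> ?I"
      then show "cochain R (?A i) (?B i)" "?q i \<in> R"
        using AB(1) CD(1) cd cR qR by (auto dest!: three simp del: minus_add_distrib)
    next
      fix c' d' assume cd': "cochain R c' d'"
      have "(\<Sum>x\<in>X. - (c (t x) + 4 * d x) * (6 * c' x) + c x * (6 * c' (t x)) + 4 * c x * (6 * d' x))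
          = 6 * pair_form c d c' d'"
        unfolding pair_form_def sum_distrib_left by (intro sum.cong) (auto simp: algebra_simps)
      then show "(\<Sum>i\<in>?I. ?q i * pair_form (?A i) (?B i) c' d') = 0"
        unfolding sum_I by (simp add: AB(2)[OF cd'] CD(2)[OF cd'])
    qed
    then have "(\<Sum>x\<in>X. - (c (t x) + 4 * d x) * l (A x) (B x) + c x * l (A (t x)) (B (t x))
        + 4 * c x * l (C x) (D x)) = 6 * l c d"
      unfolding sum_I by (simp add: numeral_eq_Suc)
    moreover have "pair_form a b c d = (\<Sum>x\<in>X. - (c (t x) + 4 * d x) * l (A x) (B x)
        + c x * l (A (t x)) (B (t x)) + 4 * c x * l (C x) (D x))"
      unfolding pair_form_def by (intro sum.cong) (auto simp: a_def b_def algebra_simps)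
    ultimately show "pair_form a b c d / 6 = l c d" by simp
  qed
qed

end

subsection \<open>Torsion-free quotients\<close>

lemma hom_int_nat_pow:
  assumes "h \<in> hom G integer_group" "group G" "x \<in> carrier G"
  shows "h (x [^]\<^bsub>G\<^esub> (n :: nat)) = int n * h x"
  using hom_nat_pow[OF assms(1,3,2) group_integer_group, of n] by simp

lemma hom_int_one:
  assumes "h \<in> hom G integer_group" "group G"
  shows "h \<one>\<^bsub>G\<^esub> = 0" using hom_one[OF assms(1,2) group_integer_group] by simp

lemma (in comm_group) subgroup_torsion_elements: "subgroup (torsion_elements G) G"
proof
  show "\<one> \<in> torsion_elements G" by (auto simp: torsion_elements_def intro!: exI[of _ 1])
  fix x y assume "x \<in> torsion_elements G" "y \<in> torsion_elements G"
  then obtain m n :: nat where *: "x \<in> carrier G" "y \<in> carrier G" "m > 0" "n > 0"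
      "x [^] m = \<one>" "y [^] n = \<one>" by (auto simp: torsion_elements_def)
  have "(x \<otimes> y) [^] (m * n) = (x [^] m) [^] n \<otimes> (y [^] n) [^] m"
    using nat_pow_distrib[OF *(1,2), of "m * n"] nat_pow_pow[OF *(1), of m n]
      nat_pow_pow[OF *(2), of n m] by (simp add: mult.commute)
  then show "x \<otimes> y \<in> torsion_elements G"
    using * by (auto simp: torsion_elements_def intro!: exI[of _ "m * n"])
next
  fix x assume "x \<in> torsion_elements G"
  then obtain n :: nat where "x \<in> carrier G" "n > 0" "x [^] n = \<one>"
    by (auto simp: torsion_elements_def)
  then show "inv x \<in> torsion_elements G"
    using nat_pow_inv[of x n] by (auto simp: torsion_elements_def intro!: exI[of _ n])
qed (auto simp: torsion_elements_def)

lemma (in comm_group) FactGroup_universal_int: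
  assumes N: "subgroup N G" and h: "h \<in> hom G integer_group" and "\<And>x. x \<in> N \<Longrightarrow> h x = 0"
  obtains g where "g \<in> hom (G Mod N) integer_group" "\<And>x. x \<in> carrier G \<Longrightarrow> g (N #> x) = h x"
proof (rule FactGroup_universal[OF h])
  show "N \<lhd> G" using N by (simp add: normal_iff_subgroup)
  fix x y assume xy: "x \<in> carrier G" "y \<in> carrier G" "N #> x = N #> y"
  then have "x \<in> N #> y" using rcos_self[OF xy(1) N] by simp
  then obtain n where "n \<in> N" "x = n \<otimes> y" by (auto simp: r_coset_def)
  then show "h x = h y"
    using hom_mult[OF h, of n y] assms(3)[of n] subgroup.mem_carrier[OF N] xy by simp
qed (use that in blast)

context comm_group
begin

context
  fixes K :: "'a set"
  assumes K: "K \<subseteq> carrier G"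
begin

lemma quotient_group: "comm_group (G Mod generate G K)"
  by (rule abelian_FactGroup[OF generate_is_subgroup[OF K]])

lemma torsion_free_quotient_group: "comm_group (torsion_free_quotient G K)"
  unfolding torsion_free_quotient_def
  by (intro comm_group.abelian_FactGroup comm_group.subgroup_torsion_elements quotient_group)

lemma tf_class_hom: "tf_class G K \<in> hom G (torsion_free_quotient G K)"
proof -
  interpret Q: comm_group "G Mod generate G K" by (rule quotient_group)
  have "generate G K \<lhd> G" using generate_is_subgroup[OF K] by (simp add: normal_iff_subgroup)
  note 1 = normal.r_coset_hom_Mod[OF this]
  have "torsion_elements (G Mod generate G K) \<lhd> (G Mod generate G K)"
    using Q.subgroup_torsion_elements by (simp add: Q.normal_iff_subgroup)
  note 2 = normal.r_coset_hom_Mod[OF this]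
  have "tf_class G K = (\<lambda>c. torsion_elements (G Mod generate G K) #>\<^bsub>G Mod generate G K\<^esub> c)
      \<circ> (\<lambda>a. generate G K #> a)" by (simp add: tf_class_def fun_eq_iff)
  then show ?thesis
    unfolding torsion_free_quotient_def using Group.hom_compose[OF 1 2] by simp
qed

lemma carrier_torsion_free_quotient: "carrier (torsion_free_quotient G K) = tf_class G K ` carrier G"
  by (auto simp: torsion_free_quotient_def carrier_FactGroup tf_class_def[abs_def])

lemma tf_class_relator:
  assumes "x \<in> K" shows "tf_class G K x = \<one>\<^bsub>torsion_free_quotient G K\<^esub>"
proof -
  interpret Q: comm_group "G Mod generate G K" by (rule quotient_group)
  have "generate G K #> x = generate G K"
    using assms K by (intro coset_join2 generate_is_subgroup) (auto intro: generate.incl)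
  then have "tf_class G K x
    = torsion_elements (G Mod generate G K) #>\<^bsub>G Mod generate G K\<^esub> \<one>\<^bsub>G Mod generate G K\<^esub>"
    by (simp add: tf_class_def)
  also have "\<dots> = torsion_elements (G Mod generate G K)"
    by (intro Q.coset_mult_one) (auto simp: torsion_elements_def)
  finally show ?thesis by (simp add: torsion_free_quotient_def)
qed

text \<open>The target has no torsion: a homomorphism that kills \<open>K\<close> also kills every
  class with a positive multiple in the subgroup generated by \<open>K\<close>.\<close>

lemma torsion_free_quotient_universal:
  assumes h: "h \<in> hom G integer_group" and zero: "\<And>x. x \<in> K \<Longrightarrow> h x = 0"
  obtains g where "g \<in> hom (torsion_free_quotient G K) integer_group"
    "\<And>x. x \<in> carrier G \<Longrightarrow> g (tf_class G K x) = h x"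
proof -
  interpret Q: comm_group "G Mod generate G K" by (rule quotient_group)
  have "h x = 0" if "x \<in> generate G K" for x using that
  proof (induction rule: generate.induct)
    case one
    then show ?case by (rule hom_int_one[OF h is_group])
  next
    case (inv x)
    then have "h (inv x) + h x = 0"
      using hom_mult[OF h, of "inv x" x] K hom_int_one[OF h is_group] by (auto simp: subset_iff)
    then show ?case using zero[OF inv] by simp
  next
    case (eng x y)
    then show ?case using hom_mult[OF h, of x y] generate_in_carrier[OF K] by simp
  qed (use zero in auto)
  then obtain g where g: "g \<in> hom (G Mod generate G K) integer_group"
      "\<And>x. x \<in> carrier G \<Longrightarrow> g (generate G K #> x) = h x"
    using FactGroup_universal_int[OF generate_is_subgroup[OF K] h] by metis
  have "g c = 0" if c: "c \<in> torsion_elements (G Mod generate G K)" for c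
  proof -
    obtain n :: nat where n: "n > 0" "c [^]\<^bsub>G Mod generate G K\<^esub> n = \<one>\<^bsub>G Mod generate G K\<^esub>"
        "c \<in> carrier (G Mod generate G K)" using c unfolding torsion_elements_def by blast
    then have "int n * g c = 0"
      using hom_int_nat_pow[OF g(1) Q.is_group n(3), of n] hom_int_one[OF g(1) Q.is_group] by simp
    then show ?thesis using n by simp
  qed
  then obtain k where "k \<in> hom ((G Mod generate G K) Mod torsion_elements (G Mod generate G K)) integer_group"
     "\<And>c. c \<in> carrier (G Mod generate G K) \<Longrightarrow>
       k (torsion_elements (G Mod generate G K) #>\<^bsub>G Mod generate G K\<^esub> c) = g c"
    using Q.FactGroup_universal_int[OF Q.subgroup_torsion_elements g(1)] by metis
  then show thesis
    using that[of k] g(2) by (simp add: torsion_free_quotient_def tf_class_def carrier_FactGroup)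
qed

end

lemma image_r_coset:
  assumes "\<sigma> \<in> hom G G" "N \<subseteq> carrier G" "x \<in> carrier G"
  shows "\<sigma> ` (N #> x) = \<sigma> ` N #> \<sigma> x"
  using assms hom_mult[OF assms(1)] by (force simp: r_coset_def image_iff subset_iff)

end

lemma image_torsion_elements:
  assumes "group H" "\<tau> \<in> iso H H"
  shows "\<tau> ` torsion_elements H = torsion_elements H"
proof -
  have hom: "\<tau> \<in> hom H H" and bij: "bij_betw \<tau> (carrier H) (carrier H)"
    using assms(2) by (auto simp: iso_def)
  interpret group_hom H H \<tau> using assms(1) hom by (simp add: group_hom_def group_hom_axioms_def)
  have iff: "\<tau> x \<in> torsion_elements H \<longleftrightarrow> x \<in> torsion_elements H" if x: "x \<in> carrier H" for x
  proof -
    have "\<tau> x [^]\<^bsub>H\<^esub> n = \<one>\<^bsub>H\<^esub> \<longleftrightarrow> x [^]\<^bsub>H\<^esub> n = \<one>\<^bsub>H\<^esub>" for n :: nat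
      using hom_nat_pow[OF x, of n] bij x hom_one
      by (metis bij_betw_imp_inj_on G.nat_pow_closed G.one_closed inj_on_eq_iff)
    then show ?thesis using x by (simp add: torsion_elements_def)
  qed
  show ?thesis
  proof (intro equalityI subsetI)
    fix y assume y: "y \<in> torsion_elements H"
    then have "y \<in> carrier H" by (simp add: torsion_elements_def)
    then obtain x where "x \<in> carrier H" "y = \<tau> x" using bij by (auto simp: bij_betw_def)
    with y iff show "y \<in> \<tau> ` torsion_elements H" by blast
  qed (use iff in \<open>auto simp: torsion_elements_def\<close>)
qed

lemma (in comm_group) iso_image_FactGroup:
  assumes \<sigma>: "\<sigma> \<in> iso G G" and N: "subgroup N G" and im: "\<sigma> ` N = N"
  shows "(`) \<sigma> \<in> iso (G Mod N) (G Mod N)"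
proof (rule isoI)
  have hom: "\<sigma> \<in> hom G G" and bij: "bij_betw \<sigma> (carrier G) (carrier G)"
    using \<sigma> by (auto simp: iso_def)
  have NG: "N \<subseteq> carrier G" using N by (rule subgroup.subset)
  have nor: "N \<lhd> G" using N by (simp add: normal_iff_subgroup)
  have img: "\<sigma> ` (N #> x) = N #> \<sigma> x" if "x \<in> carrier G" for x
    using image_r_coset[OF hom NG that] im by simp
  have cl: "\<sigma> x \<in> carrier G" if "x \<in> carrier G" for x using hom_in_carrier[OF hom that] .
  show "(`) \<sigma> \<in> hom (G Mod N) (G Mod N)"
  proof (rule homI)
    fix c d assume "c \<in> carrier (G Mod N)" "d \<in> carrier (G Mod N)"
    then obtain x y where "c = N #> x" "d = N #> y" "x \<in> carrier G" "y \<in> carrier G"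
      by (auto simp: carrier_FactGroup)
    then show "\<sigma> ` (c \<otimes>\<^bsub>G Mod N\<^esub> d) = \<sigma> ` c \<otimes>\<^bsub>G Mod N\<^esub> \<sigma> ` d"
      using normal.rcos_sum[OF nor] hom_mult[OF hom] by (simp add: img cl)
  qed (auto simp: carrier_FactGroup img cl)
  have "inj_on ((`) \<sigma>) (carrier (G Mod N))"
  proof (rule inj_onI)
    fix c d assume *: "c \<in> carrier (G Mod N)" "d \<in> carrier (G Mod N)" "\<sigma> ` c = \<sigma> ` d"
    then have "c \<subseteq> carrier G" "d \<subseteq> carrier G"
      using NG by (auto simp: carrier_FactGroup dest: subsetD[OF r_coset_subset_G])
    then show "c = d"
      using *(3) bij inj_on_image_eq_iff[of \<sigma> "carrier G"] by (auto simp: bij_betw_def)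
  qed
  moreover have "(`) \<sigma> ` carrier (G Mod N) = carrier (G Mod N)"
  proof -
    have "(`) \<sigma> ` carrier (G Mod N) = (\<lambda>x. N #> \<sigma> x) ` carrier G"
      unfolding carrier_FactGroup image_image by (intro image_cong refl img)
    also have "\<dots> = (\<lambda>x. N #> x) ` (\<sigma> ` carrier G)" by (simp add: image_image)
    also have "\<sigma> ` carrier G = carrier G" using bij by (simp add: bij_betw_def)
    finally show ?thesis by (simp add: carrier_FactGroup)
  qed
  ultimately show "bij_betw ((`) \<sigma>) (carrier (G Mod N)) (carrier (G Mod N))"
    by (simp add: bij_betw_def)
qed

text \<open>Justifies an action defined by iterated images: an automorphism preserving
  \<open>K\<close> preserves the subgroup it generates and the torsion of the quotient, so cosets of
  cosets go to the expected ones.\<close>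

lemma (in comm_group) image_tf_class:
  assumes \<sigma>: "\<sigma> \<in> iso G G" and K: "K \<subseteq> carrier G" and im: "\<sigma> ` K = K" and x: "x \<in> carrier G"
  shows "(`) \<sigma> ` tf_class G K x = tf_class G K (\<sigma> x)"
proof -
  interpret Q: comm_group "G Mod generate G K" by (rule quotient_group[OF K])
  have hom: "\<sigma> \<in> hom G G" using \<sigma> by (auto simp: iso_def)
  interpret \<sigma>: group_hom G G \<sigma> using hom is_group by (simp add: group_hom_def group_hom_axioms_def)
  have N: "\<sigma> ` generate G K = generate G K" using \<sigma>.generate_img[OF K] im by simp
  have iso: "(`) \<sigma> \<in> iso (G Mod generate G K) (G Mod generate G K)"
    by (rule iso_image_FactGroup[OF \<sigma> generate_is_subgroup[OF K] N])
  have "(`) \<sigma> ` tf_class G K x =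
      torsion_elements (G Mod generate G K) #>\<^bsub>G Mod generate G K\<^esub> (\<sigma> ` (generate G K #> x))"
    unfolding tf_class_def
    using Q.image_r_coset[of "(`) \<sigma>" "torsion_elements (G Mod generate G K)"
      "generate G K #> x"] iso x
      image_torsion_elements[OF Q.is_group iso]
    by (simp add: iso_def carrier_FactGroup torsion_elements_def)
  then show ?thesis
    using image_r_coset[OF hom generate_incl[OF K] x] N by (simp add: tf_class_def)
qed

subsection \<open>The Farey tessellation and potentials\<close>

definition mat2 :: "int \<Rightarrow> int \<Rightarrow> int \<Rightarrow> int \<Rightarrow> imat" where
  "mat2 a b c d = vector [vector [a, b], vector [c, d]]"

lemma mat2_nth [simp]:
  "mat2 a b c d $ 1 $ 1 = a" "mat2 a b c d $ 1 $ 2 = b"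
  "mat2 a b c d $ 2 $ 1 = c" "mat2 a b c d $ 2 $ 2 = d" by (simp_all add: mat2_def)

lemma imat_eq_iff:
  "A = (B :: imat) \<longleftrightarrow> A $ 1 $ 1 = B $ 1 $ 1 \<and> A $ 1 $ 2 = B $ 1 $ 2 \<and> A $ 2 $ 1 = B $ 2 $ 1
    \<and> A $ 2 $ 2 = B $ 2 $ 2"
  by (auto simp: vec_eq_iff forall_2)

lemma mat2_eq_iff [simp]:
  "mat2 a b c d = mat2 a' b' c' d' \<longleftrightarrow> a = a' \<and> b = b' \<and> c = c' \<and> d = d'"
  by (auto simp: imat_eq_iff)

lemma mat2_cases: obtains a b c d where "A = mat2 a b c d"
  using imat_eq_iff[of A "mat2 (A $ 1 $ 1) (A $ 1 $ 2) (A $ 2 $ 1) (A $ 2 $ 2)"] by simp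

lemma mat2_mult [simp]:
  "mat2 a b c d ** mat2 a' b' c' d' =
     mat2 (a * a' + b * c') (a * b' + b * d') (c * a' + d * c') (c * b' + d * d')"
  by (simp add: imat_eq_iff matrix_matrix_mult_def sum_2)

lemma det_mat2 [simp]: "det (mat2 a b c d) = a * d - b * c" by (simp add: det_2)

lemma mat_eq_mat2: "(mat k :: imat) = mat2 k 0 0 k" by (simp add: imat_eq_iff mat_def)

lemma matS_eq_mat2: "matS = mat2 0 (- 1) 1 0" and matT_eq_mat2: "matT = mat2 1 1 0 1"
  by (simp_all add: matS_def matT_def mat2_def)

definition matU :: imat where "matU = matS ** matT"

lemma matU_eq_mat2: "matU = mat2 0 (- 1) 1 1"
  by (simp add: matU_def matS_eq_mat2 matT_eq_mat2)

lemmas mat2_simps = mat_eq_mat2 matS_eq_mat2 matT_eq_mat2 matU_eq_mat2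

definition mneg :: "imat \<Rightarrow> imat" where "mneg g = mat (- 1) ** g"

lemma mneg_mat2 [simp]: "mneg (mat2 a b c d) = mat2 (- a) (- b) (- c) (- d)"
  by (simp add: mneg_def mat_eq_mat2)

lemma mneg_nth [simp]: "mneg g $ i $ j = - g $ i $ j"
  using exhaust_2[of i] exhaust_2[of j] by (cases g rule: mat2_cases) auto

lemma mneg_mneg [simp]: "mneg (mneg g) = g" by (cases g rule: mat2_cases) simp

lemma mult_mneg [simp]: "g ** mneg h = mneg (g ** h)" "mneg g ** h = mneg (g ** h)"
  by (cases g rule: mat2_cases, cases h rule: mat2_cases, simp)+

lemma S_relation: "g ** matS ** matS = mneg g" and U_relation: "g ** matU ** matU ** matU = mneg g"
  and T_eq: "g ** matT = mneg (g ** matS ** matU)" and U_eq: "g ** matU = g ** matS ** matT"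
  by (cases g rule: mat2_cases, simp add: mat2_simps)+

lemma det_mult_S [simp]: "det (g ** matS) = det g" and det_mult_T [simp]: "det (g ** matT) = det g"
  and det_mult_U [simp]: "det (g ** matU) = det g" and det_mneg [simp]: "det (mneg g) = det g"
  by (cases g rule: mat2_cases, simp add: mat2_simps algebra_simps)+

text \<open>
  For a matrix with columns \<open>u, v\<close> we use the inner products, up to sign, of the superbase
  \<open>(u, - v, v - u)\<close>. Right multiplication by \<open>matU\<close> permutes them cyclically and \<open>matS\<close> changes
  the sign of the first one. Exactly one of the three is not positive, and crossing the
  corresponding edge of the Farey triangle leads towards the base triangles.
\<close>

definition cprod :: "imat \<Rightarrow> int" where
  "cprod g = g $ 1 $ 1 * g $ 1 $ 2 + g $ 2 $ 1 * g $ 2 $ 2"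

definition csize :: "imat \<Rightarrow> int" where
  "csize g = cprod g + cprod (g ** matU) + cprod (g ** matU ** matU)"

lemma cprod_mat2: "cprod (mat2 a b c d) = a * b + c * d" by (simp add: cprod_def)

lemma csize_mat2: "csize (mat2 a b c d) = a\<^sup>2 + b\<^sup>2 + c\<^sup>2 + d\<^sup>2 - a * b - c * d"
  by (simp add: csize_def cprod_mat2 mat2_simps power2_eq_square algebra_simps)

lemma cprod_mneg [simp]: "cprod (mneg g) = cprod g" and csize_mneg [simp]: "csize (mneg g) = csize g"
  by (cases g rule: mat2_cases, simp add: cprod_mat2 csize_mat2)+

lemma cprod_S [simp]: "cprod (g ** matS) = - cprod g"
  by (cases g rule: mat2_cases) (simp add: cprod_mat2 mat2_simps algebra_simps)

lemma csize_U [simp]: "csize (g ** matU) = csize g"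
  unfolding csize_def by (simp add: U_relation)

lemma csize_S: "csize (g ** matS) = csize g + 2 * cprod g"
  by (cases g rule: mat2_cases) (simp add: cprod_mat2 csize_mat2 mat2_simps algebra_simps)

lemma csize_nonneg: "0 \<le> csize g"
proof (cases g rule: mat2_cases)
  case (1 a b c d)
  have "2 * csize g = (a - b)\<^sup>2 + (c - d)\<^sup>2 + a\<^sup>2 + b\<^sup>2 + c\<^sup>2 + d\<^sup>2"
    unfolding 1 csize_mat2 by (simp add: power2_eq_square algebra_simps)
  moreover have "0 \<le> (a - b)\<^sup>2 + (c - d)\<^sup>2 + a\<^sup>2 + b\<^sup>2 + c\<^sup>2 + d\<^sup>2" by simp
  ultimately show ?thesis by linarith
qed

lemma csize_pos: "cprod g < 0 \<Longrightarrow> 0 < csize g"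
  using csize_nonneg[of "g ** matS"] by (simp add: csize_S)

text \<open>Selling's expression for the determinant of the Gram matrix of a lattice basis in terms
  of the three inner products of a superbase; here the Gram determinant is
  \<open>(det g)^2\<close>.\<close>

lemma cprod_identity:
  assumes "det g = 1"
  shows "cprod g * cprod (g ** matU) + cprod (g ** matU) * cprod (g ** matU ** matU)
    + cprod (g ** matU ** matU) * cprod g = 1"
proof (cases g rule: mat2_cases)
  case (1 a b c d)
  have "cprod g * cprod (g ** matU) + cprod (g ** matU) * cprod (g ** matU ** matU)
    + cprod (g ** matU ** matU) * cprod g = (a * d - b * c)\<^sup>2"
    unfolding 1 by (simp add: cprod_mat2 mat2_simps power2_eq_square algebra_simps)
  then show ?thesis using assms 1 by simp
qed

lemma cprod_sum_pos:
  assumes "det g = 1"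
  shows "cprod g + cprod (g ** matU) > 0"
proof (cases g rule: mat2_cases)
  case (1 a b c d)
  have "cprod g + cprod (g ** matU) = b\<^sup>2 + d\<^sup>2"
    unfolding 1 by (simp add: cprod_mat2 mat2_simps power2_eq_square algebra_simps)
  moreover have "b \<noteq> 0 \<or> d \<noteq> 0" using assms 1 by auto
  ultimately show ?thesis by (simp add: sum_power2_gt_zero_iff)
qed

text \<open>Sums of two of the products are squared norms of nonzero vectors, so at most one product
  is not positive. Three positive integers would make the left side of \<open>cprod_identity\<close>
  at least 3.\<close>

lemma cprod_cases:
  assumes "det g = 1"
  obtains "cprod g \<le> 0" "cprod (g ** matU) > 0" "cprod (g ** matU ** matU) > 0"
  | "cprod g > 0" "cprod (g ** matU) \<le> 0" "cprod (g ** matU ** matU) > 0"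
  | "cprod g > 0" "cprod (g ** matU) > 0" "cprod (g ** matU ** matU) \<le> 0"
proof -
  let ?p = "cprod g" and ?q = "cprod (g ** matU)" and ?r = "cprod (g ** matU ** matU)"
  have "?p + ?q > 0" "?q + ?r > 0" "?r + ?p > 0"
    using cprod_sum_pos[of g] cprod_sum_pos[of "g ** matU"] cprod_sum_pos[of "g ** matU ** matU"]
    by (simp_all add: assms U_relation)
  moreover have "\<not> (?p > 0 \<and> ?q > 0 \<and> ?r > 0)"
  proof
    assume *: "?p > 0 \<and> ?q > 0 \<and> ?r > 0"
    then have "0 < ?p * ?q" "0 < ?q * ?r" "0 < ?r * ?p" by simp_all
    then show False using cprod_identity[OF assms] by linarith
  qed
  ultimately show ?thesis using that by linarith
qed

lemma cprod_eq_0: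
  assumes "det g = 1" "cprod g = 0"
  shows "g \<in> {mat 1, mneg (mat 1), matS, mneg matS}"
proof (cases g rule: mat2_cases)
  case (1 a b c d)
  have det: "a * d - b * c = 1" and p: "a * b + c * d = 0" using assms 1 by (simp_all add: cprod_mat2)
  \<comment> \<open>Lagrange's identity: orthogonal columns of determinant 1 are unit
    vectors.\<close>
  have "(a\<^sup>2 + c\<^sup>2) * (b\<^sup>2 + d\<^sup>2) = (a * d - b * c)\<^sup>2 + (a * b + c * d)\<^sup>2"
    by (simp add: power2_eq_square algebra_simps)
  then have "(a\<^sup>2 + c\<^sup>2) * (b\<^sup>2 + d\<^sup>2) = 1" using det p by simp
  moreover have "a\<^sup>2 + c\<^sup>2 \<ge> 0" "b\<^sup>2 + d\<^sup>2 \<ge> 0" by simp_all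
  ultimately have ac: "a\<^sup>2 + c\<^sup>2 = 1" and "b\<^sup>2 + d\<^sup>2 = 1"
    using zmult_eq_1_iff[of "a\<^sup>2 + c\<^sup>2" "b\<^sup>2 + d\<^sup>2"] by linarith+
  moreover have "\<bar>x\<bar> \<le> 1" "\<bar>y\<bar> \<le> 1" if "x\<^sup>2 + y\<^sup>2 = (1 :: int)" for x y
    using that abs_square_le_1[of x] abs_square_le_1[of y] zero_le_power2[of x] zero_le_power2[of y]
    by linarith+
  ultimately have "\<bar>a\<bar> \<le> 1" "\<bar>b\<bar> \<le> 1" "\<bar>c\<bar> \<le> 1" "\<bar>d\<bar> \<le> 1" by blast+
  then have "a \<in> {-1, 0, 1}" "b \<in> {-1, 0, 1}" "c \<in> {-1, 0, 1}" "d \<in> {-1, 0, 1}" by auto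
  then show ?thesis
    using det p ac unfolding 1 by (elim insertE emptyE) (simp_all add: mat2_simps)
qed

text \<open>The primitive of a cocycle, summed along the descent to the base edge. Crossing an edge
  at negative \<open>cprod\<close> lowers \<open>csize\<close>; a rotation keeps
  \<open>csize\<close> but lands at a nonpositive product, which the second measure records. On the
  base edge the values at 1 and \<open>matS\<close> differ by \<open>a (mat 1)\<close>, as
  \<open>pot_S\<close> requires. By \<open>cprod_cases\<close> the last branch is never reached for
  determinant 1.\<close>

function potential :: "(imat \<Rightarrow> int) \<Rightarrow> (imat \<Rightarrow> int) \<Rightarrow> imat \<Rightarrow> int" where
  "potential a c g =
     (if det g \<noteq> 1 then 0
      else if cprod g < 0 then potential a c (g ** matS) + a (g ** matS)
      else if cprod g = 0 then (if g $ 1 $ 1 = 0 then a (mat 1) else 0)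
      else if cprod (g ** matU) \<le> 0 then potential a c (g ** matU) - c g
      else if cprod (g ** matU ** matU) \<le> 0
        then potential a c (g ** matU ** matU) + c (g ** matU ** matU)
      else 0)" by pat_completeness auto
termination
  by (relation "measures [\<lambda>(a, c, g). nat (csize g), \<lambda>(a, c, g). if cprod g > 0 then 1 else 0]")
     (auto simp: csize_S intro: csize_pos)

declare potential.simps [simp del]

lemma potential_neg:
  assumes "\<And>g. a (mneg g) = a g" "\<And>g. c (mneg g) = c g"
  shows "potential a c (mneg g) = potential a c g" using assms
proof (induction a c g rule: potential.induct)
  case (1 a c g)
  show ?case
    by (subst potential.simps[of a c "mneg g"], subst potential.simps[of a c g]) (use 1 in simp)
qed

text \<open>Generation of the modular group by S and T, extracted from the recursion of
  \<open>potential\<close> with zero coefficients: each recursive call is a right multiplication by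
  a word in S and T. The hypotheses are equivalences because the descent runs from \<open>g\<close>
  back to the base.\<close>

theorem SL2Z_induct [consumes 1, case_names one S T]:
  assumes "det g = 1" and one: "P (mat 1)"
    and S: "\<And>g. det g = 1 \<Longrightarrow> P (g ** matS) \<longleftrightarrow> P g"
    and T: "\<And>g. det g = 1 \<Longrightarrow> P (g ** matT) \<longleftrightarrow> P g"
  shows "P g" using assms(1)
proof (induction "\<lambda>_ :: imat. 0 :: int" "\<lambda>_ :: imat. 0 :: int" g rule: potential.induct)
  case (1 g)
  have U: "P (h ** matU) \<longleftrightarrow> P h" if "det h = 1" for h
    using S[of h] T[of "h ** matS"] that by (simp add: U_eq)
  have neg: "P (mneg h) \<longleftrightarrow> P h" if "det h = 1" for h
    using S[of h] S[of "h ** matS"] that by (simp add: S_relation)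
  show ?case
  proof (cases "cprod g" "0 :: int" rule: linorder_cases)
    case less
    then show ?thesis using 1 S[of g] by simp
  next
    case equal
    have "P matS" using S[of "mat 1"] one by simp
    then show ?thesis
      using cprod_eq_0[OF "1.prems" equal] one neg[of "mat 1"] neg[of matS]
        by (auto simp: matS_eq_mat2)
  next
    case greater
    then show ?thesis
      using 1 U[of g] U[of "g ** matU"] by (cases rule: cprod_cases[OF "1.prems"]) auto
  qed
qed

locale cayley_cochain =
  fixes a b :: "imat \<Rightarrow> int"
  assumes a_neg [simp]: "a (mneg g) = a g" and b_neg [simp]: "b (mneg g) = b g"
    and a_S: "det g = 1 \<Longrightarrow> a (g ** matS) = - a g"
    and triangle: "det g = 1 \<Longrightarrow> a g + a (g ** matU) + a (g ** matU ** matU)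
      + b (g ** matS) + b (g ** matU ** matS) + b (g ** matU ** matU ** matS) = 0"
begin

text \<open>The value on \<open>{g, gU}\<close>, since \<open>U = ST\<close>.\<close>

definition c :: "imat \<Rightarrow> int" where "c g = a g + b (g ** matS)"

abbreviation "pot \<equiv> potential a c"

lemma c_neg [simp]: "c (mneg g) = c g" by (simp add: c_def)

lemma pot_neg [simp]: "pot (mneg g) = pot g" by (rule potential_neg) simp_all

lemma pot_S:
  assumes "det g = 1" shows "pot (g ** matS) = pot g + a g"
proof (cases "cprod g" "0 :: int" rule: linorder_cases)
  case less
  then show ?thesis using potential.simps[of a c g] assms by (simp add: a_S)
next
  case equal
  have "a (matS ** matS) = a (mat 1)" using a_neg[of "mat 1"] by (simp add: mat2_simps)
  then have "a matS = - a (mat 1)" using a_S[of "mat 1"] by simp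
  moreover have "cprod (mat 1) = 0" "cprod matS = 0" "det (mat 1 :: imat) = 1" "det matS = 1"
    by (simp_all add: mat2_simps cprod_mat2)
  then have "pot (mat 1) = 0" "pot matS = a (mat 1)"
    using potential.simps[of a c "mat 1"] potential.simps[of a c matS] by (simp_all add: mat2_simps)
  moreover have "matS ** matS = mneg (mat 1)" by (simp add: mat2_simps)
  ultimately show ?thesis using cprod_eq_0[OF assms equal] by auto
next
  case greater
  then have "pot (g ** matS) = pot (g ** matS ** matS) + a (g ** matS ** matS)"
    using potential.simps[of a c "g ** matS"] assms by simp
  then show ?thesis by (simp add: S_relation)
qed

text \<open>If the descent leaves the triangle at \<open>g\<close> or at \<open>gU\<close>, the
  recursion itself gives the claim. If it leaves at the third vertex, \<open>g\<close> and
  \<open>gU\<close> are reached on two different sides, and the triangle relation closes the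
  loop.\<close>

lemma pot_U:
  assumes g: "det g = 1" shows "pot (g ** matU) = pot g + c g"
proof (cases rule: cprod_cases[OF g])
  case 1
  have "pot (g ** matU) = pot (g ** matU ** matU ** matU) + c (g ** matU ** matU ** matU)"
    using potential.simps[of a c "g ** matU"] 1 g by (simp add: U_relation)
  then show ?thesis by (simp add: U_relation)
next
  case 2
  then show ?thesis using potential.simps[of a c g] g by simp
next
  case 3
  have "pot g = pot (g ** matU ** matU) + c (g ** matU ** matU)"
    using potential.simps[of a c g] 3 g by simp
  moreover have "pot (g ** matU) = pot (g ** matU ** matU) - c (g ** matU)"
    using potential.simps[of a c "g ** matU"] 3 g by simp
  moreover have "c g + c (g ** matU) + c (g ** matU ** matU) = 0"
    using triangle[OF g] by (simp add: c_def)
  ultimately show ?thesis by simp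
qed

lemma pot_T:
  assumes "det g = 1" shows "pot (g ** matT) = pot g + b g"
proof -
  have "pot (g ** matT) = pot (g ** matS) + c (g ** matS)"
    using pot_U[of "g ** matS"] assms by (simp add: T_eq)
  then show ?thesis using assms by (simp add: pot_S a_S c_def S_relation)
qed

end

subsection \<open>Mixed modular symbols as cochains\<close>

lemma carrier_SL2Z [simp]: "g \<in> carrier SL2Z \<longleftrightarrow> det g = 1"
  and mult_SL2Z [simp]: "g \<otimes>\<^bsub>SL2Z\<^esub> h = g ** h" and one_SL2Z [simp]: "\<one>\<^bsub>SL2Z\<^esub> = mat 1"
  by (simp_all add: SL2Z_def)

definition minv :: "imat \<Rightarrow> imat" where
  "minv g = mat2 (g $ 2 $ 2) (- g $ 1 $ 2) (- g $ 2 $ 1) (g $ 1 $ 1)"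

lemma minv_mat2 [simp]: "minv (mat2 a b c d) = mat2 d (- b) (- c) a" by (simp add: minv_def)

lemma det_minv [simp]: "det (minv g) = det g" by (cases g rule: mat2_cases) simp

lemma minv_left: "det g = 1 \<Longrightarrow> minv g ** g = mat 1" and minv_right: "det g = 1 \<Longrightarrow> g ** minv g = mat 1"
  by (cases g rule: mat2_cases, simp add: mat2_simps algebra_simps)+

lemma minv_cancel [simp]:
  assumes "det g = 1"
  shows "minv g ** (g ** h) = h" "g ** (minv g ** h) = h" "h ** g ** minv g = h"
    "h ** minv g ** g = h"
  using minv_left[OF assms] minv_right[OF assms]
  by (simp_all add: matrix_mul_assoc) (simp_all add: matrix_mul_assoc[symmetric])

lemma group_SL2Z: "group SL2Z"
proof (rule groupI)
  fix g assume "g \<in> carrier SL2Z"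
  then show "\<exists>h\<in>carrier SL2Z. h \<otimes>\<^bsub>SL2Z\<^esub> g = \<one>\<^bsub>SL2Z\<^esub>"
    using minv_left[of g] by (intro bexI[of _ "minv g"]) auto
qed (auto simp: det_mul matrix_mul_assoc)

interpretation SL2Z: group SL2Z by (rule group_SL2Z)

lemma inv_SL2Z: "det g = 1 \<Longrightarrow> inv\<^bsub>SL2Z\<^esub> g = minv g"
  by (rule SL2Z.inv_equality) (auto simp: minv_left)

lemma matT_pow: "matT [^]\<^bsub>SL2Z\<^esub> (m :: int) = mat2 1 m 0 1"
proof (induction m rule: int_induct[where ?k = 0])
  case base
  then show ?case by (simp add: mat2_simps)
next
  case (step1 i)
  then show ?case using SL2Z.int_pow_mult[of matT i 1] by (simp add: mat2_simps)
next
  case (step2 i)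
  have "matT [^]\<^bsub>SL2Z\<^esub> (i - 1) = matT [^]\<^bsub>SL2Z\<^esub> i ** inv\<^bsub>SL2Z\<^esub> matT"
    using SL2Z.int_pow_mult[of matT i "-1"] SL2Z.int_pow_neg[of matT 1] by (simp add: mat2_simps)
  then show ?case using step2 by (simp add: inv_SL2Z mat2_simps)
qed

lemma det_mult_T_pow [simp]: "det (g ** mat2 1 m 0 1) = det g"
  by (cases g rule: mat2_cases) (simp add: algebra_simps)

lemma mat_sign: "(\<epsilon> :: int) \<in> {1, - 1} \<Longrightarrow> mat \<epsilon> ** g = g \<or> mat \<epsilon> ** g = mneg g"
  by (auto simp: mneg_def)

interpretation symbol_group: comm_group symbol_group
  unfolding symbol_group_def by (rule abelian_free_Abelian_group)

lemma symbol_group_simps [simp]: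
  "x \<otimes>\<^bsub>symbol_group\<^esub> y = x + y" "\<one>\<^bsub>symbol_group\<^esub> = 0"
  "frag_of (g, h) \<in> carrier symbol_group \<longleftrightarrow> det g = 1 \<and> det h = 1"
  by (simp_all add: symbol_group_def)

lemma symbol_group_closed:
  "0 \<in> carrier symbol_group"
  "x \<in> carrier symbol_group \<Longrightarrow> y \<in> carrier symbol_group \<Longrightarrow> x + y \<in> carrier symbol_group"
  "x \<in> carrier symbol_group \<Longrightarrow> y \<in> carrier symbol_group \<Longrightarrow> x - y \<in> carrier symbol_group"
  "x \<in> carrier symbol_group \<Longrightarrow> frag_cmul m x \<in> carrier symbol_group"
  unfolding symbol_group_def carrier_free_Abelian_group_iff
  using keys_add[of x y] keys_diff[of x y] keys_cmul[of m x] by auto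

lemma symbol_group_induct [consumes 1, case_names zero diff frag_of]:
  assumes "x \<in> carrier symbol_group" "P 0"
    "\<And>x y. x \<in> carrier symbol_group \<Longrightarrow> y \<in> carrier symbol_group \<Longrightarrow> P x \<Longrightarrow> P y \<Longrightarrow> P (x - y)"
    "\<And>g h. det g = 1 \<Longrightarrow> det h = 1 \<Longrightarrow> P (frag_of (g, h))"
  shows "P x" using assms free_Abelian_group_induct[of x "carrier SL2Z \<times> carrier SL2Z" P]
  by (auto simp: symbol_group_def)

lemma symbol_group_hom:
  assumes "h \<in> hom symbol_group integer_group"
  shows "h 0 = 0" "x \<in> carrier symbol_group \<Longrightarrow> h (frag_cmul m x) = m * h x"
    "x \<in> carrier symbol_group \<Longrightarrow> y \<in> carrier symbol_group \<Longrightarrow> h (x + y) = h x + h y"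
    "x \<in> carrier symbol_group \<Longrightarrow> y \<in> carrier symbol_group \<Longrightarrow> h (x - y) = h x - h y"
proof -
  show "h 0 = 0" using hom_int_one[OF assms symbol_group.is_group] by simp
  show add: "h (x + y) = h x + h y" if "x \<in> carrier symbol_group" "y \<in> carrier symbol_group" for x y
    using hom_mult[OF assms that] by simp
  then show "h (x - y) = h x - h y" if "x \<in> carrier symbol_group" "y \<in> carrier symbol_group"
    using add[of "x - y" y] that by (simp add: symbol_group_closed)
  show "h (frag_cmul m x) = m * h x" if "x \<in> carrier symbol_group"
    using hom_int_pow[OF assms that symbol_group.is_group group_integer_group, of m] that
    by (simp add: symbol_group_def)
qed

lemma symbol_relators_subset: "symbol_relators \<subseteq> carrier symbol_group"
  unfolding symbol_relators_def
  by (auto intro!: symbol_group_closed simp: matT_pow mneg_def[symmetric])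

lemma symbol_relators_intros:
  "det g = 1 \<Longrightarrow> det g' = 1 \<Longrightarrow> det g'' = 1 \<Longrightarrow>
    frag_of (g, g') + frag_of (g', g'') + frag_of (g'', g) \<in> symbol_relators"
  "det g = 1 \<Longrightarrow> det g' = 1 \<Longrightarrow> \<epsilon> \<in> {1, - 1} \<Longrightarrow> \<epsilon>' \<in> {1, - 1} \<Longrightarrow>
    frag_of (g, g') - frag_of (mat \<epsilon> ** g, mat \<epsilon>' ** g') \<in> symbol_relators"
  "det g = 1 \<Longrightarrow>
    frag_of (g, g ** (matT [^]\<^bsub>SL2Z\<^esub> (m :: int)))
      - frag_cmul m (frag_of (g, g ** matT)) \<in> symbol_relators"
  unfolding symbol_relators_def
    apply (rule UnI1, rule UnI1, rule CollectI, rule exI[of _ g], rule exI[of _ g'], rule exI[of _ g''], simp)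
   apply (rule UnI1, rule UnI2, rule CollectI, rule exI[of _ g], rule exI[of _ g'],
      rule exI[of _ \<epsilon>], rule exI[of _ \<epsilon>'], simp only: carrier_SL2Z simp_thms)
  apply (rule UnI2, rule CollectI, rule exI[of _ g], rule exI[of _ m], simp)
  done

lemma symbol_relators_cases:
  assumes "x \<in> symbol_relators"
  obtains (cycle) g g' g'' where "x = frag_of (g, g') + frag_of (g', g'') + frag_of (g'', g)"
      "det g = 1" "det g' = 1" "det g'' = 1"
  | (sign) g g' \<epsilon> \<epsilon>' where "x = frag_of (g, g') - frag_of (mat \<epsilon> ** g, mat \<epsilon>' ** g')"
      "det g = 1" "det g' = 1" "\<epsilon> \<in> {1, - 1}" "\<epsilon>' \<in> {1, - 1}"
  | (power) g and m :: int
    where "x = frag_of (g, g ** (matT [^]\<^bsub>SL2Z\<^esub> m)) - frag_cmul m (frag_of (g, g ** matT))"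
      "det g = 1"
proof -
  from assms show thesis unfolding symbol_relators_def Un_iff mem_Collect_eq carrier_SL2Z
    by (elim disjE exE conjE)
       (rule that(1), assumption+, rule that(2), assumption+, rule that(3), assumption+)
qed

lemma symbol_act_frag_of [simp]: "symbol_act g (frag_of (h, k)) = frag_of (g ** h, g ** k)"
  by (simp add: symbol_act_def)

lemma symbol_act_linear [simp]:
  "symbol_act g (x + y) = symbol_act g x + symbol_act g y"
  "symbol_act g (x - y) = symbol_act g x - symbol_act g y"
  "symbol_act g (frag_cmul m x) = frag_cmul m (symbol_act g x)" "symbol_act g 0 = 0"
  by (simp_all add: symbol_act_def frag_extend_add frag_extend_diff frag_extend_cmul)

lemma symbol_act_act:
  assumes "x \<in> carrier symbol_group" shows "symbol_act g (symbol_act h x) = symbol_act (g ** h) x"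
  using assms by (induction rule: symbol_group_induct) (auto simp: matrix_mul_assoc)

lemma symbol_act_one:
  assumes "x \<in> carrier symbol_group" shows "symbol_act (mat 1) x = x"
  using assms by (induction rule: symbol_group_induct) auto

lemma symbol_act_closed:
  assumes "x \<in> carrier symbol_group" "det g = 1" shows "symbol_act g x \<in> carrier symbol_group"
  using assms by (induction rule: symbol_group_induct)
    (auto simp: det_mul symbol_group_closed)

lemma symbol_act_inverse:
  assumes "x \<in> carrier symbol_group" "det g = 1"
  shows "symbol_act g (symbol_act (minv g) x) = x" "symbol_act (minv g) (symbol_act g x) = x"
  using assms by (simp_all add: symbol_act_act symbol_act_one minv_left minv_right)

lemma symbol_act_iso:
  assumes "det g = 1" shows "symbol_act g \<in> iso symbol_group symbol_group"
proof (rule isoI)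
  show "symbol_act g \<in> hom symbol_group symbol_group"
    by (rule homI) (auto simp: symbol_act_closed assms)
  show "bij_betw (symbol_act g) (carrier symbol_group) (carrier symbol_group)"
    by (rule bij_betw_byWitness[of _ "symbol_act (minv g)"])
       (auto simp: symbol_act_inverse symbol_act_closed assms)
qed

lemma symbol_act_relators_subset:
  assumes g: "det g = 1" shows "symbol_act g ` symbol_relators \<subseteq> symbol_relators"
proof -
  have comm: "g ** (mat \<epsilon> ** h) = mat \<epsilon> ** (g ** h)" if "\<epsilon> \<in> {1, - 1}" for \<epsilon> :: int and h :: imat
    using that by (auto simp: mneg_def[symmetric])
  have 1: "symbol_act g x \<in> symbol_relators"
    if "x = frag_of (h, h') + frag_of (h', h'') + frag_of (h'', h)" "det h = 1" "det h' = 1"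
      "det h'' = 1" for x h h' h''
    using symbol_relators_intros(1)[of "g ** h" "g ** h'" "g ** h''"] that g by (simp add: det_mul)
  have 2: "symbol_act g x \<in> symbol_relators"
    if "x = frag_of (h, h') - frag_of (mat \<epsilon> ** h, mat \<epsilon>' ** h')" "det h = 1" "det h' = 1"
      "\<epsilon> \<in> {1, - 1}" "\<epsilon>' \<in> {1, - 1}" for x h h' \<epsilon> \<epsilon>'
    using symbol_relators_intros(2)[of "g ** h" "g ** h'", OF _ _ that(4,5)] that(1,2,3) g
      comm[OF that(4)] comm[OF that(5)] by (simp add: det_mul)
  have 3: "symbol_act g x \<in> symbol_relators"
    if "x = frag_of (h, h ** (matT [^]\<^bsub>SL2Z\<^esub> m)) - frag_cmul m (frag_of (h, h ** matT))" "det h = 1"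
    for x h and m :: int
    using symbol_relators_intros(3)[of "g ** h" m] that g by (simp add: det_mul matrix_mul_assoc)
  show ?thesis
  proof
    fix y assume "y \<in> symbol_act g ` symbol_relators"
    then obtain x where x: "x \<in> symbol_relators" "y = symbol_act g x" by blast
    from x(1) have "symbol_act g x \<in> symbol_relators"
    proof (cases rule: symbol_relators_cases)
      case cycle then show ?thesis by (rule 1)
    next
      case sign then show ?thesis by (rule 2)
    next
      case power then show ?thesis by (rule 3)
    qed
    with x(2) show "y \<in> symbol_relators" by simp
  qed
qed

lemma symbol_act_relators:
  assumes g: "det g = 1" shows "symbol_act g ` symbol_relators = symbol_relators"
proof
  show "symbol_relators \<subseteq> symbol_act g ` symbol_relators"
  proof
    fix x assume x: "x \<in> symbol_relators"
    then have "symbol_act (minv g) x \<in> symbol_relators"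
      using symbol_act_relators_subset[of "minv g"] g by (simp add: image_subset_iff)
    moreover have "x = symbol_act g (symbol_act (minv g) x)"
      using symbol_act_inverse(1)[OF subsetD[OF symbol_relators_subset x] g] by simp
    ultimately show "x \<in> symbol_act g ` symbol_relators" by blast
  qed
qed (rule symbol_act_relators_subset[OF g])

abbreviation "mixed_class \<equiv> tf_class symbol_group symbol_relators"

interpretation mixed_symbols: comm_group mixed_symbols
  unfolding mixed_symbols_def
  by (rule symbol_group.torsion_free_quotient_group[OF symbol_relators_subset])

lemma mixed_class_hom: "mixed_class \<in> hom symbol_group mixed_symbols"
  unfolding mixed_symbols_def by (rule symbol_group.tf_class_hom[OF symbol_relators_subset])

lemma carrier_mixed_symbols: "carrier mixed_symbols = mixed_class ` carrier symbol_group"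
  unfolding mixed_symbols_def
  by (rule symbol_group.carrier_torsion_free_quotient[OF symbol_relators_subset])

lemma mixed_act_class:
  assumes "det g = 1" "x \<in> carrier symbol_group"
  shows "mixed_act g (mixed_class x) = mixed_class (symbol_act g x)" unfolding mixed_act_def
  by (rule symbol_group.image_tf_class[OF symbol_act_iso[OF assms(1)] symbol_relators_subset
      symbol_act_relators[OF assms(1)] assms(2)])

text \<open>What a homomorphism out of the coinvariants looks like on symbols:
  \<open>symbol_cochain_of_dual\<close> and \<open>dual_of_symbol_cochain\<close> pass between the
  two descriptions.\<close>

definition symbol_cochain :: "imat set \<Rightarrow> (imat \<Rightarrow> imat \<Rightarrow> int) \<Rightarrow> bool" where
  "symbol_cochain \<Gamma> c \<longleftrightarrow>
     (\<forall>g g' g''. det g = 1 \<longrightarrow> det g' = 1 \<longrightarrow> det g'' = 1 \<longrightarrow> c g g' + c g' g'' + c g'' g = 0) \<and>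
     (\<forall>g g'. det g = 1 \<longrightarrow> det g' = 1 \<longrightarrow> c (mneg g) g' = c g g' \<and> c g (mneg g') = c g g') \<and>
     (\<forall>g m. det g = 1 \<longrightarrow> c g (g ** mat2 1 m 0 1) = m * c g (g ** matT)) \<and>
     (\<forall>\<gamma>\<in>\<Gamma>. \<forall>g g'. det g = 1 \<longrightarrow> det g' = 1 \<longrightarrow> c (\<gamma> ** g) (\<gamma> ** g') = c g g')"

lemma
  assumes "symbol_cochain \<Gamma> c" "det p = 1" "det q = 1"
  shows symbol_cochain_swap: "c q p = - c p q"
    and symbol_cochain_mneg: "c (mneg p) q = c p q" "c p (mneg q) = c p q"
    and symbol_cochain_chain: "det r = 1 \<Longrightarrow> c p r = c p q + c q r"
proof -
  have *: "c p q + c q r + c r p = 0" if "det p = 1" "det q = 1" "det r = 1" for p q r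
    using assms(1) that by (simp add: symbol_cochain_def)
  have refl: "c p p = 0" if "det p = 1" for p using *[OF that that that] by simp
  have swap: "c q p = - c p q" if "det p = 1" "det q = 1" for p q
    using *[of p q p] refl[of p] that by simp
  show "c q p = - c p q" by (rule swap[OF assms(2,3)])
  show "c p r = c p q + c q r" if "det r = 1"
    using *[of p q r] swap[of p r] assms that by simp
  show "c (mneg p) q = c p q" "c p (mneg q) = c p q"
    using assms by (simp_all add: symbol_cochain_def)
qed

context
  fixes \<Gamma> assumes \<Gamma>: "\<Gamma> \<subseteq> carrier SL2Z"
begin

lemma coinvariant_relators_subset: "coinvariant_relators \<Gamma> \<subseteq> carrier mixed_symbols"
proof -
  have "mixed_act \<gamma> m \<in> carrier mixed_symbols" if "\<gamma> \<in> \<Gamma>" "m \<in> carrier mixed_symbols" for \<gamma> m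
    using that \<Gamma> by (auto simp: carrier_mixed_symbols mixed_act_class symbol_act_closed)
  then show ?thesis
    unfolding coinvariant_relators_def by (auto intro!: mixed_symbols.m_closed)
qed

interpretation Mod: comm_group "mixed_symbols_mod \<Gamma>"
  unfolding mixed_symbols_mod_def
  by (rule mixed_symbols.torsion_free_quotient_group[OF coinvariant_relators_subset])

lemma symbol_cochain_of_dual:
  assumes \<phi>: "\<phi> \<in> hom (mixed_symbols_mod \<Gamma>) integer_group"
  shows "symbol_cochain \<Gamma> (\<lambda>g g'. \<phi> (mixed_symbol_mod \<Gamma> g g'))"
proof -
  let ?q = "tf_class mixed_symbols (coinvariant_relators \<Gamma>)"
  define h where "h = \<phi> \<circ> (?q \<circ> mixed_class)"
  have q: "?q \<in> hom mixed_symbols (mixed_symbols_mod \<Gamma>)"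
    unfolding mixed_symbols_mod_def
      by (rule mixed_symbols.tf_class_hom[OF coinvariant_relators_subset])
  then have \<phi>q: "\<phi> \<circ> ?q \<in> hom mixed_symbols integer_group"
    using \<phi> by (intro Group.hom_compose)
  then have h: "h \<in> hom symbol_group integer_group"
    unfolding h_def using \<phi> q mixed_class_hom by (intro Group.hom_compose)
  note h_simps = symbol_group_hom[OF h]
  have h_rel: "h x = 0" if "x \<in> symbol_relators" for x
  proof -
    have "mixed_class x = \<one>\<^bsub>mixed_symbols\<^esub>" unfolding mixed_symbols_def
      by (rule symbol_group.tf_class_relator[OF symbol_relators_subset that])
    then show ?thesis using hom_int_one[OF \<phi>q mixed_symbols.is_group] by (simp add: h_def)
  qed
  have sym: "\<phi> (mixed_symbol_mod \<Gamma> g g') = h (frag_of (g, g'))" for g g'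
    by (simp add: h_def mixed_symbol_mod_def mixed_symbol_def)
  have inv: "h (frag_of (\<gamma> ** g, \<gamma> ** g')) = h (frag_of (g, g'))"
    if "\<gamma> \<in> \<Gamma>" "det g = 1" "det g' = 1" for \<gamma> g g'
  proof -
    let ?m = "mixed_class (frag_of (g, g'))"
    have \<gamma>: "det \<gamma> = 1" using that \<Gamma> by auto
    have m: "?m \<in> carrier mixed_symbols" "mixed_act \<gamma> ?m \<in> carrier mixed_symbols"
      using that \<gamma> by (auto simp: carrier_mixed_symbols mixed_act_class symbol_act_closed det_mul)
    have "mixed_act \<gamma> ?m \<otimes>\<^bsub>mixed_symbols\<^esub> inv\<^bsub>mixed_symbols\<^esub> ?m \<in> coinvariant_relators \<Gamma>"
      unfolding coinvariant_relators_def using that m by blast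
    then have "?q (mixed_act \<gamma> ?m \<otimes>\<^bsub>mixed_symbols\<^esub> inv\<^bsub>mixed_symbols\<^esub> ?m) = \<one>\<^bsub>mixed_symbols_mod \<Gamma>\<^esub>"
      unfolding mixed_symbols_mod_def
      by (rule mixed_symbols.tf_class_relator[OF coinvariant_relators_subset])
    then have "(\<phi> \<circ> ?q) (mixed_act \<gamma> ?m \<otimes>\<^bsub>mixed_symbols\<^esub> inv\<^bsub>mixed_symbols\<^esub> ?m) = 0"
      using hom_int_one[OF \<phi> Mod.is_group] by simp
    moreover have "(\<phi> \<circ> ?q) (mixed_act \<gamma> ?m \<otimes>\<^bsub>mixed_symbols\<^esub> inv\<^bsub>mixed_symbols\<^esub> ?m) + (\<phi> \<circ> ?q) ?m
        = (\<phi> \<circ> ?q) (mixed_act \<gamma> ?m)"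
      using hom_mult[OF \<phi>q, of "mixed_act \<gamma> ?m \<otimes>\<^bsub>mixed_symbols\<^esub> inv\<^bsub>mixed_symbols\<^esub> ?m" ?m] m
      by (simp add: mixed_symbols.m_assoc del: comp_apply)
    ultimately show ?thesis using that \<gamma> by (simp add: h_def mixed_act_class)
  qed
  show ?thesis unfolding symbol_cochain_def sym
  proof (intro conjI allI ballI impI)
    fix g g' g'' :: imat assume d: "det g = 1" "det g' = 1" "det g'' = 1"
    from h_rel[OF symbol_relators_intros(1)[OF d]] show "h (frag_of (g, g'))
      + h (frag_of (g', g'')) + h (frag_of (g'', g)) = 0"
      using d by (simp add: h_simps symbol_group_closed)
  next
    fix g g' :: imat assume d: "det g = 1" "det g' = 1"
    note * = symbol_relators_intros(2)[OF d]
    show "h (frag_of (mneg g, g')) = h (frag_of (g, g'))"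
      using h_rel[OF *[of "-1" 1]] d by (simp add: h_simps mneg_def[symmetric])
    show "h (frag_of (g, mneg g')) = h (frag_of (g, g'))"
      using h_rel[OF *[of 1 "-1"]] d by (simp add: h_simps mneg_def[symmetric])
  next
    fix g :: imat and m assume d: "det g = 1"
    from h_rel[OF symbol_relators_intros(3)[OF d]] show "h (frag_of (g, g ** mat2 1 m 0 1))
      = m * h (frag_of (g, g ** matT))"
      using d by (simp add: h_simps matT_pow symbol_group_closed)
  qed (use inv in auto)
qed

lemma dual_of_symbol_cochain:
  assumes c: "symbol_cochain \<Gamma> c"
  obtains \<phi> where "\<phi> \<in> int_dual (mixed_symbols_mod \<Gamma>)"
    "\<And>g g'. det g = 1 \<Longrightarrow> det g' = 1 \<Longrightarrow> \<phi> (mixed_symbol_mod \<Gamma> g g') = c g g'"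
proof -
  obtain h where "h \<in> hom (free_Abelian_group (carrier SL2Z \<times> carrier SL2Z)) integer_group"
    "\<And>x. x \<in> carrier SL2Z \<times> carrier SL2Z \<Longrightarrow> h (frag_of x) = (\<lambda>(g, g'). c g g') x"
    using comm_group.free_Abelian_group_universal[OF abelian_integer_group,
        of "\<lambda>(g, g'). c g g'" "carrier SL2Z \<times> carrier SL2Z"] by (auto simp: split_def)
  then have h: "h \<in> hom symbol_group integer_group"
    and hc: "\<And>g g'. det g = 1 \<Longrightarrow> det g' = 1 \<Longrightarrow> h (frag_of (g, g')) = c g g'"
    by (auto simp: symbol_group_def)
  note h_simps = symbol_group_hom[OF h]
  have c_neg: "c (mneg g) g' = c g g'" "c g (mneg g') = c g g'" if "det g = 1" "det g' = 1" for g g'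
    using c that unfolding symbol_cochain_def by auto
  have 1: "h (frag_of (g, g') + frag_of (g', g'') + frag_of (g'', g)) = 0"
    if "det g = 1" "det g' = 1" "det g'' = 1" for g g' g''
    using that c by (simp add: h_simps hc symbol_group_closed symbol_cochain_def)
  have 2: "h (frag_of (g, g') - frag_of (mat \<epsilon> ** g, mat \<epsilon>' ** g')) = 0"
    if "det g = 1" "det g' = 1" "\<epsilon> \<in> {1, - 1}" "\<epsilon>' \<in> {1, - 1}" for g g' \<epsilon> \<epsilon>'
  proof -
    have "det (mat \<epsilon> ** g) = 1" "det (mat \<epsilon>' ** g') = 1"
      using mat_sign[OF that(3), of g] mat_sign[OF that(4), of g'] that(1,2) by auto
    moreover have "c (mat \<epsilon> ** g) (mat \<epsilon>' ** g') = c g g'"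
      using mat_sign[OF that(3), of g] mat_sign[OF that(4), of g'] that(1,2) c_neg by auto
    ultimately show ?thesis using that(1,2) by (simp add: h_simps hc)
  qed
  have 3: "h (frag_of (g, g ** (matT [^]\<^bsub>SL2Z\<^esub> m)) - frag_cmul m (frag_of (g, g ** matT))) = 0"
    if "det g = 1" for g and m :: int
    using that c by (simp add: h_simps hc matT_pow symbol_group_closed symbol_cochain_def)
  have rel: "h x = 0" if "x \<in> symbol_relators" for x using that
  proof (cases rule: symbol_relators_cases)
    case cycle then show ?thesis using 1 by simp
  next
    case sign then show ?thesis using 2 by simp
  next
    case power then show ?thesis using 3 by simp
  qed
  obtain k where k: "k \<in> hom mixed_symbols integer_group"
    "\<And>x. x \<in> carrier symbol_group \<Longrightarrow> k (mixed_class x) = h x" unfolding mixed_symbols_def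
    using symbol_group.torsion_free_quotient_universal[OF symbol_relators_subset h rel] by metis
  have h_act: "h (symbol_act \<gamma> x) = h x" if "\<gamma> \<in> \<Gamma>" "x \<in> carrier symbol_group" for \<gamma> x
  proof -
    have \<gamma>: "det \<gamma> = 1" using that \<Gamma> by auto
    show ?thesis using that(2) that(1) c \<gamma> by (induction rule: symbol_group_induct)
         (auto simp: h_simps symbol_act_closed hc det_mul symbol_cochain_def)
  qed
  have "k y = 0" if y: "y \<in> coinvariant_relators \<Gamma>" for y
  proof -
    obtain \<gamma> x where x: "\<gamma> \<in> \<Gamma>" "x \<in> carrier symbol_group"
      "y = mixed_act \<gamma> (mixed_class x) \<otimes>\<^bsub>mixed_symbols\<^esub> inv\<^bsub>mixed_symbols\<^esub> (mixed_class x)"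
      using y unfolding coinvariant_relators_def carrier_mixed_symbols by blast
    have \<gamma>: "det \<gamma> = 1" using x \<Gamma> by auto
    have m: "mixed_class x \<in> carrier mixed_symbols"
      "mixed_act \<gamma> (mixed_class x) \<in> carrier mixed_symbols"
      using x \<gamma> by (auto simp: carrier_mixed_symbols mixed_act_class symbol_act_closed)
    have "k y + k (mixed_class x) = k (mixed_act \<gamma> (mixed_class x))"
      using hom_mult[OF k(1), of y "mixed_class x"] m x(3) by (simp add: mixed_symbols.m_assoc)
    also have "\<dots> = k (mixed_class x)"
      using x \<gamma> by (simp add: mixed_act_class k(2) symbol_act_closed h_act)
    finally show ?thesis by simp
  qed
  then obtain \<psi> where \<psi>: "\<psi> \<in> hom (mixed_symbols_mod \<Gamma>) integer_group"
    "\<And>y. y \<in> carrier mixed_symbols \<Longrightarrow> \<psi> (tf_class mixed_symbols (coinvariant_relators \<Gamma>) y) = k y"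
    unfolding mixed_symbols_mod_def
    using mixed_symbols.torsion_free_quotient_universal[OF coinvariant_relators_subset k(1)] by metis
  \<comment> \<open>\<open>int_dual\<close> demands the value 0 outside of the carrier, which the
    universal property does not provide.\<close>
  define \<phi> where "\<phi> y = (if y \<in> carrier (mixed_symbols_mod \<Gamma>) then \<psi> y else 0)" for y
  have "\<phi> \<in> hom (mixed_symbols_mod \<Gamma>) integer_group"
    using hom_mult[OF \<psi>(1)] by (intro homI) (auto simp: \<phi>_def)
  then have "\<phi> \<in> int_dual (mixed_symbols_mod \<Gamma>)" by (auto simp: int_dual_def \<phi>_def)
  moreover have "\<phi> (mixed_symbol_mod \<Gamma> g g') = c g g'" if "det g = 1" "det g' = 1" for g g'
  proof -
    have m: "mixed_symbol g g' \<in> carrier mixed_symbols"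
      using that by (auto simp: mixed_symbol_def carrier_mixed_symbols)
    then have "mixed_symbol_mod \<Gamma> g g' \<in> carrier (mixed_symbols_mod \<Gamma>)"
      unfolding mixed_symbol_mod_def mixed_symbols_mod_def
      by (rule hom_in_carrier[OF mixed_symbols.tf_class_hom[OF coinvariant_relators_subset]])
    then show ?thesis using m that by (simp add: \<phi>_def mixed_symbol_mod_def \<psi>(2))
        (simp add: mixed_symbol_def k(2) hc)
  qed
  ultimately show thesis by (rule that)
qed

lemma dual_eqI:
  assumes "\<phi> \<in> int_dual (mixed_symbols_mod \<Gamma>)" "\<psi> \<in> int_dual (mixed_symbols_mod \<Gamma>)"
    and eq: "\<And>g g'. det g = 1 \<Longrightarrow> det g' = 1 \<Longrightarrow> \<phi> (mixed_symbol_mod \<Gamma> g g')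
      = \<psi> (mixed_symbol_mod \<Gamma> g g')"
  shows "\<phi> = \<psi>"
proof
  fix y
  let ?q = "tf_class mixed_symbols (coinvariant_relators \<Gamma>)"
  have q: "?q \<in> hom mixed_symbols (mixed_symbols_mod \<Gamma>)"
    unfolding mixed_symbols_mod_def
      by (rule mixed_symbols.tf_class_hom[OF coinvariant_relators_subset])
  have hom: "\<theta> \<circ> (?q \<circ> mixed_class) \<in> hom symbol_group integer_group"
    if "\<theta> \<in> int_dual (mixed_symbols_mod \<Gamma>)" for \<theta>
    using that q mixed_class_hom unfolding int_dual_def by (intro Group.hom_compose) auto
  have "\<phi> (?q (mixed_class x)) = \<psi> (?q (mixed_class x))" if "x \<in> carrier symbol_group" for x
    using that
  proof (induction rule: symbol_group_induct)
    case zero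
    then show ?case using hom_int_one[OF hom[OF assms(1)] symbol_group.is_group]
        hom_int_one[OF hom[OF assms(2)] symbol_group.is_group] by simp
  next
    case (diff x y)
    then show ?case
      using hom_mult[OF hom[OF assms(1)], of "x - y" y] hom_mult[OF hom[OF assms(2)], of "x - y" y]
      by (simp add: symbol_group_closed)
  next
    case (frag_of g h)
    then show ?case using eq[of g h] by (simp add: mixed_symbol_mod_def mixed_symbol_def)
  qed
  moreover have "carrier (mixed_symbols_mod \<Gamma>) = ?q ` mixed_class ` carrier symbol_group"
    unfolding mixed_symbols_mod_def carrier_mixed_symbols[symmetric]
    by (rule mixed_symbols.carrier_torsion_free_quotient[OF coinvariant_relators_subset])
  ultimately show "\<phi> y = \<psi> y"
    using assms(1,2) by (cases "y \<in> carrier (mixed_symbols_mod \<Gamma>)") (auto simp: int_dual_def)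
qed

end

subsection \<open>Cosets of a subgroup of finite index\<close>

text \<open>A word in S and T from \<open>g\<close> to \<open>g'\<close> splits the symbol
  \<open>{g, g'}\<close> into translates of the two elementary ones, up to orientation.\<close>

lemma symbol_cochain_eqI:
  assumes c: "symbol_cochain \<Gamma> c" and c': "symbol_cochain \<Gamma> c'"
    and S: "\<And>g. det g = 1 \<Longrightarrow> c g (g ** matS) = c' g (g ** matS)"
    and T: "\<And>g. det g = 1 \<Longrightarrow> c g (g ** matT) = c' g (g ** matT)"
    and d: "det g = 1" "det g' = 1"
  shows "c g g' = c' g g'"
proof -
  have chain: "e g (g ** h) = e g g'' + e g'' (g ** h)"
    if "symbol_cochain \<Gamma> e" "det h = 1" "det g'' = 1" for e h g''
    by (rule symbol_cochain_chain[OF that(1) d(1) that(3)]) (simp add: det_mul d that)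
  have "c g (g ** h) = c' g (g ** h)" if "det h = 1" for h using that
  proof (induction rule: SL2Z_induct)
    case one
    then show ?case using chain[OF c, of "mat 1" g] chain[OF c', of "mat 1" g] d by simp
  next
    case (S h)
    moreover have "det (g ** h) = 1" using d S by (simp add: det_mul)
    ultimately show ?case
      using chain[OF c, of "h ** matS" "g ** h"] chain[OF c', of "h ** matS" "g ** h"]
        assms(3)[of "g ** h"] by (simp add: matrix_mul_assoc)
  next
    case (T h)
    moreover have "det (g ** h) = 1" using d T by (simp add: det_mul)
    ultimately show ?case
      using chain[OF c, of "h ** matT" "g ** h"] chain[OF c', of "h ** matT" "g ** h"]
        assms(4)[of "g ** h"] by (simp add: matrix_mul_assoc)
  qed
  from this[of "minv g ** g'"] show ?thesis using d by (simp add: det_mul)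
qed

text \<open>Mixed symbols only see \<open>\<plusminus>\<Gamma>\<close>, but \<open>- 1\<close> need not belong to \<open>\<Gamma>\<close>.\<close>

definition signed_coset :: "imat set \<Rightarrow> imat \<Rightarrow> imat set" where
  "signed_coset \<Gamma> g = (\<lambda>\<gamma>. \<gamma> ** g) ` \<Gamma> \<union> (\<lambda>\<gamma>. mneg (\<gamma> ** g)) ` \<Gamma>"

lemma image_signed_coset: "(\<lambda>g. g ** h) ` signed_coset \<Gamma> g = signed_coset \<Gamma> (g ** h)"
  by (simp add: signed_coset_def image_Un image_image matrix_mul_assoc)

lemma signed_coset_mneg [simp]: "signed_coset \<Gamma> (mneg g) = signed_coset \<Gamma> g"
  by (auto simp: signed_coset_def)

lemma signed_coset_eq_rcoset:
  "signed_coset \<Gamma> g = (\<Gamma> #>\<^bsub>SL2Z\<^esub> g) \<union> mneg ` (\<Gamma> #>\<^bsub>SL2Z\<^esub> g)"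
  by (auto simp: signed_coset_def r_coset_def)

locale finite_index =
  fixes \<Gamma> :: "imat set"
  assumes finite_index: "finite_index_subgroup \<Gamma>"
begin

lemma subgroup: "subgroup \<Gamma> SL2Z" and finite_rcosets: "finite (rcosets\<^bsub>SL2Z\<^esub> \<Gamma>)"
  using finite_index by (auto simp: finite_index_subgroup_def)

lemma subset: "\<Gamma> \<subseteq> carrier SL2Z" using subgroup by (rule subgroup.subset)

lemma det_\<Gamma> [simp]: "\<gamma> \<in> \<Gamma> \<Longrightarrow> det \<gamma> = 1" using subset by auto

lemma one_\<Gamma>: "mat 1 \<in> \<Gamma>" and mult_\<Gamma>: "\<gamma> \<in> \<Gamma> \<Longrightarrow> \<delta> \<in> \<Gamma> \<Longrightarrow> \<gamma> ** \<delta> \<in> \<Gamma>"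
  and minv_\<Gamma>: "\<gamma> \<in> \<Gamma> \<Longrightarrow> minv \<gamma> \<in> \<Gamma>"
  using subgroup.one_closed[OF subgroup] subgroup.m_closed[OF subgroup, of \<gamma> \<delta>]
    subgroup.m_inv_closed[OF subgroup, of \<gamma>] inv_SL2Z[of \<gamma>] by auto

abbreviation "cl \<equiv> signed_coset \<Gamma>"

abbreviation "rc g \<equiv> \<Gamma> #>\<^bsub>SL2Z\<^esub> g"

lemma self_in_cl [simp]: "g \<in> cl g" using one_\<Gamma> by (force simp: signed_coset_def)

lemma cl_mult [simp]:
  assumes "\<gamma> \<in> \<Gamma>" shows "cl (\<gamma> ** g) = cl g"
proof -
  have "cl (\<delta> ** h) \<subseteq> cl h" if "\<delta> \<in> \<Gamma>" for \<delta> h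
    using that mult_\<Gamma> by (auto simp: signed_coset_def matrix_mul_assoc)
  from this[of \<gamma> g] this[of "minv \<gamma>" "\<gamma> ** g"] show ?thesis using assms minv_\<Gamma> by simp
qed

lemma cl_eq_iff: "cl h = cl g \<longleftrightarrow> h \<in> cl g"
proof
  assume "h \<in> cl g"
  then obtain \<gamma> where "\<gamma> \<in> \<Gamma>" "h = \<gamma> ** g \<or> h = mneg (\<gamma> ** g)"
    by (auto simp: signed_coset_def)
  then show "cl h = cl g" by auto
next
  assume "cl h = cl g"
  then show "h \<in> cl g" using self_in_cl[of h] by simp
qed

lemma det_cl: "det g = 1 \<Longrightarrow> h \<in> cl g \<Longrightarrow> det h = 1" by (auto simp: signed_coset_def det_mul)

definition X :: "imat set set" where "X = cl ` carrier SL2Z"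

lemma cl_in_X [simp]: "det g = 1 \<Longrightarrow> cl g \<in> X" by (auto simp: X_def)

definition rep :: "imat set \<Rightarrow> imat" where "rep C = (SOME g. g \<in> C)"

lemma rep:
  assumes "C \<in> X" shows "det (rep C) = 1" "cl (rep C) = C" "rep C \<in> C"
proof -
  obtain g where g: "C = cl g" "det g = 1" using assms by (auto simp: X_def)
  show *: "rep C \<in> C" unfolding rep_def by (rule someI[of _ g]) (simp add: g)
  show "det (rep C) = 1" "cl (rep C) = C" using * g by (auto simp: det_cl cl_eq_iff)
qed

definition s :: "imat set \<Rightarrow> imat set" where
  "s C = (if C \<in> X then (\<lambda>g. g ** matS) ` C else C)"

definition u :: "imat set \<Rightarrow> imat set" where
  "u C = (if C \<in> X then (\<lambda>g. g ** matU) ` C else C)"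

lemma s_cl [simp]: "det g = 1 \<Longrightarrow> s (cl g) = cl (g ** matS)"
  and u_cl [simp]: "det g = 1 \<Longrightarrow> u (cl g) = cl (g ** matU)"
  by (simp_all add: s_def u_def image_signed_coset)

lemma X_cases: assumes "C \<in> X" obtains g where "C = cl g" "det g = 1"
  using assms by (auto simp: X_def)

lemma finite_X: "finite X"
proof -
  have "X \<subseteq> (\<lambda>C. C \<union> mneg ` C) ` (rcosets\<^bsub>SL2Z\<^esub> \<Gamma>)"
    by (auto simp: X_def signed_coset_eq_rcoset RCOSETS_def)
  then show ?thesis using finite_rcosets by (meson finite_surj)
qed

sublocale triangle_set X s u
proof
  fix C
  have 1: "s C \<in> X" "u C \<in> X" "s (s C) = C" "u (u (u C)) = C" if "C \<in> X"
    using that by (auto elim!: X_cases simp: S_relation U_relation)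
  have 2: "s C = C" "u C = C" if "C \<notin> X" using that by (auto simp: s_def u_def)
  show "s C \<in> X \<longleftrightarrow> C \<in> X" "u C \<in> X \<longleftrightarrow> C \<in> X" "s (s C) = C" "u (u (u C)) = C"
    using 1 2 by (cases "C \<in> X"; simp)+
qed (rule finite_X)

lemma t_cl [simp]: "det g = 1 \<Longrightarrow> t (cl g) = cl (g ** matT)" by (simp add: t_def T_eq)

lemma t_pow_cl: "det g = 1 \<Longrightarrow> (t ^^ k) (cl g) = cl (g ** mat2 1 (int k) 0 1)"
proof (induction k)
  case 0
  then show ?case by (simp add: mat_eq_mat2[symmetric])
next
  case (Suc k)
  then have "(t ^^ Suc k) (cl g) = cl (g ** mat2 1 (int k) 0 1 ** matT)" by simp
  then show ?case by (simp add: matrix_mul_assoc[symmetric] matT_eq_mat2 add.commute)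
qed

lemma X_connected:
  assumes xy: "x \<in> X" "y \<in> X" and P: "P x"
    and s: "\<And>z. z \<in> X \<Longrightarrow> P z \<Longrightarrow> P (s z)" and u: "\<And>z. z \<in> X \<Longrightarrow> P z \<Longrightarrow> P (u z)"
  shows "P y"
proof -
  obtain g h where g: "x = cl g" "det g = 1" and h: "y = cl h" "det h = 1"
    using xy by (auto elim!: X_cases)
  \<comment> \<open>\<open>s\<close> and \<open>u\<close> have finite order, so forward closure
    already gives the equivalences that \<open>SL2Z_induct\<close> asks for.\<close>
  have s': "P (s z) \<longleftrightarrow> P z" if "z \<in> X" for z using s[of z] s[of "s z"] that by auto
  have u': "P (u z) \<longleftrightarrow> P z" if "z \<in> X" for z
    using u[of z] u[of "u z"] u[of "u (u z)"] that by auto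
  have "P (cl (g ** k))" if "det k = 1" for k using that
  proof (induction rule: SL2Z_induct)
    case one then show ?case using P g by simp
  next
    case (S k)
    then show ?case using s'[of "cl (g ** k)"] g by (simp add: det_mul matrix_mul_assoc)
  next
    case (T k)
    have d: "det (g ** k) = 1" using T g by (simp add: det_mul)
    then have "P (cl (g ** (k ** matT))) \<longleftrightarrow> P (u (s (cl (g ** k))))"
      by (simp add: matrix_mul_assoc T_eq)
    then show ?case
      using u'[of "s (cl (g ** k))"] s'[of "cl (g ** k)"] d by (simp del: s_cl u_cl)
  qed
  from this[of "minv g ** h"] show ?thesis using g h by (simp add: det_mul)
qed

text \<open>The number of cosets of \<open>\<Gamma>\<close> in a signed coset.\<close>

definition \<kappa> :: rat where "\<kappa> = (if mneg (mat 1) \<in> \<Gamma> then 1 else 2)"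

lemma mneg_rcoset: "mneg ` (rc g) = rc (mneg g)" by (auto simp: r_coset_def)

lemma rcoset_eq_iff:
  assumes "det g = 1" "det h = 1"
  shows "rc h = rc g \<longleftrightarrow> h \<in> rc g"
  using SL2Z.repr_independence[of h \<Gamma> g] SL2Z.rcos_self[of h \<Gamma>] subgroup assms by auto

text \<open>The cosets of \<Gamma> are grouped by signed coset. The fibre over that of
  \<open>g\<close> consists of the cosets of \<open>g\<close> and \<open>- g\<close>, which coincide
  exactly if \<open>- 1\<close> belongs to \<Gamma>.\<close>

lemma sum_rcosets:
  fixes F :: "imat \<Rightarrow> rat"
  assumes F: "\<And>g h. det g = 1 \<Longrightarrow> h \<in> cl g \<Longrightarrow> F h = F g"
  shows "(\<Sum>C\<in>rcosets\<^bsub>SL2Z\<^esub> \<Gamma>. F (SOME g. g \<in> C)) = \<kappa> * (\<Sum>x\<in>X. F (rep x))"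
proof -
  let ?\<pi> = "\<lambda>C. C \<union> mneg ` C"
  let ?R = "rcosets\<^bsub>SL2Z\<^esub> \<Gamma>"
  have \<pi>: "?\<pi> (rc g) = cl g" for g by (simp add: signed_coset_eq_rcoset)
  have "(\<Sum>C\<in>?R. F (SOME g. g \<in> C)) = (\<Sum>x\<in>X. \<Sum>C\<in>{C \<in> ?R. ?\<pi> C = x}. F (SOME g. g \<in> C))"
  proof (rule sum.group[symmetric])
    show "?\<pi> ` ?R \<subseteq> X" by (auto simp: RCOSETS_def \<pi>[simplified] X_def)
  qed (use finite_X finite_rcosets in auto)
  also have "\<dots> = (\<Sum>x\<in>X. \<kappa> * F (rep x))"
  proof (rule sum.cong)
    fix x assume "x \<in> X"
    then obtain g where g: "x = cl g" "det g = 1" by (rule X_cases)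
    have "{C \<in> ?R. ?\<pi> C = x} = {rc g, rc (mneg g)}"
    proof (intro equalityI subsetI)
      fix C assume "C \<in> {C \<in> ?R. ?\<pi> C = x}"
      then obtain h where h: "C = rc h" "det h = 1" "cl h = cl g"
        by (auto simp: RCOSETS_def g \<pi>[simplified])
      then have "h \<in> rc g \<or> h \<in> rc (mneg g)"
        by (simp add: cl_eq_iff) (simp add: signed_coset_eq_rcoset mneg_rcoset)
      then show "C \<in> {rc g, rc (mneg g)}"
        using rcoset_eq_iff[of g h] rcoset_eq_iff[of "mneg g" h] g h by auto
    next
      fix C assume "C \<in> {rc g, rc (mneg g)}"
      then show "C \<in> {C \<in> ?R. ?\<pi> C = x}"
        using g \<pi>[of g] \<pi>[of "mneg g"] by (auto simp: RCOSETS_def)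
    qed
    moreover have "F (SOME h. h \<in> rc k) = F (rep x)" if k: "k = g \<or> k = mneg g" for k
    proof -
      have "k \<in> rc k" using k g by (intro SL2Z.rcos_self subgroup) auto
      then have "(SOME h. h \<in> rc k) \<in> rc k" by (rule someI)
      moreover have "rc k \<subseteq> cl g" using k by (auto simp: signed_coset_eq_rcoset mneg_rcoset)
      ultimately have "F (SOME h. h \<in> rc k) = F g" using F[OF g(2)] by blast
      moreover have "rep x \<in> cl g" using rep(3)[of x] g by simp
      ultimately show ?thesis using F[OF g(2), of "rep x"] by simp
    qed
    moreover have "rc g = rc (mneg g) \<longleftrightarrow> mneg (mat 1) \<in> \<Gamma>"
    proof -
      have "rc g = rc (mneg g) \<longleftrightarrow> (\<exists>\<gamma>\<in>\<Gamma>. mneg g = \<gamma> ** g)"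
        using rcoset_eq_iff[of g "mneg g"] g by (auto simp: r_coset_def)
      also have "\<dots> \<longleftrightarrow> mneg (mat 1) \<in> \<Gamma>"
      proof
        assume "\<exists>\<gamma>\<in>\<Gamma>. mneg g = \<gamma> ** g"
        then obtain \<gamma> where \<gamma>: "\<gamma> \<in> \<Gamma>" "mneg g = \<gamma> ** g" by blast
        have "mneg (mat 1) = \<gamma>"
          using arg_cong[OF \<gamma>(2), of "\<lambda>h. h ** minv g"] g by (simp add: minv_right)
        then show "mneg (mat 1) \<in> \<Gamma>" using \<gamma> by simp
      next
        assume "mneg (mat 1) \<in> \<Gamma>"
        then show "\<exists>\<gamma>\<in>\<Gamma>. mneg g = \<gamma> ** g" by (intro bexI[of _ "mneg (mat 1)"]) auto
      qed
      finally show ?thesis .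
    qed
    ultimately show "(\<Sum>C\<in>{C \<in> ?R. ?\<pi> C = x}. F (SOME g. g \<in> C)) = \<kappa> * F (rep x)"
      by (auto simp: \<kappa>_def)
  qed simp
  finally show ?thesis by (simp add: sum_distrib_left)
qed

end

subsection \<open>Perfectness of the pairing\<close>

lemma Z_inverting_closed:
  assumes "p \<in> Z_inverting N" "q \<in> Z_inverting N"
  shows "p + q \<in> Z_inverting N" "p * q \<in> Z_inverting N"
proof -
  obtain i j where i: "of_nat N ^ i * p \<in> \<int>" and j: "of_nat N ^ j * q \<in> \<int>"
    using assms by (auto simp: Z_inverting_def)
  have "of_nat N ^ (i + j) * (p + q) = of_nat N ^ j * (of_nat N ^ i * p)
    + of_nat N ^ i * (of_nat N ^ j * q)"
    "of_nat N ^ (i + j) * (p * q) = (of_nat N ^ i * p) * (of_nat N ^ j * q)"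
    by (simp_all add: power_add algebra_simps)
  moreover have "of_nat N ^ j * (of_nat N ^ i * p) + of_nat N ^ i * (of_nat N ^ j * q) \<in> \<int>"
    "(of_nat N ^ i * p) * (of_nat N ^ j * q) \<in> \<int>"
    by (intro Ints_add Ints_mult Ints_power Ints_of_nat i j)+
  ultimately have "of_nat N ^ (i + j) * (p + q) \<in> \<int>" "of_nat N ^ (i + j) * (p * q) \<in> \<int>"
    by (simp_all only:)
  then show "p + q \<in> Z_inverting N" "p * q \<in> Z_inverting N"
    unfolding Z_inverting_def by blast+
qed

lemma of_int_in_Z_inverting: "of_int m \<in> Z_inverting N"
  unfolding Z_inverting_def by (intro CollectI exI[of _ 0]) simp

lemma inverse_in_Z_inverting:
  assumes "d dvd N" "N > 0" shows "1 / of_nat d \<in> Z_inverting N"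
proof -
  obtain e where e: "N = d * e" using assms(1) by (rule dvdE)
  then have "of_nat N ^ 1 * (1 / of_nat d) = (of_nat e :: rat)" using assms(2) by simp
  then have "of_nat N ^ 1 * (1 / of_nat d) \<in> (\<int> :: rat set)" by simp
  then show ?thesis unfolding Z_inverting_def by blast
qed

lemma common_denominator:
  assumes "finite I" "\<And>i. i \<in> I \<Longrightarrow> f i \<in> Z_inverting N"
  shows "\<exists>k. \<forall>i\<in>I. of_nat N ^ k * f i \<in> \<int>" using assms
proof (induction I)
  case (insert i I)
  obtain k where k: "\<forall>i\<in>I. of_nat N ^ k * f i \<in> \<int>" using insert.IH insert.prems by blast
  obtain l where l: "of_nat N ^ l * f i \<in> \<int>"
    using insert.prems[of i] by (auto simp: Z_inverting_def)
  have eq: "of_nat N ^ (k + l) * f j = of_nat N ^ l * (of_nat N ^ k * f j)"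
    "of_nat N ^ (k + l) * f j = of_nat N ^ k * (of_nat N ^ l * f j)" for j
    by (simp_all add: power_add algebra_simps)
  have "of_nat N ^ (k + l) * f i \<in> \<int>"
    unfolding eq(2) by (intro Ints_mult Ints_power Ints_of_nat l)
  moreover have "of_nat N ^ (k + l) * f j \<in> \<int>" if "j \<in> I" for j
    unfolding eq(1) by (rule Ints_mult[OF Ints_power[OF Ints_of_nat] bspec[OF k that]])
  ultimately show ?case by (intro exI[of _ "k + l"]) auto
qed simp

lemma int_dual_combination:
  assumes "\<phi> \<in> int_dual M" "\<psi> \<in> int_dual M"
  shows "(\<lambda>x. m * \<phi> x + n * \<psi> x) \<in> int_dual M"
proof -
  have "\<phi> (x \<otimes>\<^bsub>M\<^esub> y) = \<phi> x + \<phi> y" "\<psi> (x \<otimes>\<^bsub>M\<^esub> y) = \<psi> x + \<psi> y"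
    if "x \<in> carrier M" "y \<in> carrier M" for x y
    using assms that by (auto simp: int_dual_def hom_def)
  then show ?thesis using assms by (auto simp: int_dual_def hom_def algebra_simps)
qed

lemma localized_dualI:
  "\<phi> \<in> int_dual M \<Longrightarrow> (\<lambda>x. of_int (\<phi> x) / of_nat N ^ k) \<in> localized_dual N M"
  unfolding localized_dual_def by blast

lemma localized_dual_add:
  assumes N: "N > 0" and "\<phi> \<in> localized_dual N M" "\<psi> \<in> localized_dual N M"
  shows "(\<lambda>x. \<phi> x + \<psi> x) \<in> localized_dual N M"
proof -
  obtain \<phi>' k \<psi>' j where *: "\<phi>' \<in> int_dual M" "\<psi>' \<in> int_dual M"
    "\<phi> = (\<lambda>x. of_int (\<phi>' x) / of_nat N ^ k)" "\<psi> = (\<lambda>x. of_int (\<psi>' x) / of_nat N ^ j)"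
    using assms(2,3) unfolding localized_dual_def by blast
  have "(\<lambda>x. \<phi> x + \<psi> x) = (\<lambda>x. of_int (int N ^ j * \<phi>' x + int N ^ k * \<psi>' x) / of_nat N ^ (k + j))"
    using N by (simp add: * fun_eq_iff power_add field_simps)
  then show ?thesis
    using localized_dualI[OF int_dual_combination[OF *(1,2), of "int N ^ j" "int N ^ k"], of N
      "k + j"]
    by (simp only:)
qed

lemma localized_dual_scale:
  assumes N: "N > 0" and "\<phi> \<in> localized_dual N M" and r: "r \<in> Z_inverting N"
  shows "(\<lambda>x. r * \<phi> x) \<in> localized_dual N M"
proof -
  obtain \<phi>' k where *: "\<phi>' \<in> int_dual M" "\<phi> = (\<lambda>x. of_int (\<phi>' x) / of_nat N ^ k)"
    using assms(2) unfolding localized_dual_def by blast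
  obtain i m where m: "of_nat N ^ i * r = of_int m"
    using r by (auto simp: Z_inverting_def elim: Ints_cases)
  then have "r = of_int m / of_nat N ^ i" using N by (simp add: field_simps)
  then have "(\<lambda>x. r * \<phi> x) = (\<lambda>x. of_int (m * \<phi>' x + 0 * \<phi>' x) / of_nat N ^ (i + k))"
    by (simp add: * fun_eq_iff power_add)
  then show ?thesis
    using localized_dualI[OF int_dual_combination[OF *(1,1), of m 0], of N "i + k"] by (simp only:)
qed

text \<open>By antisymmetry the second induced map is the first one followed by negation, which is a
  bijection of the linear forms.\<close>

lemma perfect_pairing_antisymmetric:
  assumes anti: "\<And>\<phi> \<psi>. \<phi> \<in> L \<Longrightarrow> \<psi> \<in> L \<Longrightarrow> B \<psi> \<phi> = - B \<phi> \<psi>"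
    and neg: "\<And>r. r \<in> R \<Longrightarrow> - r \<in> R"
    and L: "\<And>\<phi> \<psi>. \<phi> \<in> L \<Longrightarrow> \<psi> \<in> L \<Longrightarrow> (\<lambda>x. \<phi> x + \<psi> x) \<in> L"
      "\<And>r \<phi>. r \<in> R \<Longrightarrow> \<phi> \<in> L \<Longrightarrow> (\<lambda>x. r * \<phi> x) \<in> L"
    and bij: "bij_betw (\<lambda>\<phi>. \<lambda>\<psi>\<in>L. B \<phi> \<psi>) L (linear_forms R L)"
  shows "perfect_pairing R L B"
proof -
  let ?n = "\<lambda>l. \<lambda>\<psi>\<in>L. - l \<psi>"
  have maps: "?n l \<in> linear_forms R L" if l: "l \<in> linear_forms R L" for l
    using l neg L by (auto simp: linear_forms_def PiE_iff)
  have inv: "?n (?n l) = l" if l: "l \<in> linear_forms R L" for l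
    using l by (auto simp: linear_forms_def PiE_iff extensional_def)
  have "bij_betw ?n (linear_forms R L) (linear_forms R L)"
    by (rule bij_betw_byWitness[of _ ?n]) (auto simp only: maps inv image_subset_iff)
  from bij_betw_trans[OF bij this]
  have "bij_betw (\<lambda>\<phi>. ?n (\<lambda>\<psi>\<in>L. B \<phi> \<psi>)) L (linear_forms R L)" by (simp only: o_def)
  also have "?this \<longleftrightarrow> bij_betw (\<lambda>\<psi>. \<lambda>\<phi>\<in>L. B \<phi> \<psi>) L (linear_forms R L)"
  proof (intro bij_betw_cong ext)
    fix \<psi> \<phi> assume "\<psi> \<in> L"
    then show "?n (\<lambda>\<phi>\<in>L. B \<psi> \<phi>) \<phi> = (\<lambda>\<phi>\<in>L. B \<phi> \<psi>) \<phi>"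
      using anti[of \<psi> \<phi>] by (cases "\<phi> \<in> L") simp_all
  qed
  finally show ?thesis using bij by (simp add: perfect_pairing_def)
qed

locale inverted_widths = finite_index +
  fixes L :: nat
  assumes L_pos: "L > 0" and width_dvd: "x \<in> X \<Longrightarrow> width x dvd L"
begin

abbreviation "N \<equiv> 2 * L"
abbreviation "R \<equiv> Z_inverting N"
abbreviation "msym \<equiv> mixed_symbol_mod \<Gamma>"
abbreviation "V \<equiv> localized_dual N (mixed_symbols_mod \<Gamma>)"

lemma N_pos: "N > 0" using L_pos by simp

sublocale triangle_set_over X s u R
proof
  show "p + q \<in> R" "p * q \<in> R" if "p \<in> R" "q \<in> R" for p q
    using Z_inverting_closed[OF that] by auto
  show "1 \<in> R" "- 1 \<in> R"
    using of_int_in_Z_inverting[of 1 N] of_int_in_Z_inverting[of "- 1" N] by simp_all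
  show "1 / 2 \<in> R" using inverse_in_Z_inverting[of 2 N] N_pos by simp
  show "1 / of_nat (width x) \<in> R" if "x \<in> X" for x
    using inverse_in_Z_inverting[of "width x" N] width_dvd[OF that] N_pos by simp
qed (rule X_connected)

definition edge_values :: "(symbol_sum set set set set \<Rightarrow> rat) \<Rightarrow> imat set \<Rightarrow> rat" where
  "edge_values \<phi> x = (if x \<in> X then \<phi> (msym (rep x) (rep x ** matS)) else 0)"

definition cusp_values :: "(symbol_sum set set set set \<Rightarrow> rat) \<Rightarrow> imat set \<Rightarrow> rat" where
  "cusp_values \<phi> x = (if x \<in> X then \<phi> (msym (rep x) (rep x ** matT)) else 0)"

lemma symbol_cochain_coset:
  assumes c: "symbol_cochain \<Gamma> c" and g: "det g = 1" and h: "det h = 1"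
  shows "h' \<in> cl h \<Longrightarrow> c h' (h' ** g) = c h (h ** g)"
proof -
  assume "h' \<in> cl h"
  then obtain \<gamma> where \<gamma>: "\<gamma> \<in> \<Gamma>" "h' = \<gamma> ** h \<or> h' = mneg (\<gamma> ** h)"
    by (auto simp: signed_coset_def)
  have "det (\<gamma> ** h) = 1" "det (\<gamma> ** (h ** g)) = 1" "det (h ** g) = 1"
    using \<gamma>(1) g h by (simp_all add: det_mul)
  then have "c h' (h' ** g) = c (\<gamma> ** h) (\<gamma> ** (h ** g))"
    using \<gamma>(2) c unfolding symbol_cochain_def by (auto simp: matrix_mul_assoc)
  also have "\<dots> = c h (h ** g)"
    using c \<gamma>(1) h \<open>det (h ** g) = 1\<close> unfolding symbol_cochain_def by blast
  finally show ?thesis .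
qed

lemma localized_dualE:
  assumes "\<phi> \<in> V"
  obtains c k where "symbol_cochain \<Gamma> c" "\<And>g g'. det g = 1 \<Longrightarrow> det g' = 1 \<Longrightarrow> \<phi> (msym g g')
    = of_int (c g g') / of_nat N ^ k"
proof -
  obtain \<phi>' k where \<phi>': "\<phi>' \<in> int_dual (mixed_symbols_mod \<Gamma>)" "\<phi> = (\<lambda>x. of_int (\<phi>' x) / of_nat N ^ k)"
    using assms unfolding localized_dual_def by blast
  then have "\<phi>' \<in> hom (mixed_symbols_mod \<Gamma>) integer_group" by (simp add: int_dual_def)
  from that[OF symbol_cochain_of_dual[OF subset this], of k] show thesis using \<phi>'(2) by simp
qed

lemma values_cl:
  assumes "\<phi> \<in> V" "det g = 1"
  shows "\<phi> (msym g (g ** matS)) = edge_values \<phi> (cl g)" "\<phi> (msym g (g ** matT))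
    = cusp_values \<phi> (cl g)"
    and "\<phi> (msym (g ** matS) g) = - edge_values \<phi> (cl g)"
proof -
  obtain c k where c: "symbol_cochain \<Gamma> c"
    "\<And>g g'. det g = 1 \<Longrightarrow> det g' = 1 \<Longrightarrow> \<phi> (msym g g') = of_int (c g g') / of_nat N ^ k"
    using localized_dualE[OF assms(1)] by blast
  have r: "det (rep (cl g)) = 1" "rep (cl g) \<in> cl g"
    using rep(1,3)[OF cl_in_X[OF assms(2)]] by auto
  have "c (rep (cl g)) (rep (cl g) ** h) = c g (g ** h)" if "det h = 1" for h
    using symbol_cochain_coset[OF c(1) that assms(2) r(2)] .
  note * = this
  have "det matS = 1" "det matT = 1" by (simp_all add: matS_eq_mat2 matT_eq_mat2)
  from *[OF this(1)] *[OF this(2)]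
  show 1: "\<phi> (msym g (g ** matS)) = edge_values \<phi> (cl g)" and "\<phi> (msym g (g ** matT))
    = cusp_values \<phi> (cl g)"
    using assms(2) r(1) by (simp_all add: edge_values_def cusp_values_def c(2))
  have "c (g ** matS) g = - c g (g ** matS)"
    using assms(2) by (intro symbol_cochain_swap[OF c(1)]) simp_all
  then have "\<phi> (msym (g ** matS) g) = - \<phi> (msym g (g ** matS))"
    using assms(2) by (simp add: c(2))
  then show "\<phi> (msym (g ** matS) g) = - edge_values \<phi> (cl g)" by (simp add: 1)
qed

lemma cochain_values:
  assumes "\<phi> \<in> V" shows "cochain R (edge_values \<phi>) (cusp_values \<phi>)"
proof -
  obtain c k where c: "symbol_cochain \<Gamma> c"
    "\<And>g g'. det g = 1 \<Longrightarrow> det g' = 1 \<Longrightarrow> \<phi> (msym g g') = of_int (c g g') / of_nat N ^ k"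
    using localized_dualE[OF assms] by blast
  note swap = symbol_cochain_swap[OF c(1)] and chain = symbol_cochain_chain[OF c(1)]
    and sgn = symbol_cochain_mneg[OF c(1)]
  have a: "edge_values \<phi> (cl g) = of_int (c g (g ** matS)) / of_nat N ^ k"
    and b: "cusp_values \<phi> (cl g) = of_int (c g (g ** matT)) / of_nat N ^ k" if "det g = 1" for g
    using values_cl[OF assms that] c(2) that by simp_all
  have R: "of_int m / of_nat N ^ k \<in> R" for m
    unfolding Z_inverting_def using N_pos by (intro CollectI exI[of _ k]) simp
  have S: "c (g ** matS) (g ** matS ** matS) = - c g (g ** matS)" if "det g = 1" for g
    using swap[of g "g ** matS"] that by (simp add: S_relation sgn)
  \<comment> \<open>The power relation for exponent 2, less one step, is the invariance of the cusp
    values under T.\<close>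
  have T: "c (g ** matT) (g ** matT ** matT) = c g (g ** matT)" if "det g = 1" for g
  proof -
    have "c g (g ** mat2 1 2 0 1) = 2 * c g (g ** matT)"
      using c(1) that by (simp add: symbol_cochain_def)
    moreover have "g ** mat2 1 2 0 1 = g ** matT ** matT"
      by (simp add: matT_eq_mat2 matrix_mul_assoc[symmetric])
    ultimately show ?thesis using chain[of g "g ** matT" "g ** matT ** matT"] that by simp
  qed
  \<comment> \<open>The path \<open>g\<close>, \<open>gU\<close>, \<open>gU^2\<close>,
    \<open>gU^3 = - g\<close> is closed up to sign, and each step from \<open>h\<close> to
    \<open>hU\<close> is split at \<open>hS\<close>.\<close>
  have tri: "c g (g ** matS) + c (g ** matU) (g ** matU ** matS)
    + c (g ** matU ** matU) (g ** matU ** matU ** matS)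
    + c (g ** matS) (g ** matS ** matT) + c (g ** matU ** matS) (g ** matU ** matS ** matT)
    + c (g ** matU ** matU ** matS) (g ** matU ** matU ** matS ** matT) = 0" if g: "det g = 1" for g
  proof -
    have "c h (h ** matS) + c (h ** matS) (h ** matS ** matT) = c h (h ** matU)" if "det h = 1" for h
      using chain[of h "h ** matS" "h ** matU"] that by (simp add: U_eq)
    from this[of g] this[of "g ** matU"] this[of "g ** matU ** matU"]
    show ?thesis
      using chain[of g "g ** matU" "g ** matU ** matU"] swap[of g "g ** matU ** matU"] g
      by (simp add: U_relation sgn)
  qed
  show ?thesis unfolding cochain_def
  proof (intro conjI allI impI)
    fix x
    show "edge_values \<phi> x \<in> R" "cusp_values \<phi> x \<in> R"
      using R a b by (cases "x \<in> X"; auto elim!: X_cases simp: edge_values_def cusp_values_def R_zero)+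
    show "x \<notin> X \<Longrightarrow> edge_values \<phi> x = 0" "x \<notin> X \<Longrightarrow> cusp_values \<phi> x = 0"
      by (simp_all add: edge_values_def cusp_values_def)
    show "edge_values \<phi> (s x) = - edge_values \<phi> x"
    proof (cases "x \<in> X")
      case True
      then obtain g where g: "x = cl g" "det g = 1" by (rule X_cases)
      then show ?thesis using S[of g] by (simp add: a)
    qed (simp add: edge_values_def)
    show "cusp_values \<phi> (t x) = cusp_values \<phi> x"
    proof (cases "x \<in> X")
      case True
      then obtain g where g: "x = cl g" "det g = 1" by (rule X_cases)
      then show ?thesis using T[of g] by (simp add: b)
    qed (simp add: cusp_values_def)
    show "edge_values \<phi> x + edge_values \<phi> (u x) + edge_values \<phi> (u (u x))
      + cusp_values \<phi> (s x) + cusp_values \<phi> (s (u x)) + cusp_values \<phi> (s (u (u x))) = 0"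
    proof (cases "x \<in> X")
      case True
      then obtain g where g: "x = cl g" "det g = 1" by (rule X_cases)
      then show ?thesis
        using arg_cong[OF tri[of g], of "\<lambda>m. of_int m / of_nat N ^ k :: rat"]
        by (simp add: a b add_divide_distrib)
    qed (simp add: edge_values_def cusp_values_def)
  qed
qed

lemma values_inj:
  assumes "\<phi> \<in> V" "\<psi> \<in> V" "edge_values \<phi> = edge_values \<psi>" "cusp_values \<phi> = cusp_values \<psi>"
  shows "\<phi> = \<psi>"
proof -
  obtain \<phi>' k \<psi>' j where *: "\<phi>' \<in> int_dual (mixed_symbols_mod \<Gamma>)"
    "\<psi>' \<in> int_dual (mixed_symbols_mod \<Gamma>)"
    "\<phi> = (\<lambda>x. of_int (\<phi>' x) / of_nat N ^ k)" "\<psi> = (\<lambda>x. of_int (\<psi>' x) / of_nat N ^ j)"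
    using assms(1,2) unfolding localized_dual_def by blast
  \<comment> \<open>Numerators over a common denominator; the zero summand only gives the shape of
    \<open>int_dual_combination\<close>.\<close>
  let ?p = "\<lambda>x. int N ^ j * \<phi>' x + 0 * \<phi>' x" and ?q = "\<lambda>x. int N ^ k * \<psi>' x + 0 * \<psi>' x"
  have d: "?p \<in> int_dual (mixed_symbols_mod \<Gamma>)" "?q \<in> int_dual (mixed_symbols_mod \<Gamma>)"
    by (intro int_dual_combination *)+
  have eq: "?p y = ?q y \<longleftrightarrow> \<phi> y = \<psi> y" for y
  proof -
    have "?p y = ?q y \<longleftrightarrow> (of_nat N ^ j * of_int (\<phi>' y) :: rat) = of_nat N ^ k * of_int (\<psi>' y)"
      by (simp flip: of_int_eq_iff[where ?'a = rat])
    also have "\<dots> \<longleftrightarrow> \<phi> y = \<psi> y" using N_pos by (simp add: * field_simps)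
    finally show ?thesis .
  qed
  have hom: "?p \<in> hom (mixed_symbols_mod \<Gamma>) integer_group"
    "?q \<in> hom (mixed_symbols_mod \<Gamma>) integer_group"
    using d by (simp_all add: int_dual_def)
  have "?p = ?q"
  proof (rule dual_eqI[OF subset d])
    fix g g' :: imat assume g: "det g = 1" "det g' = 1"
    show "?p (msym g g') = ?q (msym g g')"
    proof (rule symbol_cochain_eqI[OF symbol_cochain_of_dual[OF subset hom(1)] symbol_cochain_of_dual[OF subset hom(2)] _ _ g])
      fix h :: imat assume "det h = 1"
      then show "?p (msym h (h ** matS)) = ?q (msym h (h ** matS))" "?p (msym h (h ** matT))
        = ?q (msym h (h ** matT))"
        unfolding eq using assms by (simp_all add: values_cl)
    qed
  qed
  then show ?thesis using eq by (simp add: fun_eq_iff)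
qed

text \<open>After clearing denominators the cochain is integrated to a potential on the whole group.
  The potential need not be invariant under \<Gamma>, but its differences are, and they form the
  required cocycle.\<close>

lemma values_surj:
  assumes "cochain R a b"
  obtains \<phi> where "\<phi> \<in> V" "edge_values \<phi> = a" "cusp_values \<phi> = b"
proof -
  obtain k where k: "\<forall>x\<in>X. of_nat N ^ k * a x \<in> \<int>"
    using common_denominator[OF finite_X, of a N] assms by (auto simp: cochain_def)
  obtain j where j: "\<forall>x\<in>X. of_nat N ^ j * b x \<in> \<int>"
    using common_denominator[OF finite_X, of b N] assms by (auto simp: cochain_def)
  have eq: "of_nat N ^ (k + j) * a x = of_nat N ^ j * (of_nat N ^ k * a x)"
    "of_nat N ^ (k + j) * b x = of_nat N ^ k * (of_nat N ^ j * b x)" for x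
    by (simp_all add: power_add algebra_simps)
  have outside: "a x = 0" "b x = 0" if "x \<notin> X" for x
    using assms that by (auto simp: cochain_def)
  have "of_nat N ^ (k + j) * a x \<in> \<int> \<and> of_nat N ^ (k + j) * b x \<in> \<int>" for x
  proof (cases "x \<in> X")
    case True
    then show ?thesis
      unfolding eq using Ints_mult[OF Ints_power[OF Ints_of_nat] bspec[OF k True]]
        Ints_mult[OF Ints_power[OF Ints_of_nat] bspec[OF j True]] by blast
  next
    case False
    then show ?thesis using outside[OF False] by simp
  qed
  then have int: "of_nat N ^ (k + j) * a x \<in> \<int>" "of_nat N ^ (k + j) * b x \<in> \<int>" for x
    by blast+
  define d where "d = k + j"
  \<comment> \<open>The floors are exact: both arguments are integers by the choice of
    \<open>d\<close>.\<close>
  define a' b' where "a' x = \<lfloor>of_nat N ^ d * a x\<rfloor>" and "b' x = \<lfloor>of_nat N ^ d * b x\<rfloor>" for x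
  have a': "of_int (a' x) = of_nat N ^ d * a x" and b': "of_int (b' x) = of_nat N ^ d * b x" for x
    using int[of x] by (auto simp: a'_def b'_def d_def elim!: Ints_cases)
  have as: "a' (s x) = - a' x" for x
  proof -
    have "(of_int (a' (s x)) :: rat) = of_int (- a' x)"
      using assms by (simp add: a' cochain_def)
    then show ?thesis by (simp only: of_int_eq_iff)
  qed
  have bt: "b' (t x) = b' x" for x using assms by (simp add: b'_def cochain_def)
  have tri: "a' x + a' (u x) + a' (u (u x)) + b' (s x) + b' (s (u x)) + b' (s (u (u x))) = 0" for x
  proof -
    have "(of_int (a' x + a' (u x) + a' (u (u x)) + b' (s x) + b' (s (u x))
      + b' (s (u (u x)))) :: rat)
      = of_nat N ^ d * (a x + a (u x) + a (u (u x)) + b (s x) + b (s (u x)) + b (s (u (u x))))"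
      by (simp add: a' b' distrib_left)
    also have "\<dots> = of_int 0" using cochain_triangle[OF assms, of x] by simp
    finally show ?thesis by (simp only: of_int_eq_iff)
  qed
  interpret cayley_cochain "\<lambda>g. a' (cl g)" "\<lambda>g. b' (cl g)"
  proof
    fix g :: imat assume g: "det g = 1"
    show "a' (cl (g ** matS)) = - a' (cl g)" using as[of "cl g"] g by simp
    show "a' (cl g) + a' (cl (g ** matU)) + a' (cl (g ** matU ** matU)) + b' (cl (g ** matS))
      + b' (cl (g ** matU ** matS)) + b' (cl (g ** matU ** matU ** matS)) = 0"
      using tri[of "cl g"] g by simp
  qed simp_all
  \<comment> \<open>Invariance of \<open>b'\<close> is proved along with the power relation, since
    every further step by T must add the same amount.\<close>
  have pot_T_pow: "pot (g ** mat2 1 m 0 1) = pot g + m * b' (cl g) \<and> b' (cl (g ** mat2 1 m 0 1))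
    = b' (cl g)"
    if "det g = 1" for g m
  proof (induction m rule: int_induct[where ?k = 0])
    case base
    then show ?case by (simp add: mat_eq_mat2[symmetric])
  next
    case (step1 i)
    have eq: "g ** mat2 1 (i + 1) 0 1 = g ** mat2 1 i 0 1 ** matT"
      by (simp add: matT_eq_mat2 matrix_mul_assoc[symmetric] add.commute)
    show ?case
      unfolding eq using step1 that pot_T[of "g ** mat2 1 i 0 1"] bt[of "cl (g ** mat2 1 i 0 1)"]
      by (simp add: algebra_simps)
  next
    case (step2 i)
    have eq: "g ** mat2 1 i 0 1 = g ** mat2 1 (i - 1) 0 1 ** matT"
      by (simp add: matT_eq_mat2 matrix_mul_assoc[symmetric])
    show ?case
      using step2 that pot_T[of "g ** mat2 1 (i - 1) 0 1"] bt[of "cl (g ** mat2 1 (i - 1) 0 1)"]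
      unfolding eq by (simp add: algebra_simps)
  qed
  \<comment> \<open>Steps by S and T depend on the signed coset only, so translation by
    \<open>\<gamma>\<close> changes the potential by a constant, its period.\<close>
  have pot_\<Gamma>: "pot (\<gamma> ** h) = pot h + pot \<gamma> - pot (mat 1)" if \<gamma>: "\<gamma> \<in> \<Gamma>" and "det h = 1" for \<gamma> h
    using that(2)
  proof (induction rule: SL2Z_induct)
    case one
    then show ?case by simp
  next
    case (S h)
    have "det (\<gamma> ** h) = 1" using S \<gamma> by (simp add: det_mul)
    then show ?case using S \<gamma> pot_S[of "\<gamma> ** h"] pot_S[of h]
      by (simp add: matrix_mul_assoc add_diff_eq)
  next
    case (T h)
    have "det (\<gamma> ** h) = 1" using T \<gamma> by (simp add: det_mul)
    then show ?case using T \<gamma> pot_T[of "\<gamma> ** h"] pot_T[of h]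
      by (simp add: matrix_mul_assoc add_diff_eq)
  qed
  have "symbol_cochain \<Gamma> (\<lambda>g g'. pot g' - pot g)"
    unfolding symbol_cochain_def using pot_T_pow pot_\<Gamma> pot_T by simp
  then obtain \<phi>' where \<phi>': "\<phi>' \<in> int_dual (mixed_symbols_mod \<Gamma>)"
    "\<And>g g'. det g = 1 \<Longrightarrow> det g' = 1 \<Longrightarrow> \<phi>' (msym g g') = pot g' - pot g"
    using dual_of_symbol_cochain[OF subset] by blast
  define \<phi> where "\<phi> x = (of_int (\<phi>' x) / of_nat N ^ d :: rat)" for x
  have V: "\<phi> \<in> V" unfolding \<phi>_def by (rule localized_dualI[OF \<phi>'(1)])
  have "edge_values \<phi> (cl g) = a (cl g)" "cusp_values \<phi> (cl g) = b (cl g)" if "det g = 1" for g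
    using values_cl(1,2)[OF V that] that N_pos pot_S[of g] pot_T[of g]
    by (simp_all add: \<phi>_def \<phi>'(2) a' b')
  moreover have "edge_values \<phi> x = a x" "cusp_values \<phi> x = b x" if "x \<notin> X" for x
    using that assms by (simp_all add: edge_values_def cusp_values_def cochain_def)
  ultimately have "edge_values \<phi> x = a x" "cusp_values \<phi> x = b x" for x
    by (cases "x \<in> X"; auto elim!: X_cases)+
  then show thesis using that[OF V] by (simp add: fun_eq_iff)
qed

text \<open>The summand is a function of the signed coset, so the representatives chosen for cosets
  of \<Gamma> may be exchanged for \<open>rep\<close>.\<close>

lemma mixed_pairing_eq:
  assumes "\<phi> \<in> V" "\<psi> \<in> V"
  shows "mixed_pairing \<Gamma> \<phi> \<psi> =
    \<kappa> * (pair_form (edge_values \<phi>) (cusp_values \<phi>) (edge_values \<psi>) (cusp_values \<psi>) / 6)"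
proof -
  define F where "F g = \<phi> (msym (g ** matS) g) * \<psi> (msym (g ** matT ** matS) (g ** matT))
          - \<phi> (msym (g ** matT ** matS) (g ** matT)) * \<psi> (msym (g ** matS) g)
          - 4 * \<phi> (msym g (g ** matT)) * \<psi> (msym g (g ** matS))
          + 4 * \<phi> (msym g (g ** matS)) * \<psi> (msym g (g ** matT))" for g
  define E where "E x = edge_values \<phi> x * edge_values \<psi> (t x) - edge_values \<phi> (t x) * edge_values \<psi> x
     - 4 * cusp_values \<phi> x * edge_values \<psi> x + 4 * edge_values \<phi> x * cusp_values \<psi> x" for x
  have FE: "F g = E (cl g)" if "det g = 1" for g
    using that assms by (simp add: F_def E_def values_cl)
  have "mixed_pairing \<Gamma> \<phi> \<psi> = 1 / 6 * (\<Sum>C\<in>rcosets\<^bsub>SL2Z\<^esub> \<Gamma>. F (SOME g. g \<in> C))"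
    unfolding mixed_pairing_def Let_def F_def ..
  also have "(\<Sum>C\<in>rcosets\<^bsub>SL2Z\<^esub> \<Gamma>. F (SOME g. g \<in> C)) = \<kappa> * (\<Sum>x\<in>X. F (rep x))"
  proof (rule sum_rcosets)
    fix g h assume "det g = 1" "h \<in> cl g"
    then show "F h = F g" using FE[of g] FE[of h] det_cl[of g h] cl_eq_iff[of h g] by simp
  qed
  also have "(\<Sum>x\<in>X. F (rep x)) = (\<Sum>x\<in>X. E x)" by (intro sum.cong) (auto simp: FE rep)
  finally show ?thesis by (simp add: pair_form_def E_def)
qed

theorem perfect: "perfect_after_inverting N \<Gamma>"
proof -
  let ?B = "mixed_pairing \<Gamma>"
  \<comment> \<open>\<open>\<kappa>\<close> is 1 or 2, hence a unit of \<open>R\<close>.\<close>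
  have \<kappa>: "\<kappa> \<in> R" "1 / \<kappa> \<in> R" "\<kappa> \<noteq> 0" using R_one R_half R_numeral by (auto simp: \<kappa>_def)
  have V_add: "(\<lambda>x. \<phi> x + \<psi> x) \<in> V" if "\<phi> \<in> V" "\<psi> \<in> V" for \<phi> \<psi>
    by (rule localized_dual_add[OF N_pos that])
  have V_scale: "(\<lambda>x. r * \<phi> x) \<in> V" if "r \<in> R" "\<phi> \<in> V" for r \<phi>
    by (rule localized_dual_scale[OF N_pos that(2,1)])
  have val_add: "edge_values (\<lambda>x. \<phi> x + \<psi> x) = (\<lambda>x. edge_values \<phi> x + edge_values \<psi> x)"
    "cusp_values (\<lambda>x. \<phi> x + \<psi> x) = (\<lambda>x. cusp_values \<phi> x + cusp_values \<psi> x)" for \<phi> \<psi>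
    by (auto simp: edge_values_def cusp_values_def)
  have val_scale: "edge_values (\<lambda>x. r * \<phi> x) = (\<lambda>x. r * edge_values \<phi> x)"
    "cusp_values (\<lambda>x. r * \<phi> x) = (\<lambda>x. r * cusp_values \<phi> x)" for r \<phi>
    by (auto simp: edge_values_def cusp_values_def)
  have anti: "?B \<psi> \<phi> = - ?B \<phi> \<psi>" if "\<phi> \<in> V" "\<psi> \<in> V" for \<phi> \<psi>
    unfolding mixed_pairing_eq[OF that] mixed_pairing_eq[OF that(2,1)]
      pair_form_anti[of "edge_values \<psi>" "cusp_values \<psi>" "edge_values \<phi>" "cusp_values \<phi>"]
    by simp
  have form: "(\<lambda>\<psi>\<in>V. ?B \<phi> \<psi>) \<in> linear_forms R V" if \<phi>: "\<phi> \<in> V" for \<phi>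
  proof -
    have "?B \<phi> \<psi> \<in> R" if "\<psi> \<in> V" for \<psi> unfolding mixed_pairing_eq[OF \<phi> that]
      by (rule R_mult[OF \<kappa>(1) pair_form_integral[OF cochain_values[OF \<phi>] cochain_values[OF that]]])
    moreover have "?B \<phi> (\<lambda>x. \<psi> x + \<psi>' x) = ?B \<phi> \<psi> + ?B \<phi> \<psi>'" if "\<psi> \<in> V" "\<psi>' \<in> V" for \<psi> \<psi>'
    proof -
      have "?B (\<lambda>x. \<psi> x + \<psi>' x) \<phi> = ?B \<psi> \<phi> + ?B \<psi>' \<phi>"
        unfolding mixed_pairing_eq[OF V_add[OF that] \<phi>] mixed_pairing_eq[OF that(1) \<phi>]
          mixed_pairing_eq[OF that(2) \<phi>] val_add pair_form_add_left
        by (simp add: add_divide_distrib distrib_left)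
      then show ?thesis
        using anti[OF \<phi> that(1)] anti[OF \<phi> that(2)] anti[OF \<phi> V_add[OF that]] by simp
    qed
    moreover have "?B \<phi> (\<lambda>x. r * \<psi> x) = r * ?B \<phi> \<psi>" if "r \<in> R" "\<psi> \<in> V" for r \<psi>
    proof -
      have "?B (\<lambda>x. r * \<psi> x) \<phi> = r * ?B \<psi> \<phi>"
        unfolding mixed_pairing_eq[OF V_scale[OF that] \<phi>] mixed_pairing_eq[OF that(2) \<phi>]
          val_scale pair_form_scale_left by simp
      then show ?thesis using anti[OF \<phi> that(2)] anti[OF \<phi> V_scale[OF that]] by simp
    qed
    ultimately show ?thesis using V_add V_scale by (auto simp: linear_forms_def)
  qed
  have inj: "inj_on (\<lambda>\<phi>. \<lambda>\<psi>\<in>V. ?B \<phi> \<psi>) V"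
  proof (rule inj_onI)
    fix \<phi> \<phi>' assume V: "\<phi> \<in> V" "\<phi>' \<in> V" and eq: "(\<lambda>\<psi>\<in>V. ?B \<phi> \<psi>) = (\<lambda>\<psi>\<in>V. ?B \<phi>' \<psi>)"
    have eq: "?B \<phi> \<psi> = ?B \<phi>' \<psi>" if "\<psi> \<in> V" for \<psi> using fun_cong[OF eq, of \<psi>] that by simp
    let ?a = "\<lambda>x. edge_values \<phi> x - edge_values \<phi>' x" and ?b = "\<lambda>x. cusp_values \<phi> x
      - cusp_values \<phi>' x"
    have "pair_form c d ?a ?b = 0" if cd: "cochain R c d" for c d
    proof -
      obtain \<psi> where \<psi>: "\<psi> \<in> V" "edge_values \<psi> = c" "cusp_values \<psi> = d"
        using values_surj[OF cd] by blast
      then have "pair_form ?a ?b c d = 0"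
        using eq[OF \<psi>(1)] V \<kappa>(3) by (simp add: mixed_pairing_eq pair_form_diff_left)
      then show ?thesis using pair_form_anti[of c d ?a ?b] by simp
    qed
    then have "?a = (\<lambda>_. 0)" "?b = (\<lambda>_. 0)"
      using pair_form_nondegenerate[OF cochain_diff[OF cochain_values[OF V(1)] cochain_values[OF V(2)]]]
      by auto
    then show "\<phi> = \<phi>'" using V by (intro values_inj) (auto simp: fun_eq_iff)
  qed
  have surj: "\<exists>\<phi>\<in>V. (\<lambda>\<psi>\<in>V. ?B \<phi> \<psi>) = l" if l: "l \<in> linear_forms R V" for l
  proof -
    have l_add: "l (\<lambda>x. \<psi> x + \<psi>' x) = l \<psi> + l \<psi>'" if "\<psi> \<in> V" "\<psi>' \<in> V" for \<psi> \<psi>'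
      using l that by (simp add: linear_forms_def)
    have l_scale: "l (\<lambda>x. r * \<psi> x) = r * l \<psi>" if "r \<in> R" "\<psi> \<in> V" for r \<psi>
      using l that by (simp add: linear_forms_def)
    have l_R: "l \<psi> \<in> R" if "\<psi> \<in> V" for \<psi> using l that by (auto simp: linear_forms_def)
    have "\<forall>a b. \<exists>\<phi>. cochain R a b \<longrightarrow> \<phi> \<in> V \<and> edge_values \<phi> = a \<and> cusp_values \<phi> = b"
      using values_surj by metis
    then obtain e where e: "\<And>a b. cochain R a b \<Longrightarrow> e a b \<in> V \<and> edge_values (e a b) = a
      \<and> cusp_values (e a b) = b"
      by metis
    have e_values: "e (edge_values \<psi>) (cusp_values \<psi>) = \<psi>" if "\<psi> \<in> V" for \<psi>
      using e[OF cochain_values[OF that]] that by (intro values_inj) auto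
    \<comment> \<open>\<open>l\<close> is transported to cochains by the inverse \<open>e\<close> of
      the value map and divided by \<open>\<kappa>\<close>, the factor between
      \<open>mixed_pairing\<close> and \<open>pair_form / 6\<close>.\<close>
    have "cochain_functional (\<lambda>a b. 1 / \<kappa> * l (e a b))" unfolding cochain_functional_def
    proof (intro conjI allI impI)
      fix a b assume ab: "cochain R a b"
      show "1 / \<kappa> * l (e a b) \<in> R" using e[OF ab] l_R \<kappa>(2) by (intro R_mult) auto
      {
        fix a' b' assume ab': "cochain R a' b'"
        have "e (\<lambda>x. a x + a' x) (\<lambda>x. b x + b' x) = (\<lambda>x. e a b x + e a' b' x)"
          using e[OF ab] e[OF ab'] e[OF cochain_add[OF ab ab']] V_add
          by (intro values_inj) (auto simp: val_add)
        then show "1 / \<kappa> * l (e (\<lambda>x. a x + a' x) (\<lambda>x. b x + b' x)) = 1 / \<kappa> * l (e a b)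
          + 1 / \<kappa> * l (e a' b')"
          using l_add e[OF ab] e[OF ab'] by (simp add: distrib_left)
      }
      fix r assume r: "r \<in> R"
      have "e (\<lambda>x. r * a x) (\<lambda>x. r * b x) = (\<lambda>x. r * e a b x)"
        using e[OF ab] e[OF cochain_scale[OF ab r]] V_scale[OF r]
        by (intro values_inj) (auto simp: val_scale)
      then show "1 / \<kappa> * l (e (\<lambda>x. r * a x) (\<lambda>x. r * b x)) = r * (1 / \<kappa> * l (e a b))"
        using l_scale[OF r] e[OF ab] by simp
    qed
    then obtain a b where ab: "cochain R a b"
      "\<And>c d. cochain R c d \<Longrightarrow> pair_form a b c d / 6 = 1 / \<kappa> * l (e c d)"
      using cochain_functional_represented by metis
    have "(\<lambda>\<psi>\<in>V. ?B (e a b) \<psi>) = l"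
    proof
      fix \<psi>
      show "(\<lambda>\<psi>\<in>V. ?B (e a b) \<psi>) \<psi> = l \<psi>"
      proof (cases "\<psi> \<in> V")
        case True
        then show ?thesis
          using e[OF ab(1)] ab(2)[OF cochain_values[OF True]] \<kappa>(3) e_values[OF True]
          by (simp add: mixed_pairing_eq)
      next
        case False
        then show ?thesis using l by (auto simp: linear_forms_def PiE_def extensional_def)
      qed
    qed
    then show ?thesis using e[OF ab(1)] by blast
  qed
  have "bij_betw (\<lambda>\<phi>. \<lambda>\<psi>\<in>V. ?B \<phi> \<psi>) V (linear_forms R V)"
    using inj form surj by (auto simp: bij_betw_def)
  then show ?thesis unfolding perfect_after_inverting_def
    by (intro perfect_pairing_antisymmetric) (assumption | rule anti R_neg V_add V_scale)+
qed

end

subsection \<open>Widths of cusps\<close>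

lemma cross_denominator:
  assumes "det (g :: imat) = 1" "Im z > 0"
  shows "of_int (g $ 2 $ 1) * z + of_int (g $ 2 $ 2) \<noteq> 0"
proof
  assume eq: "of_int (g $ 2 $ 1) * z + of_int (g $ 2 $ 2) = 0"
  from arg_cong[OF eq, of Im] have "g $ 2 $ 1 = 0" using assms(2) by simp
  with eq have "g $ 2 $ 2 = 0" by simp
  with \<open>g $ 2 $ 1 = 0\<close> assms(1) show False by (cases g rule: mat2_cases) simp
qed

lemma uhp_act_mat2: "uhp_act (mat2 a b c d) z = (of_int a * z + of_int b) / (of_int c * z + of_int d)"
  by (simp add: uhp_act_def moebius_def)

lemma Im_uhp_act:
  assumes "det g = 1" "Im z > 0"
  shows "Im (uhp_act g z) = Im z / (cmod (of_int (g $ 2 $ 1) * z + of_int (g $ 2 $ 2)))\<^sup>2"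
proof (cases g rule: mat2_cases)
  case (1 a b c d)
  have det: "real_of_int a * real_of_int d - real_of_int b * real_of_int c = 1"
    using arg_cong[OF assms(1)[unfolded 1 det_mat2], of real_of_int] by simp
  have "Im ((of_int a * z + of_int b) * cnj (of_int c * z + of_int d)) =
      (real_of_int a * real_of_int d - real_of_int b * real_of_int c) * Im z"
    by (simp add: algebra_simps)
  moreover have "uhp_act g z = ((of_int a * z + of_int b) * cnj (of_int c * z + of_int d)) /
      of_real ((cmod (of_int c * z + of_int d))\<^sup>2)"
    unfolding 1 uhp_act_mat2 using complex_div_cnj[of "of_int a * z + of_int b" "of_int c * z
      + of_int d"]
    by simp
  ultimately show ?thesis using det by (simp only: Im_divide_of_real 1 mat2_nth)
qed

lemma divide_chain:
  fixes e :: "'a :: field"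
  assumes "e \<noteq> 0"
  shows "(a * (p / e) + b) / (c * (p / e) + d) = (a * p + b * e) / (c * p + d * e)"
proof -
  have "a * (p / e) + b = (a * p + b * e) / e" "c * (p / e) + d = (c * p + d * e) / e"
    using assms by (simp_all add: add_divide_distrib)
  then show ?thesis using assms by simp
qed

lemma uhp_act_mult:
  assumes "det g = 1" "det h = 1" "Im z > 0"
  shows "uhp_act (g ** h) z = uhp_act g (uhp_act h z)"
proof (cases g rule: mat2_cases, cases h rule: mat2_cases)
  fix a b c d a' b' c' d' assume g: "g = mat2 a b c d" and h: "h = mat2 a' b' c' d'"
  let ?e = "of_int c' * z + of_int d'"
  have e: "?e \<noteq> 0" using cross_denominator[OF assms(2,3)] h by simp
  from divide_chain[OF e] have "(of_int a * ((of_int a' * z + of_int b') / ?e) + of_int b) /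
      (of_int c * ((of_int a' * z + of_int b') / ?e) + of_int d) =
      (of_int a * (of_int a' * z + of_int b') + of_int b * ?e) /
      (of_int c * (of_int a' * z + of_int b') + of_int d * ?e)" .
  then show "uhp_act (g ** h) z = uhp_act g (uhp_act h z)"
    by (simp add: g h uhp_act_mat2 algebra_simps)
qed

lemma uhp_act_mneg [simp]: "uhp_act (mneg g) z = uhp_act g z"
proof (cases g rule: mat2_cases)
  case (1 a b c d)
  have "uhp_act (mneg g) z = - (of_int a * z + of_int b) / (- (of_int c * z + of_int d))"
    by (simp add: 1 uhp_act_mat2)
  then show ?thesis by (simp only: minus_divide_divide 1 uhp_act_mat2)
qed

lemma uhp_act_one [simp]: "uhp_act (mat 1) z = z" and uhp_act_T: "uhp_act (mat2 1 m 0 1) z = z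
  + of_int m"
  by (simp_all add: mat_eq_mat2 uhp_act_mat2)

lemma Im_uhp_act_pos: "det g = 1 \<Longrightarrow> Im z > 0 \<Longrightarrow> Im (uhp_act g z) > 0"
  using cross_denominator[of g z] by (simp add: Im_uhp_act)

lemma unipotent_cases:
  assumes "det g = 1" "g $ 2 $ 1 = 0"
  obtains m where "g = mat2 1 m 0 1" | m where "g = mneg (mat2 1 m 0 1)"
proof (cases g rule: mat2_cases)
  case (1 a b c d)
  with assms have "c = 0" "a * d = 1" by auto
  then have "a = 1 \<and> d = 1 \<or> a = - 1 \<and> d = - 1" by (simp add: zmult_eq_1_iff)
  then show thesis
  proof
    assume "a = 1 \<and> d = 1" then show thesis using that(1)[of b] 1 \<open>c = 0\<close> by simp
  next
    assume "a = - 1 \<and> d = - 1" then show thesis using that(2)[of "- b"] 1 \<open>c = 0\<close> by simp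
  qed
qed

text \<open>If the lower left entry is nonzero, then the denominator has absolute value at least
  \<open>Im z\<close>, so the image has height at most \<open>1 / Im z < 1\<close>. Above height 1
  only translations, up to sign, identify points.\<close>

lemma high_points_unipotent:
  assumes g: "det g = 1" and z: "Im z > 1" and gz: "Im (uhp_act g z) > 1"
  shows "g $ 2 $ 1 = 0"
proof (rule ccontr)
  let ?c = "g $ 2 $ 1" and ?d = "g $ 2 $ 2"
  assume "?c \<noteq> 0"
  then have "1 \<le> \<bar>real_of_int ?c\<bar>" by linarith
  then have "Im z \<le> \<bar>real_of_int ?c * Im z\<bar>" using z by (simp add: abs_mult mult_le_cancel_right1)
  also have "\<dots> \<le> cmod (of_int ?c * z + of_int ?d)"
    using abs_Im_le_cmod[of "of_int ?c * z + of_int ?d"] by simp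
  finally have le: "Im z \<le> cmod (of_int ?c * z + of_int ?d)" .
  have "Im z * 1 < Im z * Im z" using z by (intro mult_strict_left_mono) auto
  also have "\<dots> \<le> (cmod (of_int ?c * z + of_int ?d))\<^sup>2"
    unfolding power2_eq_square using le z by (intro mult_mono) auto
  finally have "Im z / (cmod (of_int ?c * z + of_int ?d))\<^sup>2 < 1"
    using z by (subst divide_less_eq_1_pos) auto
  then show False using gz Im_uhp_act[OF g, of z] z by simp
qed

text \<open>Homogeneous coordinates. They make the action linear and avoid the case distinctions of
  \<open>p1_act\<close> in the proof that it is an action.\<close>

definition p1_point :: "rat \<Rightarrow> rat \<Rightarrow> p1q" where
  "p1_point x y = (if y = 0 then Infty else Fin (x / y))"

lemma p1_act_point:
  assumes "det g = 1" "x \<noteq> 0 \<or> y \<noteq> 0"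
  shows "p1_act g (p1_point x y) = p1_point (of_int (g $ 1 $ 1) * x + of_int (g $ 1 $ 2) * y)
    (of_int (g $ 2 $ 1) * x + of_int (g $ 2 $ 2) * y)"
proof (cases g rule: mat2_cases)
  case (1 a b c d)
  show ?thesis
  proof (cases "y = 0")
    case True
    then show ?thesis using assms(2) by (simp add: 1 p1_act_def p1_point_def)
  next
    case False
    have "of_int c * (x / y) + of_int d = (of_int c * x + of_int d * y) / y"
      "of_int a * (x / y) + of_int b = (of_int a * x + of_int b * y) / y"
      using False by (simp_all add: field_simps)
    then show ?thesis using False by (simp add: 1 p1_act_def p1_point_def moebius_def)
  qed
qed

lemma p1_point_cases: obtains x y where "p = p1_point x y" "x \<noteq> 0 \<or> y \<noteq> 0"
  using that[of 1 0] that[of "case p of Fin q \<Rightarrow> q" 1] by (cases p) (auto simp: p1_point_def)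

lemma p1_act_mult:
  assumes "det g = 1" "det h = 1"
  shows "p1_act (g ** h) p = p1_act g (p1_act h p)"
proof -
  obtain x y where p: "p = p1_point x y" "x \<noteq> 0 \<or> y \<noteq> 0" by (rule p1_point_cases)
  obtain a b c d where h: "h = mat2 a b c d" by (rule mat2_cases)
  obtain a' b' c' d' where g: "g = mat2 a' b' c' d'" by (rule mat2_cases)
  have *: "of_int a * of_int d - of_int b * of_int c = (1 :: rat)"
    using arg_cong[OF assms(2)[unfolded h det_mat2], of rat_of_int] by simp
  have "of_int a * x + of_int b * y \<noteq> 0 \<or> of_int c * x + of_int d * y \<noteq> 0"
  proof (rule ccontr)
    assume "\<not> ?thesis"
    then have z: "of_int a * x + of_int b * y = 0" "of_int c * x + of_int d * y = 0" by auto
    have "of_int d * (of_int a * x + of_int b * y) - of_int b * (of_int c * x + of_int d * y)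
        = (of_int a * of_int d - of_int b * of_int c) * x"
      "of_int a * (of_int c * x + of_int d * y) - of_int c * (of_int a * x + of_int b * y)
        = (of_int a * of_int d - of_int b * of_int c) * y" by (simp_all add: algebra_simps)
    with z p(2) * show False by simp
  qed
  from p1_act_point[OF assms(1) this]
  have 1: "p1_act g (p1_act h p) = p1_point (of_int a' * (of_int a * x + of_int b * y)
    + of_int b' * (of_int c * x + of_int d * y))
     (of_int c' * (of_int a * x + of_int b * y) + of_int d' * (of_int c * x + of_int d * y))"
    using p1_act_point[OF assms(2) p(2)] by (simp add: p(1) h g)
  have "det (g ** h) = 1" using assms by (simp add: det_mul)
  from p1_act_point[OF this p(2)] show ?thesis
    unfolding 1 by (simp add: p(1) g h algebra_simps)
qed

lemma p1_act_one [simp]: "p1_act (mat 1) p = p"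
  by (cases p) (simp_all add: p1_act_def mat_eq_mat2 moebius_def)

lemma p1_act_mneg:
  assumes "det g = 1" shows "p1_act (mneg g) p = p1_act g p"
proof -
  obtain x y where p: "p = p1_point x y" "x \<noteq> 0 \<or> y \<noteq> 0" by (rule p1_point_cases)
  have "p1_point (- x') (- y') = p1_point x' y'" for x' y' by (simp add: p1_point_def)
  from this[of "of_int (g $ 1 $ 1) * x + of_int (g $ 1 $ 2) * y" "of_int (g $ 2 $ 1) * x
    + of_int (g $ 2 $ 2) * y"]
  show ?thesis using p1_act_point[of "mneg g" x y] p1_act_point[of g x y] p assms by simp
qed

lemma p1_act_Infty: "p1_act g Infty = p1_point (of_int (g $ 1 $ 1)) (of_int (g $ 2 $ 1))"
  by (simp add: p1_act_def p1_point_def)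

lemma p1_act_T_Infty [simp]: "p1_act (mat2 1 m 0 1) Infty = Infty" by (simp add: p1_act_def)

lemma stabilizer_Infty: "p1_act g Infty = Infty \<Longrightarrow> g $ 2 $ 1 = 0"
  by (simp add: p1_act_Infty p1_point_def split: if_splits)

lemma p1_transitive: obtains g where "det g = 1" "p = p1_act g Infty"
proof (cases p)
  case Infty
  then show thesis using that[of "mat 1"] by (simp add: mat_eq_mat2)
next
  case (Fin q)
  obtain a c where q: "quotient_of q = (a, c)" by fastforce
  then have "coprime a c" "c > 0" "q = of_int a / of_int c"
    using quotient_of_coprime quotient_of_denom_pos quotient_of_div by blast+
  moreover obtain d b where "d * a + b * c = gcd a c" using bezout_int[of a c] by blast
  ultimately show thesis
    using that[of "mat2 a (- b) c d"] Fin by (simp add: p1_act_def mult.commute)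
qed

text \<open>The neighbourhood for the second index is taken inside the one for the first, so its
  fibres are smaller. \<open>limit\<close> supplies a value other than \<open>f p\<close> at which
  to compare; at an isolated value the definition would hold for every index.\<close>

lemma has_ramification_index_le:
  assumes e1: "has_ramification_index TX TY f p e\<^sub>1" and e2: "has_ramification_index TX TY f p e\<^sub>2"
    and p: "p \<in> topspace TX"
    and limit: "\<And>V. openin TY V \<Longrightarrow> f p \<in> V \<Longrightarrow> V \<noteq> {f p}"
  shows "e\<^sub>2 \<le> e\<^sub>1"
proof -
  obtain U\<^sub>1 V\<^sub>1 where 1: "openin TX U\<^sub>1" "p \<in> U\<^sub>1" "openin TY V\<^sub>1" "f p \<in> V\<^sub>1"
    "\<forall>y \<in> V\<^sub>1 - {f p}. finite {x \<in> U\<^sub>1. f x = y} \<and> card {x \<in> U\<^sub>1. f x = y} = e\<^sub>1"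
    using e1[unfolded has_ramification_index_def, rule_format, of "topspace TX"] p by auto
  obtain U\<^sub>2 V\<^sub>2 where 2: "U\<^sub>2 \<subseteq> U\<^sub>1" "openin TY V\<^sub>2" "f p \<in> V\<^sub>2"
    "\<forall>y \<in> V\<^sub>2 - {f p}. finite {x \<in> U\<^sub>2. f x = y} \<and> card {x \<in> U\<^sub>2. f x = y} = e\<^sub>2"
    using e2[unfolded has_ramification_index_def, rule_format, of U\<^sub>1] 1 by auto
  have "openin TY (V\<^sub>1 \<inter> V\<^sub>2)" "f p \<in> V\<^sub>1 \<inter> V\<^sub>2" using 1 2 by auto
  with limit obtain y where y: "y \<in> V\<^sub>1" "y \<in> V\<^sub>2" "y \<noteq> f p" by blast
  have "card {x \<in> U\<^sub>2. f x = y} \<le> card {x \<in> U\<^sub>1. f x = y}"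
    using y 1(5) 2(1) by (intro card_mono) auto
  then show ?thesis using y 1(5) 2(4) by auto
qed

text \<open>Used to count the orbits of all integer translates of a point, an infinite family, by a
  cycle of cosets.\<close>

lemma card_image_eq:
  assumes "\<And>i j. i \<in> I \<Longrightarrow> j \<in> I \<Longrightarrow> f i = f j \<longleftrightarrow> g i = g j"
  shows "card (f ` I) = card (g ` I)" "finite (f ` I) \<longleftrightarrow> finite (g ` I)"
proof -
  have "bij_betw (\<lambda>y. g (inv_into I f y)) (f ` I) (g ` I)"
  proof (rule bij_betw_imageI)
    have *: "inv_into I f y \<in> I" "f (inv_into I f y) = y" if "y \<in> f ` I" for y
      using that by (auto intro: inv_into_into f_inv_into_f)
    show "inj_on (\<lambda>y. g (inv_into I f y)) (f ` I)" using * assms by (intro inj_onI) metis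
    show "(\<lambda>y. g (inv_into I f y)) ` f ` I = g ` I"
    proof
      show "(\<lambda>y. g (inv_into I f y)) ` f ` I \<subseteq> g ` I" using * by auto
      show "g ` I \<subseteq> (\<lambda>y. g (inv_into I f y)) ` f ` I"
      proof
        fix z assume "z \<in> g ` I"
        then obtain i where "i \<in> I" "z = g i" by auto
        then have "z = g (inv_into I f (f i))" using *[of "f i"] assms[of
          "inv_into I f (f i)" i] by auto
        then show "z \<in> (\<lambda>y. g (inv_into I f y)) ` f ` I" using \<open>i \<in> I\<close> by blast
      qed
    qed
  qed
  then show "card (f ` I) = card (g ` I)" "finite (f ` I) \<longleftrightarrow> finite (g ` I)"
    using bij_betw_same_card bij_betw_finite by blast+
qed

lemma h_act_simps [simp]:
  "h_act g (Inner z) = Inner (uhp_act g z)" "h_act g (Cusp p) = Cusp (p1_act g p)"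
  by (simp_all add: h_act_def)

lemma h_act_mult:
  assumes "det g = 1" "det h = 1" "p \<in> extended_uhp"
  shows "h_act (g ** h) p = h_act g (h_act h p)"
  using assms by (cases p) (auto simp: extended_uhp_def upper_half_plane_def uhp_act_mult p1_act_mult)

lemma h_act_one [simp]: "h_act (mat 1) p = p" by (cases p) simp_all

lemma extended_uhp_simps [simp]:
  "Inner z \<in> extended_uhp \<longleftrightarrow> Im z > 0" "Cusp p \<in> extended_uhp"
  by (auto simp: extended_uhp_def upper_half_plane_def)

lemma h_act_closed: "det g = 1 \<Longrightarrow> p \<in> extended_uhp \<Longrightarrow> h_act g p \<in> extended_uhp"
  by (cases p) (auto simp: Im_uhp_act_pos)

lemma h_orbit_eq: "h_orbit G p = (\<lambda>\<gamma>. h_act \<gamma> p) ` G" by (auto simp: h_orbit_def orbit_def)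

section \<open>Horoballs as neighbourhoods of cusps\<close>

definition horoball :: "real \<Rightarrow> hpoint set" where
  "horoball M = Inner ` {z. Im z > M} \<union> {Cusp Infty}"

lemma horoball_subset: "M \<ge> 0 \<Longrightarrow> horoball M \<subseteq> extended_uhp" by (auto simp: horoball_def)

lemma Infty_stabilizer_cases:
  assumes "det g = 1" "det h = 1" "p1_act h Infty = p1_act g Infty"
  obtains m where "h = g ** mat2 1 m 0 1 \<or> h = mneg (g ** mat2 1 m 0 1)"
proof -
  have "p1_act (minv g ** h) Infty = p1_act (minv g) (p1_act g Infty)"
    using assms by (simp add: p1_act_mult)
  also have "\<dots> = Infty" using assms by (simp add: p1_act_mult[symmetric] minv_left)
  finally have "(minv g ** h) $ 2 $ 1 = 0" by (rule stabilizer_Infty)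
  moreover have "det (minv g ** h) = 1" using assms by (simp add: det_mul)
  ultimately obtain m where "minv g ** h = mat2 1 m 0 1 \<or> minv g ** h = mneg (mat2 1 m 0 1)"
    by (metis unipotent_cases)
  then have "g ** (minv g ** h) = g ** mat2 1 m 0 1 \<or> g ** (minv g ** h) = g ** mneg (mat2 1 m 0 1)"
    by auto
  then have "h = g ** mat2 1 m 0 1 \<or> h = mneg (g ** mat2 1 m 0 1)"
    using assms(1) by (simp only: minv_cancel mult_mneg)
  then show thesis by (rule that)
qed

lemma open_extended_horoball:
  assumes g: "det g = 1" and M: "M > 0"
  shows "open_extended (h_act g ` horoball M)" unfolding open_extended_def
proof (intro conjI ballI impI)
  show "h_act g ` horoball M \<subseteq> extended_uhp"
    using h_act_closed[OF g] horoball_subset[of M] M by auto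
  have inv: "uhp_act g (uhp_act (minv g) z) = z" "uhp_act (minv g) (uhp_act g z) = z"
    if "Im z > 0" for z
    using that g by (simp_all add: uhp_act_mult[symmetric] minv_left minv_right)
  let ?q = "\<lambda>z. (cmod (of_int (minv g $ 2 $ 1) * z + of_int (minv g $ 2 $ 2)))\<^sup>2"
  have "{z. Inner z \<in> h_act g ` horoball M} = {z. Im z > 0 \<and> Im (uhp_act (minv g) z) > M}"
  proof (intro equalityI subsetI)
    fix z assume "z \<in> {z. Inner z \<in> h_act g ` horoball M}"
    then obtain w where "Im w > M" "z = uhp_act g w" by (auto simp: horoball_def)
    then show "z \<in> {z. Im z > 0 \<and> Im (uhp_act (minv g) z) > M}"
      using M g inv[of w] Im_uhp_act_pos[of g w] by simp
  next
    fix z assume z: "z \<in> {z. Im z > 0 \<and> Im (uhp_act (minv g) z) > M}"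
    then have "Inner z = h_act g (Inner (uhp_act (minv g) z))" using inv[of z] by simp
    moreover have "Inner (uhp_act (minv g) z) \<in> horoball M" using z by (auto simp: horoball_def)
    ultimately show "z \<in> {z. Inner z \<in> h_act g ` horoball M}" by blast
  qed
  \<comment> \<open>With the denominator cleared, both sides of the inequality are continuous on the
    whole plane.\<close>
  also have "\<dots> = {z. Im z > 0} \<inter> {z. M * ?q z < Im z}"
  proof -
    have "Im (uhp_act (minv g) z) > M \<longleftrightarrow> M * ?q z < Im z" if "Im z > 0" for z
    proof -
      have "?q z > 0" using cross_denominator[of "minv g" z] g that by simp
      then show ?thesis using Im_uhp_act[of "minv g" z] g that by (simp add: pos_less_divide_eq)
    qed
    then show ?thesis by auto
  qed
  also have "open \<dots>" by (intro open_Int open_Collect_less continuous_intros)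
  finally show "open {z. Inner z \<in> h_act g ` horoball M}" .
  fix h assume h: "h \<in> carrier SL2Z" and "h_act h (Cusp Infty) \<in> h_act g ` horoball M"
  then have "p1_act h Infty = p1_act g Infty" by (auto simp: horoball_def)
  then obtain m where m: "h = g ** mat2 1 m 0 1 \<or> h = mneg (g ** mat2 1 m 0 1)"
    using Infty_stabilizer_cases[OF g] h by auto
  have "h_act h (Inner z) \<in> h_act g ` horoball M" if z: "Im z > M" for z
  proof -
    have "uhp_act h z = uhp_act (g ** mat2 1 m 0 1) z" using m by auto
    also have "\<dots> = uhp_act g (z + of_int m)"
      using g z M by (simp add: uhp_act_mult uhp_act_T)
    finally have "h_act h (Inner z) = h_act g (Inner (z + of_int m))" by simp
    moreover have "Inner (z + of_int m) \<in> horoball M" using z by (auto simp: horoball_def)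
    ultimately show ?thesis by blast
  qed
  then show "\<exists>M'>0. \<forall>z. Im z > M' \<longrightarrow> h_act h (Inner z) \<in> h_act g ` horoball M"
    using M by blast
qed

lemma h_orbit_cong:
  assumes G: "subgroup G SL2Z" and p: "p \<in> extended_uhp" and \<gamma>: "\<gamma> \<in> G"
  shows "h_orbit G (h_act \<gamma> p) = h_orbit G p"
proof -
  have det: "det \<delta> = 1" if "\<delta> \<in> G" for \<delta> using subgroup.subset[OF G] that by auto
  have *: "h_orbit G (h_act \<delta> q) \<subseteq> h_orbit G q" if "\<delta> \<in> G" "q \<in> extended_uhp" for \<delta> q
  proof
    fix r assume "r \<in> h_orbit G (h_act \<delta> q)"
    then obtain \<epsilon> where "\<epsilon> \<in> G" "r = h_act \<epsilon> (h_act \<delta> q)" by (auto simp: h_orbit_eq)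
    then have "r = h_act (\<epsilon> ** \<delta>) q" "\<epsilon> ** \<delta> \<in> G"
      using that det subgroup.m_closed[OF G, of \<epsilon> \<delta>] by (simp_all add: h_act_mult)
    then show "r \<in> h_orbit G q" by (auto simp: h_orbit_eq)
  qed
  have "minv \<gamma> \<in> G" using subgroup.m_inv_closed[OF G \<gamma>] inv_SL2Z[OF det[OF \<gamma>]] by simp
  moreover have "h_act (minv \<gamma>) (h_act \<gamma> p) = p"
    using p det[OF \<gamma>] by (simp add: h_act_mult[symmetric] minv_left)
  ultimately show ?thesis
    using *[OF \<gamma> p] *[of "minv \<gamma>" "h_act \<gamma> p"] h_act_closed[OF det[OF \<gamma>] p] by auto
qed

lemma h_orbit_self: "subgroup G SL2Z \<Longrightarrow> p \<in> h_orbit G p"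
  using subgroup.one_closed[of G SL2Z] by (force simp: h_orbit_eq)

lemma openin_horoball_image:
  assumes G: "subgroup G SL2Z" and g: "det g = 1" and M: "M > 0"
  shows "openin (modular_curve G) (h_orbit G ` h_act g ` horoball M)"
proof -
  have det: "det \<delta> = 1" if "\<delta> \<in> G" for \<delta> using subgroup.subset[OF G] that by auto
  have sub: "h_act g ` horoball M \<subseteq> extended_uhp"
    using h_act_closed[OF g] horoball_subset[of M] M by auto
  have "{p \<in> extended_uhp. h_orbit G p \<in> h_orbit G ` h_act g ` horoball M} =
      (\<Union>\<gamma>\<in>G. h_act (\<gamma> ** g) ` horoball M)"
  proof (intro equalityI subsetI)
    fix p assume "p \<in> {p \<in> extended_uhp. h_orbit G p \<in> h_orbit G ` h_act g ` horoball M}"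
    then obtain q where q: "q \<in> horoball M" "h_orbit G p = h_orbit G (h_act g q)" by auto
    then have "p \<in> h_orbit G (h_act g q)" using h_orbit_self[OF G, of p] by simp
    then obtain \<gamma> where "\<gamma> \<in> G" "p = h_act \<gamma> (h_act g q)" by (auto simp: h_orbit_eq)
    then have "p = h_act (\<gamma> ** g) q"
      using g q(1) det horoball_subset[of M] M by (subst h_act_mult) auto
    then show "p \<in> (\<Union>\<gamma>\<in>G. h_act (\<gamma> ** g) ` horoball M)" using q(1) \<open>\<gamma> \<in> G\<close> by blast
  next
    fix p assume "p \<in> (\<Union>\<gamma>\<in>G. h_act (\<gamma> ** g) ` horoball M)"
    then obtain \<gamma> q where *: "\<gamma> \<in> G" "q \<in> horoball M" "p = h_act (\<gamma> ** g) q" by auto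
    then have q: "q \<in> extended_uhp" using horoball_subset[of M] M by auto
    have p: "p = h_act \<gamma> (h_act g q)" using * g det q by (simp add: h_act_mult)
    have "h_orbit G p = h_orbit G (h_act g q)" "p \<in> extended_uhp"
      unfolding p using h_orbit_cong[OF G _ *(1)] h_act_closed q g det[OF *(1)] by auto
    then show "p \<in> {p \<in> extended_uhp. h_orbit G p \<in> h_orbit G ` h_act g ` horoball M}"
      using *(2) by blast
  qed
  moreover have "openin extended_topology (\<Union>\<gamma>\<in>G. h_act (\<gamma> ** g) ` horoball M)"
    using open_extended_horoball[OF _ M] g det
    by (intro openin_Union) (auto simp: openin_extended_topology det_mul)
  ultimately show ?thesis
    using sub by (auto simp: openin_modular_curve open_modular_curve_def modular_curve_set_def)
qed

section \<open>Ramification of the covering at the cusps\<close>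

context finite_index
begin

lemma full_subgroup: "subgroup (carrier SL2Z) SL2Z" by (rule SL2Z.subgroup_self)

lemma modular_covering_orbit:
  assumes "p \<in> extended_uhp"
  shows "modular_covering (h_orbit \<Gamma> p) = h_orbit (carrier SL2Z) p"
proof -
  have "h_orbit (carrier SL2Z) (h_act \<gamma> p) = h_orbit (carrier SL2Z) p" if "\<gamma> \<in> \<Gamma>" for \<gamma>
    using h_orbit_cong[OF full_subgroup assms, of \<gamma>] that by simp
  then show ?thesis using one_\<Gamma> by (auto simp: modular_covering_def h_orbit_eq[of \<Gamma>])
qed

text \<open>In a high horoball at the cusp of \<open>g\<close>, the points over the orbit of
  \<open>z\<close> are the orbits of \<open>g(z + m)\<close>. Two of them agree exactly if
  \<open>gT^m\<close> and \<open>gT^n\<close> have the same signed coset, so the fibre has as many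
  elements as the cycle of \<open>t\<close>.\<close>

lemma ramification_at_cusp:
  assumes g: "det g = 1"
  shows "has_ramification_index (modular_curve \<Gamma>) (modular_curve (carrier SL2Z))
    modular_covering (h_orbit \<Gamma> (h_act g (Cusp Infty))) (width (cl g))"
  unfolding has_ramification_index_def
proof (intro allI impI)
  let ?c = "h_orbit \<Gamma> (h_act g (Cusp Infty))"
  let ?full = "carrier SL2Z"
  fix U0 assume U0: "openin (modular_curve \<Gamma>) U0 \<and> ?c \<in> U0"
  have fc: "modular_covering ?c = h_orbit ?full (Cusp Infty)"
    using modular_covering_orbit[of "h_act g (Cusp Infty)"] h_orbit_cong[OF full_subgroup _, of
      "Cusp Infty" g] g by simp
  have "open_extended {p \<in> extended_uhp. h_orbit \<Gamma> p \<in> U0}"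
    using U0 by (auto simp: openin_modular_curve open_modular_curve_def openin_extended_topology)
  moreover have "h_act g (Cusp Infty) \<in> {p \<in> extended_uhp. h_orbit \<Gamma> p \<in> U0}" "g \<in> carrier SL2Z"
    using U0 g by simp_all
  ultimately obtain M0 where M0:
    "\<forall>z. Im z > M0 \<longrightarrow> h_act g (Inner z) \<in> {p \<in> extended_uhp. h_orbit \<Gamma> p \<in> U0}"
    unfolding open_extended_def by blast
  \<comment> \<open>Height at least 1 is what \<open>high_points_unipotent\<close> needs;
    \<open>M0\<close> keeps the horoball inside \<open>U0\<close>.\<close>
  define M where "M = max M0 1"
  have M: "M \<ge> M0" "M \<ge> 1" "M > 0" by (auto simp: M_def)
  let ?U = "h_orbit \<Gamma> ` h_act g ` horoball M"
  let ?V = "h_orbit ?full ` h_act (mat 1) ` horoball M"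
  have "openin (modular_curve \<Gamma>) ?U" "openin (modular_curve ?full) ?V"
    using openin_horoball_image[OF subgroup g M(3)] openin_horoball_image[OF full_subgroup _ M(3), of "mat 1"] by auto
  moreover have "?c \<in> ?U" by (simp add: horoball_def)
  moreover have "modular_covering ?c \<in> ?V" unfolding fc by (simp add: horoball_def)
  moreover have "?U \<subseteq> U0"
  proof
    fix x assume "x \<in> ?U"
    then obtain q where q: "q \<in> horoball M" "x = h_orbit \<Gamma> (h_act g q)" by blast
    show "x \<in> U0"
    proof (cases q)
      case (Inner z)
      then have "M0 < Im z" using q(1) M(1) by (auto simp: horoball_def)
      with M0 have "h_act g q \<in> {p \<in> extended_uhp. h_orbit \<Gamma> p \<in> U0}"
        unfolding Inner by blast
      then show ?thesis using q(2) by simp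
    next
      case (Cusp p)
      then have "q = Cusp Infty" using q(1) by (auto simp: horoball_def)
      then show ?thesis using q(2) U0 by (simp only:)
    qed
  qed
  moreover have "finite {x \<in> ?U. modular_covering x = y} \<and> card {x \<in> ?U. modular_covering x = y}
    = width (cl g)"
    if y: "y \<in> ?V - {modular_covering ?c}" for y
  proof -
    obtain z where z: "Im z > M" "y = h_orbit ?full (Inner z)"
    proof -
      obtain q where q: "q \<in> horoball M" "y = h_orbit ?full q" using y by auto
      show thesis
      proof (cases q)
        case (Inner z)
        then show ?thesis using q that[of z] by (auto simp: horoball_def)
      next
        case (Cusp p)
        then have "q = Cusp Infty" using q by (auto simp: horoball_def)
        then have "y = modular_covering ?c" unfolding fc using q by simp
        then show ?thesis using y by blast
      qed
    qed
    have z0: "Im z > 0" "Im z > 1" using z M by auto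
    let ?x = "\<lambda>m :: int. h_orbit \<Gamma> (h_act g (Inner (z + of_int m)))"
    have "{x \<in> ?U. modular_covering x = y} = range ?x"
    proof (intro equalityI subsetI)
      fix x assume "x \<in> {x \<in> ?U. modular_covering x = y}"
      then obtain q where q: "q \<in> horoball M" "x = h_orbit \<Gamma> (h_act g q)" "modular_covering x
        = y" by auto
      have qe: "q \<in> extended_uhp" using q(1) horoball_subset[of M] M by auto
      have "h_orbit ?full q = y"
        using q modular_covering_orbit[of "h_act g q"] h_orbit_cong[OF full_subgroup qe, of g] g
          h_act_closed[OF g qe] by simp
      then have "q \<in> h_orbit ?full (Inner z)" using h_orbit_self[OF full_subgroup, of q] z(2) by simp
      then obtain k where k: "det k = 1" "q = Inner (uhp_act k z)" by (auto simp: h_orbit_eq)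
      then have "Im (uhp_act k z) > 1" using q(1) M by (auto simp: horoball_def)
      then have "k $ 2 $ 1 = 0" by (rule high_points_unipotent[OF k(1) z0(2)])
      then obtain m where "k = mat2 1 m 0 1 \<or> k = mneg (mat2 1 m 0 1)"
        using unipotent_cases[OF k(1)] by metis
      then have "q = Inner (z + of_int m)"
        using k(2) by (elim disjE) (simp_all only: uhp_act_mneg uhp_act_T)
      then show "x \<in> range ?x" using q(2) by auto
    next
      fix x assume "x \<in> range ?x"
      then obtain m where m: "x = ?x m" by auto
      have "x \<in> ?U" unfolding m using z(1) by (intro imageI) (auto simp: horoball_def)
      moreover have "modular_covering x = y"
      proof -
        have "h_act g (Inner (z + of_int m)) = h_act (g ** mat2 1 m 0 1) (Inner z)"
          using g z0 by (simp add: uhp_act_mult uhp_act_T)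
        moreover have "modular_covering (h_orbit \<Gamma> (h_act (g ** mat2 1 m 0 1) (Inner z)))
            = h_orbit ?full (h_act (g ** mat2 1 m 0 1) (Inner z))"
          using g z0 by (intro modular_covering_orbit h_act_closed) auto
        moreover have "h_orbit ?full (h_act (g ** mat2 1 m 0 1) (Inner z)) = y"
          unfolding z(2) using g z0 by (intro h_orbit_cong[OF full_subgroup]) auto
        ultimately show ?thesis unfolding m by (simp only:)
      qed
      ultimately show "x \<in> {x \<in> ?U. modular_covering x = y}" by blast
    qed
    moreover have "?x m = ?x n \<longleftrightarrow> cl (g ** mat2 1 m 0 1) = cl (g ** mat2 1 n 0 1)" for m n
    proof -
      let ?m = "g ** mat2 1 m 0 1" and ?n = "g ** mat2 1 n 0 1"
      have d: "det ?m = 1" "det ?n = 1" using g by auto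
      have eq: "h_act g (Inner (z + of_int i)) = h_act (g ** mat2 1 i 0 1) (Inner z)" for i
        using g z0 by (simp add: uhp_act_mult uhp_act_T)
      \<comment> \<open>A point above height 1 has stabiliser \<plusminus>1: whatever fixes it is a
        translation up to sign, and the translation has to be trivial.\<close>
      have fixed: "h = k \<or> h = mneg k"
        if "det h = 1" "det k = 1" "uhp_act h z = uhp_act k z" for h k
      proof -
        have e: "uhp_act (minv k ** h) z = z"
          using that z0 by (simp add: uhp_act_mult) (simp add: uhp_act_mult[symmetric] minv_left)
        have dd: "det (minv k ** h) = 1" using that by (simp add: det_mul)
        have "(minv k ** h) $ 2 $ 1 = 0"
          using high_points_unipotent[OF dd z0(2)] e z0 by simp
        then obtain i where i: "minv k ** h = mat2 1 i 0 1 \<or> minv k ** h = mneg (mat2 1 i 0 1)"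
          using unipotent_cases[OF dd] by metis
        then have "z + of_int i = z"
          using e by (elim disjE) (simp_all only: uhp_act_mneg uhp_act_T)
        then have "minv k ** h = mat 1 \<or> minv k ** h = mneg (mat 1)"
          using i by (simp add: mat_eq_mat2)
        then have "k ** (minv k ** h) = k \<or> k ** (minv k ** h) = mneg k" by auto
        then show ?thesis using that by simp
      qed
      show ?thesis
      proof
        assume "?x m = ?x n"
        then have "h_orbit \<Gamma> (h_act ?m (Inner z)) = h_orbit \<Gamma> (h_act ?n (Inner z))" by (simp only: eq)
        then have "h_act ?m (Inner z) \<in> h_orbit \<Gamma> (h_act ?n (Inner z))"
          using h_orbit_self[OF subgroup] by metis
        then obtain \<gamma> where \<gamma>: "\<gamma> \<in> \<Gamma>" "h_act ?m (Inner z) = h_act \<gamma> (h_act ?n (Inner z))"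
          unfolding h_orbit_eq by blast
        then have "uhp_act ?m z = uhp_act (\<gamma> ** ?n) z"
          using d z0 by (simp add: uhp_act_mult[of \<gamma> ?n])
        then have "?m = \<gamma> ** ?n \<or> ?m = mneg (\<gamma> ** ?n)"
          using fixed[of ?m "\<gamma> ** ?n"] d \<gamma>(1) by (simp add: det_mul[of \<gamma>])
        then show "cl ?m = cl ?n" using \<gamma>(1) by (metis cl_mult signed_coset_mneg)
      next
        assume "cl ?m = cl ?n"
        then have "?m \<in> cl ?n" by (simp add: cl_eq_iff)
        then obtain \<gamma> where \<gamma>: "\<gamma> \<in> \<Gamma>" "?m = \<gamma> ** ?n \<or> ?m = mneg (\<gamma> ** ?n)"
          by (auto simp: signed_coset_def)
        then have "h_act ?m (Inner z) = h_act (\<gamma> ** ?n) (Inner z)"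
          using d by (metis h_act_simps(1) uhp_act_mneg)
        also have "\<dots> = h_act \<gamma> (h_act ?n (Inner z))" using \<gamma> d z0 by (intro h_act_mult) auto
        finally have "h_orbit \<Gamma> (h_act ?m (Inner z)) = h_orbit \<Gamma> (h_act ?n (Inner z))"
          using h_orbit_cong[OF subgroup _ \<gamma>(1), of
            "h_act ?n (Inner z)"] h_act_closed[OF d(2), of "Inner z"] z0
          by simp
        then show "?x m = ?x n" by (simp only: eq)
      qed
    qed
    \<comment> \<open>\<open>cyc\<close> is defined with nonnegative powers of \<open>t\<close>;
      negative translations lie in it as well because the cycle is finite.\<close>
    moreover have "range (\<lambda>m. cl (g ** mat2 1 m 0 1)) = cyc (cl g)"
    proof (intro equalityI subsetI)
      fix C assume "C \<in> range (\<lambda>m. cl (g ** mat2 1 m 0 1))"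
      moreover have "cl (g ** mat2 1 m 0 1) \<in> cyc (cl g)" for m
      proof (induction m rule: int_induct[where ?k = 0])
        case base
        then show ?case by (simp add: mat_eq_mat2[symmetric])
      next
        case (step1 i)
        have "cl (g ** mat2 1 (i + 1) 0 1) = t (cl (g ** mat2 1 i 0 1))"
          using g by (simp add: matT_eq_mat2 matrix_mul_assoc[symmetric] add.commute)
        then show ?case using step1 g by (simp del: t_cl)
      next
        case (step2 i)
        have "cl (g ** mat2 1 i 0 1) = t (cl (g ** mat2 1 (i - 1) 0 1))"
          using g by (simp add: matT_eq_mat2 matrix_mul_assoc[symmetric])
        then show ?case using step2 g by (simp del: t_cl)
      qed
      ultimately show "C \<in> cyc (cl g)" by auto
    next
      fix C assume "C \<in> cyc (cl g)"
      then obtain k where "C = cl (g ** mat2 1 (int k) 0 1)"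
        using t_pow_cl[OF g] by (auto simp: cyc_def)
      then show "C \<in> range (\<lambda>m. cl (g ** mat2 1 m 0 1))" by auto
    qed
    moreover have "finite (cyc (cl g))"
      using cyc_subset[of "cl g"] finite_X g finite_subset by auto
    ultimately show ?thesis
      using card_image_eq[of UNIV ?x "\<lambda>m. cl (g ** mat2 1 m 0 1)"] card_cyc[of "cl g"] g by simp
  qed
  ultimately show "\<exists>U V. openin (modular_curve \<Gamma>) U \<and> ?c \<in> U \<and> U \<subseteq> U0 \<and>
      openin (modular_curve ?full) V \<and> modular_covering ?c \<in> V \<and>
      (\<forall>y\<in>V - {modular_covering ?c}. finite {x \<in> U. modular_covering x = y} \<and>
        card {x \<in> U. modular_covering x = y} = width (cl g))" by blast
qed

theorem cusp_width_eq:
  assumes g: "det g = 1"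
  shows "cusp_width \<Gamma> (h_orbit \<Gamma> (h_act g (Cusp Infty))) = width (cl g)"
proof -
  let ?c = "h_orbit \<Gamma> (h_act g (Cusp Infty))"
  let ?full = "carrier SL2Z"
  have "openin (modular_curve \<Gamma>) (h_orbit \<Gamma> ` h_act g ` horoball 1)"
    by (rule openin_horoball_image[OF subgroup g]) simp
  moreover have "?c \<in> h_orbit \<Gamma> ` h_act g ` horoball 1" by (simp add: horoball_def)
  ultimately have c: "?c \<in> topspace (modular_curve \<Gamma>)" using openin_subset by blast
  have fc: "modular_covering ?c = h_orbit ?full (Cusp Infty)"
    using modular_covering_orbit[of "h_act g (Cusp Infty)"] h_orbit_cong[OF full_subgroup _, of
      "Cusp Infty" g] g by simp
  \<comment> \<open>Every neighbourhood of the cusp contains orbits of points high in the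
    half-plane, which are never orbits of cusps.\<close>
  have limit: "V \<noteq> {modular_covering ?c}"
    if V: "openin (modular_curve ?full) V" "modular_covering ?c \<in> V" for V
  proof -
    have "open_extended {p \<in> extended_uhp. h_orbit ?full p \<in> V}"
      using V(1) by (auto simp: openin_modular_curve open_modular_curve_def openin_extended_topology)
    moreover have "h_act (mat 1) (Cusp Infty) \<in> {p \<in> extended_uhp. h_orbit ?full p \<in> V}"
      using V(2) unfolding fc by simp
    moreover have "mat 1 \<in> carrier SL2Z" by simp
    ultimately obtain M where "M > 0"
      "\<forall>z. Im z > M \<longrightarrow> h_act (mat 1) (Inner z) \<in> {p \<in> extended_uhp. h_orbit ?full p \<in> V}"
      unfolding open_extended_def by blast
    then have "h_orbit ?full (Inner (Complex 0 (M + 1))) \<in> V" by simp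
    moreover have "Inner z \<notin> h_orbit ?full (Cusp Infty)" for z by (auto simp: h_orbit_eq)
    then have "h_orbit ?full (Inner z) \<noteq> h_orbit ?full (Cusp Infty)" for z
      using h_orbit_self[OF full_subgroup] by metis
    ultimately show ?thesis unfolding fc by blast
  qed
  show ?thesis unfolding cusp_width_def
  proof (rule the_equality)
    fix e assume e: "has_ramification_index (modular_curve \<Gamma>) (modular_curve ?full) modular_covering ?c e"
    show "e = width (cl g)"
      using has_ramification_index_le[OF e ramification_at_cusp[OF g] c limit]
        has_ramification_index_le[OF ramification_at_cusp[OF g] e c limit] by (simp add: antisym)
  qed (rule ramification_at_cusp[OF g])
qed

lemma cusp_widths: "cusp_width \<Gamma> ` cusps \<Gamma> = width ` X"
proof (intro equalityI subsetI)
  fix n assume "n \<in> cusp_width \<Gamma> ` cusps \<Gamma>"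
  then obtain p where p: "n = cusp_width \<Gamma> (h_orbit \<Gamma> (Cusp p))" by (auto simp: cusps_def)
  obtain g where "det g = 1" "p = p1_act g Infty" by (rule p1_transitive)
  then show "n \<in> width ` X" using p cusp_width_eq[of g] by auto
next
  fix n assume "n \<in> width ` X"
  then obtain g where g: "det g = 1" "n = width (cl g)" by (auto simp: X_def)
  then have "n = cusp_width \<Gamma> (h_orbit \<Gamma> (Cusp (p1_act g Infty)))"
    using cusp_width_eq[of g] by simp
  then show "n \<in> cusp_width \<Gamma> ` cusps \<Gamma>" by (auto simp: cusps_def)
qed

end

subsection \<open>The groups \<open>Gamma1 N\<close>\<close>

lemma Gamma1_iff:
  "g \<in> Gamma1 N \<longleftrightarrow> det g = 1 \<and> int N dvd g $ 1 $ 1 - 1 \<and> int N dvd g $ 2 $ 2 - 1 \<and> int N dvd g $ 2 $ 1"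
  by (simp add: Gamma1_def cong_iff_dvd_diff)

lemma Gamma1_mult:
  assumes "g \<in> Gamma1 N" "h \<in> Gamma1 N" shows "g ** h \<in> Gamma1 N"
proof -
  obtain a b c d where g: "g = mat2 a b c d" by (rule mat2_cases)
  obtain a' b' c' d' where h: "h = mat2 a' b' c' d'" by (rule mat2_cases)
  have N: "int N dvd a - 1" "int N dvd d - 1" "int N dvd c" "int N dvd a' - 1" "int N dvd d'
    - 1" "int N dvd c'"
    using assms by (simp_all add: Gamma1_iff g h)
  have "a * a' + b * c' - 1 = (a - 1) * a' + (a' - 1) + b * c'"
    "c * b' + d * d' - 1 = c * b' + (d - 1) * d' + (d' - 1)" by (simp_all add: algebra_simps)
  then have "int N dvd a * a' + b * c' - 1" "int N dvd c * b' + d * d' - 1" "int N dvd c * a'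
    + d * c'"
    using N by (simp_all only:) (intro dvd_add dvd_mult dvd_mult2; assumption)+
  moreover have "det (g ** h) = 1" using assms by (simp add: Gamma1_iff det_mul)
  ultimately show ?thesis by (simp add: Gamma1_iff g h)
qed

lemma cusps_fixed_iff:
  "cusps_fixed_by_conjugation (Gamma1 N) \<longleftrightarrow> (\<forall>x. \<exists>\<gamma>\<in>Gamma1 N. p1_act \<gamma> x = p1_neg x)"
proof -
  have orb: "orbit (SL2Z\<lparr>carrier := Gamma1 N\<rparr>) p1_act x = (\<lambda>\<gamma>. p1_act \<gamma> x) ` Gamma1 N" for x
    by (auto simp: orbit_def)
  have one: "mat 1 \<in> Gamma1 N" by (simp add: Gamma1_iff mat_eq_mat2)
  have neg: "p1_neg (p1_neg x) = x" for x by (cases x) (simp_all add: p1_neg_def)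
  show ?thesis
  proof
    assume L: "cusps_fixed_by_conjugation (Gamma1 N)"
    show "\<forall>x. \<exists>\<gamma>\<in>Gamma1 N. p1_act \<gamma> x = p1_neg x"
    proof
      fix x
      have "p1_neg x \<in> (\<lambda>\<gamma>. p1_act \<gamma> (p1_neg x)) ` Gamma1 N"
        using one by (rule rev_image_eqI) simp
      then have "p1_neg x \<in> (\<lambda>\<gamma>. p1_act \<gamma> x) ` Gamma1 N"
        using L unfolding cusps_fixed_by_conjugation_def orb by blast
      then show "\<exists>\<gamma>\<in>Gamma1 N. p1_act \<gamma> x = p1_neg x" by auto
    qed
  next
    assume R: "\<forall>x. \<exists>\<gamma>\<in>Gamma1 N. p1_act \<gamma> x = p1_neg x"
    \<comment> \<open>The reverse inclusion is this one at \<open>p1_neg x\<close>, negation being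
      an involution.\<close>
    have sub: "(\<lambda>\<gamma>. p1_act \<gamma> (p1_neg x)) ` Gamma1 N \<subseteq> (\<lambda>\<gamma>. p1_act \<gamma> x) ` Gamma1 N" for x
    proof
      fix y assume "y \<in> (\<lambda>\<gamma>. p1_act \<gamma> (p1_neg x)) ` Gamma1 N"
      then obtain \<delta> where \<delta>: "\<delta> \<in> Gamma1 N" "y = p1_act \<delta> (p1_neg x)" by auto
      obtain \<gamma> where \<gamma>: "\<gamma> \<in> Gamma1 N" "p1_act \<gamma> x = p1_neg x" using R by blast
      have "y = p1_act (\<delta> ** \<gamma>) x" using \<gamma> \<delta> by (simp add: p1_act_mult Gamma1_iff)
      then show "y \<in> (\<lambda>\<gamma>. p1_act \<gamma> x) ` Gamma1 N" using Gamma1_mult \<gamma>(1) \<delta>(1) by blast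
    qed
    show "cusps_fixed_by_conjugation (Gamma1 N)"
      unfolding cusps_fixed_by_conjugation_def orb
    proof
      fix x
      show "(\<lambda>\<gamma>. p1_act \<gamma> (p1_neg x)) ` Gamma1 N = (\<lambda>\<gamma>. p1_act \<gamma> x) ` Gamma1 N"
        using sub[of x] sub[of "p1_neg x"] unfolding neg by (rule equalityI)
    qed
  qed
qed

text \<open>The matrix \<open>?g'\<close> carries \<infinity> to the negated cusp, so candidates for
  \<open>\<gamma>\<close> are \<open>?g'\<close> times a power of T times the inverse of the given
  matrix, up to sign. It remains to choose the exponent \<open>j\<close> and the sign:
  \<open>j = 0\<close> and plus if \<open>N\<close> divides \<open>2 * c\<close>, otherwise minus
  and a solution of \<open>c * j = 2 * d\<close> modulo \<open>N\<close>.\<close>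

lemma conjugate_cusp:
  assumes g: "det (mat2 a b c d) = 1" and c: "gcd c (int N) dvd 2 \<or> int N dvd 2 * c"
  shows "\<exists>\<gamma>\<in>Gamma1 N. p1_act \<gamma> (p1_act (mat2 a b c d) Infty) = p1_neg (p1_act (mat2 a b c d) Infty)"
proof -
  let ?g = "mat2 a b c d" and ?g' = "mat2 a (- b) (- c) d"
  have g': "det ?g' = 1" using g by simp
  have neg: "p1_act ?g' Infty = p1_neg (p1_act ?g Infty)"
    by (simp add: p1_act_Infty p1_point_def p1_neg_def)
  have "det (mat2 1 j 0 1) = 1" for j by simp
  then have det: "det (?g' ** mat2 1 j 0 1 ** minv ?g) = 1" for j
    by (simp only: det_mul det_minv g g' mult_1)
  have act: "p1_act (?g' ** mat2 1 j 0 1 ** minv ?g) (p1_act ?g Infty)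
    = p1_neg (p1_act ?g Infty)" for j
  proof -
    have "p1_act (?g' ** mat2 1 j 0 1 ** minv ?g) (p1_act ?g Infty)
      = p1_act (?g' ** mat2 1 j 0 1 ** minv ?g ** ?g) Infty"
      using g det[of j] by (rule p1_act_mult[symmetric, rotated])
    also have "\<dots> = p1_act (?g' ** mat2 1 j 0 1) Infty" using g by (simp only: minv_cancel)
    also have "\<dots> = p1_act ?g' Infty"
      using g' by (subst p1_act_mult) (simp_all del: mat2_mult)
    finally show ?thesis using neg by simp
  qed
  have entries: "?g' ** mat2 1 j 0 1 ** minv ?g =
      mat2 (a * d + b * c - a * c * j) (- 2 * a * b + a * a * j) (- 2 * c * d
        + c * c * j) (a * d + b * c - a * c * j)" for j
    by (simp add: algebra_simps)
  have one: "a * d - b * c = 1" using g by simp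
  show ?thesis
  proof (cases "int N dvd 2 * c")
    case True
    then have "int N dvd b * (2 * c)" "int N dvd - d * (2 * c)" by (simp_all only: dvd_mult)
    moreover have "a * d + b * c - 1 = b * (2 * c)" using one by simp
    ultimately have "?g' ** mat2 1 0 0 1 ** minv ?g \<in> Gamma1 N"
      using det[of 0] unfolding Gamma1_iff entries by (simp add: algebra_simps)
    then show ?thesis using act[of 0] by blast
  next
    case False
    then have "gcd c (int N) dvd 2 * d" using c by (simp add: dvd_mult2)
    then obtain e where e: "2 * d = gcd c (int N) * e" by (rule dvdE)
    \<comment> \<open>Bezout, scaled by \<open>e\<close>, solves
      \<open>c * j + N * k = 2 * d\<close>; then the diagonal entries become \<open>- 1\<close> and
      the lower left entry 0 modulo \<open>N\<close>.\<close>
    obtain x y where xy: "x * c + y * int N = gcd c (int N)" using bezout_int by blast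
    define j k where "j = x * e" and "k = y * e"
    have "c * j + int N * k = (x * c + y * int N) * e" by (simp add: j_def k_def algebra_simps)
    then have jk: "c * j + int N * k = 2 * d" by (simp only: xy e)
    let ?\<gamma> = "?g' ** mat2 1 j 0 1 ** minv ?g"
    have "- (a * d + b * c - a * c * j) - 1 = int N * (- a * k)"
      using one arg_cong[OF jk, of "\<lambda>x. a * x"] by (simp add: algebra_simps)
    then have 1: "int N dvd - (a * d + b * c - a * c * j) - 1" by (simp only: dvd_triv_left)
    have "- (- 2 * c * d + c * c * j) = int N * (c * k)"
      using arg_cong[OF jk, of "\<lambda>x. c * x"] by (simp add: algebra_simps)
    then have 2: "int N dvd - (- 2 * c * d + c * c * j)" by (simp only: dvd_triv_left)
    have "mneg ?\<gamma> \<in> Gamma1 N"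
      unfolding Gamma1_iff det_mneg mneg_nth using det[of j] 1 2 unfolding entries mat2_nth by blast
    moreover have "p1_act (mneg ?\<gamma>) (p1_act ?g Infty) = p1_neg (p1_act ?g Infty)"
      using act[of j] det[of j] by (simp only: p1_act_mneg)
    ultimately show ?thesis by blast
  qed
qed

text \<open>The hypothesis is tested at the cusp \<open>1 / c\<close>. A matrix that carries it to
  \<open>- 1 / c\<close> sends the vector \<open>(1, c)\<close> to \<open>(1, - c)\<close> or to its
  negative; congruences modulo \<open>N\<close> give the second alternative for the plus sign and
  the first one for the minus sign.\<close>

lemma divisor_of_fixed:
  assumes fixed: "cusps_fixed_by_conjugation (Gamma1 N)" and c: "c dvd N" "c > 0"
  shows "c dvd 2 \<or> N dvd 2 * c"
proof -
  obtain \<gamma> where \<gamma>: "\<gamma> \<in> Gamma1 N" "p1_act \<gamma> (p1_point 1 (of_nat c)) = p1_neg (p1_point 1 (of_nat c))"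
    using fixed unfolding cusps_fixed_iff by blast
  obtain p q r v where m: "\<gamma> = mat2 p q r v" by (rule mat2_cases)
  have det: "p * v - q * r = 1" and N: "int N dvd p - 1" "int N dvd v - 1" "int N dvd r"
    using \<gamma>(1) by (simp_all add: Gamma1_iff m)
  let ?x = "p + q * int c" and ?y = "r + v * int c"
  have "p1_point (of_int ?x) (of_int ?y) = p1_neg (p1_point 1 (of_nat c))"
    using p1_act_point[of \<gamma> 1 "of_nat c"] \<gamma> det by (simp add: m Gamma1_iff)
  then have "(of_int ?y :: rat) \<noteq> 0" "of_int ?x / of_int ?y = - (1 / of_nat c :: rat)"
    using c(2) by (auto simp: p1_point_def p1_neg_def split: if_splits)
  then have "(of_int ?x * of_nat c :: rat) = - of_int ?y"
    using c(2) by (simp add: field_simps)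
  then have "(of_int (?x * int c) :: rat) = of_int (- ?y)" by simp
  then have y: "?y = - (?x * int c)" by (simp only: of_int_eq_iff)
  \<comment> \<open>The image of a primitive vector is primitive: applying the inverse matrix
    exhibits \<open>?x\<close> as a divisor of 1.\<close>
  have "?x * (v + q * int c) = v * ?x - q * ?y" unfolding y by (simp add: algebra_simps)
  also have "\<dots> = 1" using det by (simp add: algebra_simps)
  finally have "?x = 1 \<or> ?x = - 1" by (auto simp: zmult_eq_1_iff)
  then show ?thesis
  proof
    assume x: "?x = 1"
    then have "2 * int c = - (r + (v - 1) * int c)" using y by (simp add: algebra_simps)
    then have "int N dvd 2 * int c" using N by (simp add: dvd_add)
    then have "int N dvd int (2 * c)" by simp
    then show ?thesis by (simp only: int_dvd_int_iff simp_thms)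
  next
    assume x: "?x = - 1"
    then have "(2 :: int) = - ((p - 1) + q * int c)" by simp
    moreover have "int c dvd p - 1" using N(1) c(1) by (meson dvd_trans int_dvd_int_iff)
    ultimately have "int c dvd 2" by (simp only: dvd_minus_iff dvd_add_times_triv_right_iff)
    then have "int c dvd int 2" by simp
    then show ?thesis by (simp only: int_dvd_int_iff simp_thms)
  qed
qed

theorem Gamma1_cusps_fixed_iff:
  assumes "N > 0" "N \<noteq> 8"
  shows "cusps_fixed_by_conjugation (Gamma1 N) \<longleftrightarrow> (\<exists>p::nat. prime p \<and> N dvd 2 * p)"
proof
  assume fixed: "cusps_fixed_by_conjugation (Gamma1 N)"
  note div = divisor_of_fixed[OF fixed]
  \<comment> \<open>An odd prime divisor does not divide 2, so the dichotomy leaves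
    \<open>N dvd 2 * q\<close>.\<close>
  have odd: "\<exists>p::nat. prime p \<and> N dvd 2 * p" if "prime q" "q dvd N" "q \<noteq> 2" for q :: nat
    using div[OF that(2)] that primes_dvd_imp_eq[of q 2] prime_gt_0_nat[of q] two_is_prime_nat by blast
  \<comment> \<open>The divisor 4 forces \<open>N\<close> to be 4 or 8. The value 8 passes every
    test of \<open>divisor_of_fixed\<close> but does not divide twice a prime; here
    \<open>N \<noteq> 8\<close> enters.\<close>
  have four: "\<exists>p::nat. prime p \<and> N dvd 2 * p" if 4: "4 dvd N"
  proof -
    have "N dvd 8" using div[OF 4] by auto
    then obtain k where "8 = N * k" by (rule dvdE)
    moreover obtain l where "N = 4 * l" using 4 by (rule dvdE)
    ultimately have kl: "N * k = 8" "N = 4 * l" by simp_all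
    then have "l * k = 2" by (simp add: mult.commute)
    then have "l dvd 2" by (intro dvdI[of _ _ k]) simp
    then have "l = 1 \<or> l = 2" using two_is_prime_nat by (simp add: prime_nat_iff)
    then have "N = 4" using kl assms(2) by auto
    then show ?thesis using two_is_prime_nat by (intro exI[of _ 2]) simp
  qed
  show "\<exists>p::nat. prime p \<and> N dvd 2 * p"
  proof (cases "N = 1")
    case True
    then show ?thesis using two_is_prime_nat by auto
  next
    case False
    then obtain q where q: "prime q" "q dvd N" using prime_factor_nat by blast
    show ?thesis
    proof (cases "q = 2")
      case True
      then obtain m where m: "N = 2 * m" using q by (auto elim: dvdE)
      show ?thesis
      proof (cases "m = 1")
        case True
        then show ?thesis using m two_is_prime_nat by auto
      next
        case False
        then obtain r where "prime r" "r dvd m" using prime_factor_nat by blast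
        then show ?thesis using odd[of r] four m by (cases "r = 2") auto
      qed
    qed (use odd q in blast)
  qed
next
  assume "\<exists>p::nat. prime p \<and> N dvd 2 * p"
  then obtain p :: nat where p: "prime p" "N dvd 2 * p" by blast
  show "cusps_fixed_by_conjugation (Gamma1 N)" unfolding cusps_fixed_iff
  proof
    fix x
    obtain g where g: "det g = 1" "x = p1_act g Infty" by (rule p1_transitive)
    obtain a b c d where m: "g = mat2 a b c d" by (rule mat2_cases)
    have "gcd c (int N) dvd 2 \<or> int N dvd 2 * c"
    \<comment> \<open>If \<open>p\<close> divides \<open>c\<close>, then \<open>N\<close> divides
      \<open>2 * c\<close>; otherwise the gcd is a divisor of \<open>2 * p\<close> prime to
      \<open>p\<close>.\<close>
    proof (cases "int p dvd c")
      case True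
      have "int N dvd int (2 * p)" using p(2) by (simp only: int_dvd_int_iff)
      also have "int (2 * p) dvd 2 * c" using True by simp
      finally show ?thesis by simp
    next
      case False
      have "prime (int p)" using p(1) by simp
      then have "coprime (int p) c" using False by (rule prime_imp_coprime)
      then have "coprime (gcd c (int N)) (int p)"
        using coprime_divisors[of "gcd c (int N)" c "int p" "int p"] by (simp add: coprime_commute)
      moreover have "int N dvd int (2 * p)" using p(2) by (simp only: int_dvd_int_iff)
      then have "gcd c (int N) dvd 2 * int p" by (intro dvd_trans[OF gcd_dvd2]) simp
      ultimately show ?thesis by (simp add: coprime_dvd_mult_left_iff)
    qed
    then show "\<exists>\<gamma>\<in>Gamma1 N. p1_act \<gamma> x = p1_neg x"
      using conjugate_cusp[of a b c d N] g m by simp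
  qed
qed

theorem theorem1p3:
  "(\<forall>\<Gamma>. finite_index_subgroup \<Gamma> \<and> cusps_fixed_by_conjugation \<Gamma> \<longrightarrow>
       perfect_after_inverting (2 * Lcm (cusp_width \<Gamma> ` cusps \<Gamma>)) \<Gamma>) \<and>
   (\<forall>N::nat. N > 0 \<and> N \<noteq> 8 \<longrightarrow>
       (cusps_fixed_by_conjugation (Gamma1 N) \<longleftrightarrow> (\<exists>p::nat. prime p \<and> N dvd 2 * p)))"
proof (intro conjI allI impI)
  fix \<Gamma> assume \<Gamma>: "finite_index_subgroup \<Gamma> \<and> cusps_fixed_by_conjugation \<Gamma>"
  interpret finite_index \<Gamma> by standard (use \<Gamma> in blast)
  \<comment> \<open>The least common multiple is positive, hence a possible denominator, because it
    divides a finite product of positive widths.\<close>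
  have "Lcm (width ` X) dvd (\<Prod>x\<in>X. width x)"
    by (rule Lcm_least) (auto intro: dvd_prodI finite_X)
  moreover have "(\<Prod>x\<in>X. width x) > 0" using width(1) by (intro prod_pos) blast
  ultimately have "Lcm (width ` X) > 0" by (rule dvd_pos_nat[rotated])
  then interpret inverted_widths \<Gamma> "Lcm (width ` X)" by unfold_locales auto
  show "perfect_after_inverting (2 * Lcm (cusp_width \<Gamma> ` cusps \<Gamma>)) \<Gamma>"
    unfolding cusp_widths by (rule perfect)
next
  fix N :: nat assume "N > 0 \<and> N \<noteq> 8"
  then show "cusps_fixed_by_conjugation (Gamma1 N) \<longleftrightarrow> (\<exists>p::nat. prime p \<and> N dvd 2 * p)"
    by (intro Gamma1_cusps_fixed_iff) auto
qed

end
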